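(* A three-dimensional paracontact metric manifold $(M,\varphi,\xi,\eta,g)$ is a paracontact Ricci soliton, i.e. $\mathcal L_\xi g+\varrho=\lambda g$ for some real constant $\lambda$, if and only if the manifold is locally described, with respect to a local $\varphi$-basis $\{\xi,e,\varphi e\}$, by $$[\xi,e]=-\varepsilon a_1 e+(a_3-a_1+1)\varphi e,\quad [\xi,\varphi e]=(a_3+a_1+1)e+\varepsilon a_1\varphi e,\quad [e,\varphi e]=-2\xi+a_4e-a_5\varphi e,$$ for some $\varepsilon\in\{1,-1\}$ and some smooth functions $a_1,a_3,a_4,a_5$ satisfying $$\xi(a_4)-e(a_3)+\varepsilon a_1a_4-a_5(a_3-a_1+1)=0,$$ $$\xi(a_5)-\varphi e(a_3)-\varepsilon a_1a_5-a_4(a_3+a_1+1)=0,$$ $$(e+\varepsilon\varphi e)(a_1)+2\varepsilon a_1a_4+2a_1a_5=0,$$ together with $$\lambda=-2,\qquad \xi(a_1)+2\varepsilon a_1a_3=2a_1,\qquad r=-6,$$ where $\lambda$ is the soliton constant and $r$ is the scalar curvature of $g$. In particular, the Ricci soliton is necessarily expanding (that is, $\lambda<0$).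
   Context: An almost paracontact structure on a connected smooth manifold $M$ of dimension $3$ is a triple $(\varphi,\xi,\eta)$ of a $(1,1)$-tensor, a global vector field and a $1$-form with $\varphi(\xi)=0$, $\eta\circ\varphi=0$, $\eta(\xi)=1$, $\varphi^2=\mathrm{Id}-\eta\otimes\xi$, and such that the $\pm1$-eigenbundles of $\varphi|_{\ker\eta}$ both have rank $1$. A pseudo-Riemannian metric $g$ is compatible if $g(\varphi X,\varphi Y)=-g(X,Y)+\eta(X)\eta(Y)$; then $(\varphi,\xi,\eta,g)$ is an almost paracontact metric structure, $\eta=g(\xi,\cdot)$, and $g$ has signature $(2,1)$. It is a paracontact metric structure if $d\eta(X,Y)=g(X,\varphi Y)$ for all $X,Y$, with the convention $d\eta(X,Y)=\frac12\big(X\eta(Y)-Y\eta(X)-\eta([X,Y])\big)$. $\xi$ is called the Reeb vector field. A (local) $\varphi$-basis is a pseudo-orthonormal local frame $\{\xi,e,\varphi e\}$ with $\xi,e$ space-like unit and $\varphi e$ time-like unit. $\varrho$ denotes the Ricci tensor (standard sign, positive on round spheres). A Ricci soliton given by $\mathcal L_Xg+\varrho=\lambda g$ is shrinking, steady or expanding according to $\lambda>0$, $\lambda=0$, $\lambda<0$. *)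

theory Defs
  imports "HOL-Analysis.Analysis" "HOL-Library.Function_Algebras"
begin

section \<open>Smooth functions on Euclidean space\<close>

text \<open>Both notions are meant for open sets \<open>S\<close>, where \<open>at x within S = at x\<close>.\<close>

primrec times_cont_diff_on ::
  "nat \<Rightarrow> 'a::euclidean_space set \<Rightarrow> ('a \<Rightarrow> 'b::real_normed_vector) \<Rightarrow> bool" where
  "times_cont_diff_on 0 S f \<longleftrightarrow> continuous_on S f"
| "times_cont_diff_on (Suc k) S f \<longleftrightarrow>
     f differentiable_on S \<and>
     (\<forall>v. times_cont_diff_on k S (\<lambda>x. frechet_derivative f (at x) v))"

definition smooth_on :: "'a::euclidean_space set \<Rightarrow> ('a \<Rightarrow> 'b::real_normed_vector) \<Rightarrow> bool" where
  "smooth_on S f \<longleftrightarrow> (\<forall>k. times_cont_diff_on k S f)"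


section \<open>Smooth three-dimensional manifolds\<close>

text \<open>
  The manifold is the whole type \<open>'a\<close>. A chart is a pair of its domain and a coordinate map;
  values of the coordinate map outside the domain are irrelevant. The atlas need not be maximal.
\<close>

type_synonym 'a atlas = "('a set \<times> ('a \<Rightarrow> real ^ 3)) set"

definition smooth_manifold :: "('a::{t2_space,second_countable_topology}) atlas \<Rightarrow> bool" where
  "smooth_manifold A \<longleftrightarrow>
     (\<Union>(U, c)\<in>A. U) = UNIV \<and>
     (\<forall>(U, c)\<in>A. open U \<and> open (c ` U) \<and> homeomorphism U (c ` U) c (inv_into U c)) \<and>
     (\<forall>(U, c)\<in>A. \<forall>(V, d)\<in>A. smooth_on (c ` (U \<inter> V)) (d \<circ> inv_into U c))"

definition smooth_fun :: "('a::topological_space) atlas \<Rightarrow> 'a set \<Rightarrow> ('a \<Rightarrow> real) \<Rightarrow> bool" where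
  "smooth_fun A W f \<longleftrightarrow> (\<forall>(U, c)\<in>A. smooth_on (c ` (U \<inter> W)) (f \<circ> inv_into U c))"

definition smooth_near :: "('a::topological_space) atlas \<Rightarrow> 'a \<Rightarrow> ('a \<Rightarrow> real) \<Rightarrow> bool" where
  "smooth_near A p f \<longleftrightarrow> (\<exists>W. open W \<and> p \<in> W \<and> smooth_fun A W f)"


section \<open>Tangent vectors and vector fields\<close>

text \<open>
  A tangent vector at \<open>p\<close> is a directional derivative operator
  \<open>\<Sum>i. v\<^sub>i \<partial>/\<partial>x\<^sub>i\<close> acting on the functions that are smooth near \<open>p\<close>. It is set to \<open>0\<close> on all
  other functions, so that equality of tangent vectors is equality of HOL functions.
  Addition, subtraction and zero are those of \<open>HOL-Library.Function_Algebras\<close>.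
\<close>

type_synonym 'a tvec = "('a \<Rightarrow> real) \<Rightarrow> real"
type_synonym 'a vfield = "'a \<Rightarrow> 'a tvec"

definition tv_scale :: "real \<Rightarrow> 'a tvec \<Rightarrow> 'a tvec" (infixr "*\<^sub>T" 75) where
  "r *\<^sub>T v = (\<lambda>f. r * v f)"

definition dir_deriv ::
  "('a::topological_space) atlas \<Rightarrow> 'a set \<times> ('a \<Rightarrow> real ^ 3) \<Rightarrow> real ^ 3 \<Rightarrow> 'a vfield" where
  "dir_deriv A ch v p = (\<lambda>f.
     if smooth_near A p f
     then frechet_derivative (f \<circ> inv_into (fst ch) (snd ch)) (at (snd ch p)) v
     else 0)"

definition tangent_space :: "('a::topological_space) atlas \<Rightarrow> 'a \<Rightarrow> 'a tvec set" where
  "tangent_space A p = {dir_deriv A ch v p | ch v. ch \<in> A \<and> p \<in> fst ch}"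

text \<open>Smooth vector fields on an open set \<open>U\<close>; values outside \<open>U\<close> are irrelevant.\<close>

definition vector_fields :: "('a::topological_space) atlas \<Rightarrow> 'a set \<Rightarrow> 'a vfield set" where
  "vector_fields A U = {X.
     (\<forall>p\<in>U. X p \<in> tangent_space A p) \<and>
     (\<forall>W f. open W \<and> W \<subseteq> U \<and> smooth_fun A W f \<longrightarrow> smooth_fun A W (\<lambda>p. X p f))}"

definition lie_bracket ::
  "('a::topological_space) atlas \<Rightarrow> 'a vfield \<Rightarrow> 'a vfield \<Rightarrow> 'a vfield" where
  "lie_bracket A X Y p = (\<lambda>f.
     if smooth_near A p f then X p (\<lambda>q. Y q f) - Y p (\<lambda>q. X q f) else 0)"


section \<open>Tensor fields\<close>

text \<open>
  Tensor fields are families of multilinear maps on the tangent spaces; smoothness means that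
  smooth local vector fields are mapped to smooth functions or smooth vector fields.
\<close>

definition one_form ::
  "('a::topological_space) atlas \<Rightarrow> ('a \<Rightarrow> 'a tvec \<Rightarrow> real) \<Rightarrow> bool" where
  "one_form A \<eta> \<longleftrightarrow>
     (\<forall>p. \<forall>v\<in>tangent_space A p. \<forall>w\<in>tangent_space A p. \<forall>s t.
        \<eta> p (s *\<^sub>T v + t *\<^sub>T w) = s * \<eta> p v + t * \<eta> p w) \<and>
     (\<forall>U. open U \<longrightarrow> (\<forall>X\<in>vector_fields A U. smooth_fun A U (\<lambda>p. \<eta> p (X p))))"

definition endomorphism_field ::
  "('a::topological_space) atlas \<Rightarrow> ('a \<Rightarrow> 'a tvec \<Rightarrow> 'a tvec) \<Rightarrow> bool" where
  "endomorphism_field A \<phi> \<longleftrightarrow>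
     (\<forall>p. \<forall>v\<in>tangent_space A p. \<phi> p v \<in> tangent_space A p) \<and>
     (\<forall>p. \<forall>v\<in>tangent_space A p. \<forall>w\<in>tangent_space A p. \<forall>s t.
        \<phi> p (s *\<^sub>T v + t *\<^sub>T w) = s *\<^sub>T \<phi> p v + t *\<^sub>T \<phi> p w) \<and>
     (\<forall>U. open U \<longrightarrow> (\<forall>X\<in>vector_fields A U. (\<lambda>p. \<phi> p (X p)) \<in> vector_fields A U))"

type_synonym 'a metric_field = "'a \<Rightarrow> 'a tvec \<Rightarrow> 'a tvec \<Rightarrow> real"

definition pseudo_riemannian_metric ::
  "('a::topological_space) atlas \<Rightarrow> 'a metric_field \<Rightarrow> bool" where
  "pseudo_riemannian_metric A g \<longleftrightarrow>
     (\<forall>p. \<forall>u\<in>tangent_space A p. \<forall>v\<in>tangent_space A p. \<forall>w\<in>tangent_space A p. \<forall>s t.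
        g p (s *\<^sub>T v + t *\<^sub>T w) u = s * g p v u + t * g p w u) \<and>
     (\<forall>p. \<forall>v\<in>tangent_space A p. \<forall>w\<in>tangent_space A p. g p v w = g p w v) \<and>
     (\<forall>p. \<forall>v\<in>tangent_space A p. (\<forall>w\<in>tangent_space A p. g p v w = 0) \<longrightarrow> v = 0) \<and>
     (\<forall>U. open U \<longrightarrow> (\<forall>X\<in>vector_fields A U. \<forall>Y\<in>vector_fields A U.
        smooth_fun A U (\<lambda>p. g p (X p) (Y p))))"


section \<open>Paracontact metric structures\<close>

definition almost_paracontact ::
  "('a::topological_space) atlas \<Rightarrow> ('a \<Rightarrow> 'a tvec \<Rightarrow> 'a tvec) \<Rightarrow> 'a vfield
    \<Rightarrow> ('a \<Rightarrow> 'a tvec \<Rightarrow> real) \<Rightarrow> bool" where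
  "almost_paracontact A \<phi> \<xi> \<eta> \<longleftrightarrow>
     endomorphism_field A \<phi> \<and> \<xi> \<in> vector_fields A UNIV \<and> one_form A \<eta> \<and>
     (\<forall>p. \<phi> p (\<xi> p) = 0) \<and>
     (\<forall>p. \<forall>v\<in>tangent_space A p. \<eta> p (\<phi> p v) = 0) \<and>
     (\<forall>p. \<eta> p (\<xi> p) = 1) \<and>
     (\<forall>p. \<forall>v\<in>tangent_space A p. \<phi> p (\<phi> p v) = v - \<eta> p v *\<^sub>T \<xi> p) \<and>
     (\<forall>p. vector_space.dim (*\<^sub>T) {v \<in> tangent_space A p. \<eta> p v = 0 \<and> \<phi> p v = v} = 1) \<and>
     (\<forall>p. vector_space.dim (*\<^sub>T) {v \<in> tangent_space A p. \<eta> p v = 0 \<and> \<phi> p v = - v} = 1)"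

definition exterior_derivative ::
  "('a::topological_space) atlas \<Rightarrow> ('a \<Rightarrow> 'a tvec \<Rightarrow> real)
    \<Rightarrow> 'a vfield \<Rightarrow> 'a vfield \<Rightarrow> 'a \<Rightarrow> real" where
  "exterior_derivative A \<eta> X Y p =
     1 / 2 * (X p (\<lambda>q. \<eta> q (Y q)) - Y p (\<lambda>q. \<eta> q (X q)) - \<eta> p (lie_bracket A X Y p))"

definition paracontact_metric ::
  "('a::topological_space) atlas \<Rightarrow> ('a \<Rightarrow> 'a tvec \<Rightarrow> 'a tvec) \<Rightarrow> 'a vfield
    \<Rightarrow> ('a \<Rightarrow> 'a tvec \<Rightarrow> real) \<Rightarrow> 'a metric_field \<Rightarrow> bool" where
  "paracontact_metric A \<phi> \<xi> \<eta> g \<longleftrightarrow>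
     almost_paracontact A \<phi> \<xi> \<eta> \<and> pseudo_riemannian_metric A g \<and>
     (\<forall>p. \<forall>v\<in>tangent_space A p. \<forall>w\<in>tangent_space A p.
        g p (\<phi> p v) (\<phi> p w) = - g p v w + \<eta> p v * \<eta> p w) \<and>
     (\<forall>U. open U \<longrightarrow> (\<forall>X\<in>vector_fields A U. \<forall>Y\<in>vector_fields A U. \<forall>p\<in>U.
        exterior_derivative A \<eta> X Y p = g p (X p) (\<phi> p (Y p))))"

definition phi_basis ::
  "('a::topological_space) atlas \<Rightarrow> ('a \<Rightarrow> 'a tvec \<Rightarrow> 'a tvec) \<Rightarrow> 'a vfield
    \<Rightarrow> 'a metric_field \<Rightarrow> 'a set \<Rightarrow> 'a vfield \<Rightarrow> bool" where
  "phi_basis A \<phi> \<xi> g U e \<longleftrightarrow>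
     open U \<and> e \<in> vector_fields A U \<and>
     (\<forall>p\<in>U. g p (\<xi> p) (\<xi> p) = 1 \<and> g p (e p) (e p) = 1 \<and> g p (\<phi> p (e p)) (\<phi> p (e p)) = - 1 \<and>
            g p (\<xi> p) (e p) = 0 \<and> g p (\<xi> p) (\<phi> p (e p)) = 0 \<and> g p (e p) (\<phi> p (e p)) = 0)"


section \<open>Levi-Civita connection and curvature\<close>

text \<open>
  A connection acts on local smooth vector fields over every open set, and the axioms are
  imposed on each of them. This determines the Levi-Civita connection on local smooth vector
  fields; its values on other arguments are irrelevant.
\<close>

definition is_connection ::
  "('a::topological_space) atlas \<Rightarrow> ('a vfield \<Rightarrow> 'a vfield \<Rightarrow> 'a vfield) \<Rightarrow> bool" where
  "is_connection A D \<longleftrightarrow>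
     (\<forall>U. open U \<longrightarrow> (\<forall>X\<in>vector_fields A U. \<forall>Y\<in>vector_fields A U.
        D X Y \<in> vector_fields A U \<and>
        (\<forall>Z\<in>vector_fields A U. \<forall>p\<in>U.
           D (\<lambda>q. X q + Z q) Y p = D X Y p + D Z Y p \<and>
           D X (\<lambda>q. Y q + Z q) p = D X Y p + D X Z p) \<and>
        (\<forall>f. smooth_fun A U f \<longrightarrow> (\<forall>p\<in>U.
           D (\<lambda>q. f q *\<^sub>T X q) Y p = f p *\<^sub>T D X Y p \<and>
           D X (\<lambda>q. f q *\<^sub>T Y q) p = X p f *\<^sub>T Y p + f p *\<^sub>T D X Y p))))"

definition is_levi_civita ::
  "('a::topological_space) atlas \<Rightarrow> 'a metric_field
    \<Rightarrow> ('a vfield \<Rightarrow> 'a vfield \<Rightarrow> 'a vfield) \<Rightarrow> bool" where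
  "is_levi_civita A g D \<longleftrightarrow>
     is_connection A D \<and>
     (\<forall>U. open U \<longrightarrow> (\<forall>X\<in>vector_fields A U. \<forall>Y\<in>vector_fields A U. \<forall>p\<in>U.
        D X Y p - D Y X p = lie_bracket A X Y p \<and>
        (\<forall>Z\<in>vector_fields A U.
           X p (\<lambda>q. g q (Y q) (Z q)) = g p (D X Y p) (Z p) + g p (Y p) (D X Z p))))"

definition levi_civita ::
  "('a::topological_space) atlas \<Rightarrow> 'a metric_field \<Rightarrow> 'a vfield \<Rightarrow> 'a vfield \<Rightarrow> 'a vfield" where
  "levi_civita A g = (SOME D. is_levi_civita A g D)"

definition curvature ::
  "('a::topological_space) atlas \<Rightarrow> 'a metric_field
    \<Rightarrow> 'a vfield \<Rightarrow> 'a vfield \<Rightarrow> 'a vfield \<Rightarrow> 'a vfield" where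
  "curvature A g X Y Z p =
     (let D = levi_civita A g in D X (D Y Z) p - D Y (D X Z) p - D (lie_bracket A X Y) Z p)"

definition chart_at :: "'a atlas \<Rightarrow> 'a \<Rightarrow> 'a set \<times> ('a \<Rightarrow> real ^ 3)" where
  "chart_at A p = (SOME ch. ch \<in> A \<and> p \<in> fst ch)"

definition coord_field ::
  "('a::topological_space) atlas \<Rightarrow> 'a set \<times> ('a \<Rightarrow> real ^ 3) \<Rightarrow> 3 \<Rightarrow> 'a vfield" where
  "coord_field A ch i = dir_deriv A ch (axis i 1)"

text \<open>
  The Ricci tensor \<open>\<rho>(Y, Z)\<close> is the trace of \<open>X \<mapsto> R(X, Y)Z\<close>, so it is positive on round
  spheres. The trace is taken in the coordinate basis \<open>\<partial>\<^sub>i\<close> of a chart \<open>x\<close> at \<open>p\<close>, and the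
  \<open>i\<close>-th component of a tangent vector in this basis is its value on the coordinate
  function \<open>x\<^sub>i\<close>. The arguments \<open>Y\<close> and \<open>Z\<close> are vector fields that are smooth near \<open>p\<close>.
\<close>

definition ricci ::
  "('a::topological_space) atlas \<Rightarrow> 'a metric_field \<Rightarrow> 'a vfield \<Rightarrow> 'a vfield \<Rightarrow> 'a \<Rightarrow> real" where
  "ricci A g Y Z p =
     (let ch = chart_at A p
      in \<Sum>i\<in>UNIV. curvature A g (coord_field A ch i) Y Z p (\<lambda>q. snd ch q $ i))"

text \<open>The trace \<open>\<Sum>i j. g\<^sup>i\<^sup>j \<rho>\<^sub>i\<^sub>j\<close> of the Ricci tensor with respect to \<open>g\<close>.\<close>

definition scalar_curvature ::
  "('a::topological_space) atlas \<Rightarrow> 'a metric_field \<Rightarrow> 'a \<Rightarrow> real" where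
  "scalar_curvature A g p =
     (let ch = chart_at A p; E = coord_field A ch;
          G = (\<chi> i j. g p (E i p) (E j p)) :: real ^ 3 ^ 3
      in \<Sum>i\<in>UNIV. \<Sum>j\<in>UNIV. matrix_inv G $ i $ j * ricci A g (E i) (E j) p)"

definition lie_derivative_metric ::
  "('a::topological_space) atlas \<Rightarrow> 'a vfield \<Rightarrow> 'a metric_field
    \<Rightarrow> 'a vfield \<Rightarrow> 'a vfield \<Rightarrow> 'a \<Rightarrow> real" where
  "lie_derivative_metric A V g X Y p =
     V p (\<lambda>q. g q (X q) (Y q)) - g p (lie_bracket A V X p) (Y p) - g p (X p) (lie_bracket A V Y p)"

text \<open>
  A paracontact Ricci soliton is a paracontact metric manifold for which the equation below
  holds with \<open>V = \<xi>\<close>.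
\<close>

definition ricci_soliton ::
  "('a::topological_space) atlas \<Rightarrow> 'a metric_field \<Rightarrow> 'a vfield \<Rightarrow> real \<Rightarrow> bool" where
  "ricci_soliton A g V l \<longleftrightarrow>
     (\<forall>U. open U \<longrightarrow> (\<forall>X\<in>vector_fields A U. \<forall>Y\<in>vector_fields A U. \<forall>p\<in>U.
        lie_derivative_metric A V g X Y p + ricci A g X Y p = l * g p (X p) (Y p)))"

abbreviation expanding :: "real \<Rightarrow> bool" where
  "expanding l \<equiv> l < 0"

end

(*
  In a local phi-basis the structure functions c, a1, a3, a4, a5 (c is the e-component of -[xi, e])
  determine the Levi-Civita connection by the Koszul formula, hence the Ricci tensor. The (xi, xi)
  component of the soliton equation says that a1^2 - c^2 = (lambda + 2) / 2 is constant, while the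
  components on the contact distribution give xi(a1^2 - c^2) = 4 (a1^2 - c^2). So c^2 = a1^2 and
  lambda = -2.

  It remains to choose one sign in c = +- a1 near a given point, also where a1 vanishes. The
  functions f = a1 + c and k = c - a1 satisfy f k = 0; f has logarithmic derivatives along xi and
  e + phi e, and k has one along e - phi e. If both were nonzero arbitrarily close to the point, a
  surface tangent to xi and e + phi e on which f is nonzero would meet a curve tangent to e - phi e
  on which k is nonzero, a contradiction.

  Conversely, the listed equations are exactly the components of the soliton equation, and these
  suffice because both sides are tensorial.
*)

theory Submission
  imports Defs
begin

section \<open>Calculus of smooth functions\<close>

text \<open>The sign \<epsilon> must be constant on a neighbourhood, whereas \<open>f k = 0\<close>
  decides it only pointwise: for smooth functions the zero sets of \<open>f\<close> and
  \<open>k\<close> could a priori interlace near the point. What excludes this is that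
  \<open>V f = \<beta> f\<close> is a linear differential equation along V, so that
  \<open>f \<noteq> 0\<close> propagates along V. The count 2 + 1 = 3 is why \<open>f\<close> is
  followed in two directions and \<open>k\<close> in the remaining one. The fields need not commute:
  the surface is made by following one field after the other, and only its continuity enters the
  intersection argument. The other obstacle lies in the definitions. The Levi-Civita connection is a
  choice, so one has to be constructed, and both curvature traces are taken in a chart, while the
  geometry is visible in a \<phi>-basis. Tensoriality moves everything to frames. The condition r =
  -6 is the trace of the soliton equation: the Lie derivative of g along \<xi> is trace-free, so r =
  3 \<lambda>. In the converse this condition fixes \<rho>(e, e) - \<rho>(\<phi>e, \<phi>e).\<close>

lemma times_cont_diff_on_cong:
  assumes "open S" "\<And>x. x \<in> S \<Longrightarrow> f x = h x"
  shows "times_cont_diff_on k S f \<longleftrightarrow> times_cont_diff_on k S h"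
  using assms(2)
proof (induction k arbitrary: f h)
  case 0
  then show ?case by (simp cong: continuous_on_cong)
next
  case (Suc k)
  have d: "f differentiable_on S \<longleftrightarrow> h differentiable_on S"
    unfolding differentiable_on_eq_differentiable_at[OF assms(1)] differentiable_def
    using Suc.prems assms(1) has_derivative_transform_within_open
    by (metis (no_types, lifting))
  have "frechet_derivative f (at x) = frechet_derivative h (at x)"
    if "x \<in> S" "f differentiable_on S" for x
    using that assms(1) Suc.prems
    by (intro frechet_derivative_transform_within_open[where X = S])
       (auto simp: differentiable_on_eq_differentiable_at)
  then have "times_cont_diff_on k S (\<lambda>x. frechet_derivative f (at x) v)
      \<longleftrightarrow> times_cont_diff_on k S (\<lambda>x. frechet_derivative h (at x) v)"
    if "f differentiable_on S" for v
    using that by (intro Suc.IH) auto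
  with d show ?case by auto
qed

text \<open>Lets every closure proof name its derivative explicitly instead of handling
  \<open>frechet_derivative\<close>; openness of \<open>S\<close> makes the two agree on all of
  \<open>S\<close>, so that the agreement survives further differentiation.\<close>

lemma times_cont_diff_on_SucI:
  assumes "open S" "\<And>x. x \<in> S \<Longrightarrow> (f has_derivative f' x) (at x)"
    and "\<And>v. times_cont_diff_on k S (\<lambda>x. f' x v)"
  shows "times_cont_diff_on (Suc k) S f"
proof -
  have "frechet_derivative f (at x) = f' x" if "x \<in> S" for x
    using assms(2)[OF that] frechet_derivative_at by metis
  then have "times_cont_diff_on k S (\<lambda>x. frechet_derivative f (at x) v)" for v
    using assms(1,3) by (subst times_cont_diff_on_cong[where h = "\<lambda>x. f' x v"]) auto
  moreover have "f differentiable_on S"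
    using assms(1,2) by (auto simp: differentiable_on_eq_differentiable_at differentiable_def)
  ultimately show ?thesis by simp
qed

lemma times_cont_diff_on_SucD:
  assumes "open S" "times_cont_diff_on (Suc k) S f" "x \<in> S"
  shows "(f has_derivative frechet_derivative f (at x)) (at x)"
  using assms by (auto simp: differentiable_on_eq_differentiable_at frechet_derivative_works)

lemma times_cont_diff_on_subset:
  assumes "times_cont_diff_on k S f" "T \<subseteq> S"
  shows "times_cont_diff_on k T f"
  using assms(1)
proof (induction k arbitrary: f)
  case 0
  then show ?case using assms(2) by (auto intro: continuous_on_subset)
next
  case (Suc k)
  then show ?case using assms(2) by (auto intro: differentiable_on_subset)
qed

lemma times_cont_diff_on_pred:
  "times_cont_diff_on (Suc k) S f \<Longrightarrow> times_cont_diff_on k S f"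
proof (induction k arbitrary: f)
  case 0
  then show ?case by (auto intro: differentiable_imp_continuous_on)
next
  case (Suc k)
  then show ?case by (metis times_cont_diff_on.simps(2))
qed

lemma times_cont_diff_on_local:
  assumes "\<And>x. x \<in> S \<Longrightarrow> \<exists>T. open T \<and> x \<in> T \<and> T \<subseteq> S \<and> times_cont_diff_on k T f"
  shows "times_cont_diff_on k S f"
  using assms
proof (induction k arbitrary: f)
  case 0
  have "continuous (at x) f" if x: "x \<in> S" for x
  proof -
    obtain T where "open T" "x \<in> T" "continuous_on T f" using 0[OF x] by auto
    then show ?thesis by (simp add: continuous_on_eq_continuous_at)
  qed
  then show ?case by (simp add: continuous_at_imp_continuous_on)
next
  case (Suc k)
  have "f differentiable (at x)" if x: "x \<in> S" for x
  proof -
    obtain T where "open T" "x \<in> T" "f differentiable_on T" using Suc.prems[OF x] by auto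
    then show ?thesis by (simp add: differentiable_on_eq_differentiable_at)
  qed
  then have "f differentiable_on S"
    by (simp add: differentiable_at_imp_differentiable_on)
  moreover have "times_cont_diff_on k S (\<lambda>x. frechet_derivative f (at x) v)" for v
  proof (rule Suc.IH)
    fix x assume "x \<in> S"
    from Suc.prems[OF this]
    show "\<exists>T. open T \<and> x \<in> T \<and> T \<subseteq> S \<and>
        times_cont_diff_on k T (\<lambda>x. frechet_derivative f (at x) v)"
      by auto
  qed
  ultimately show ?case by simp
qed

lemma times_cont_diff_on_const: "open S \<Longrightarrow> times_cont_diff_on k S (\<lambda>x. a)"
proof (induction k arbitrary: a)
  case (Suc k)
  show ?case
    by (rule times_cont_diff_on_SucI[where f' = "\<lambda>x v. 0"]) (use Suc in auto)
qed auto

lemma times_cont_diff_on_linear_comp: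
  assumes L: "bounded_linear L" and S: "open S" and f: "times_cont_diff_on k S f"
  shows "times_cont_diff_on k S (\<lambda>x. L (f x))"
  using f
proof (induction k arbitrary: f)
  case 0
  then show ?case using L by (auto intro: bounded_linear.continuous_on)
next
  case (Suc k)
  note d = times_cont_diff_on_SucD[OF S Suc.prems]
  show ?case
    by (rule times_cont_diff_on_SucI[OF S bounded_linear.has_derivative[OF L d]])
       (use Suc in auto)
qed

lemma times_cont_diff_on_add:
  assumes S: "open S" and "times_cont_diff_on k S f" "times_cont_diff_on k S h"
  shows "times_cont_diff_on k S (\<lambda>x. f x + h x)"
  using assms(2,3)
proof (induction k arbitrary: f h)
  case 0
  then show ?case by (auto intro!: continuous_intros)
next
  case (Suc k)
  note d = times_cont_diff_on_SucD[OF S Suc.prems(1)] times_cont_diff_on_SucD[OF S Suc.prems(2)]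
  show ?case
    by (rule times_cont_diff_on_SucI[OF S has_derivative_add[OF d]]) (use Suc in auto)
qed

lemma times_cont_diff_on_sum:
  assumes "open S" "\<And>i. i \<in> I \<Longrightarrow> times_cont_diff_on k S (f i)"
  shows "times_cont_diff_on k S (\<lambda>x. \<Sum>i\<in>I. f i x)"
  using assms(2)
  by (induction I rule: infinite_finite_induct)
     (auto simp: times_cont_diff_on_const times_cont_diff_on_add assms(1))

lemma times_cont_diff_on_mult:
  fixes f h :: "'a::euclidean_space \<Rightarrow> real"
  assumes S: "open S" and "times_cont_diff_on k S f" "times_cont_diff_on k S h"
  shows "times_cont_diff_on k S (\<lambda>x. f x * h x)"
  using assms(2,3)
proof (induction k arbitrary: f h)
  case 0
  then show ?case by (auto intro!: continuous_intros)
next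
  case (Suc k)
  note d = times_cont_diff_on_SucD[OF S Suc.prems(1)] times_cont_diff_on_SucD[OF S Suc.prems(2)]
  note p = times_cont_diff_on_pred[OF Suc.prems(1)] times_cont_diff_on_pred[OF Suc.prems(2)]
  show ?case
    by (rule times_cont_diff_on_SucI[OF S has_derivative_mult[OF d]])
       (use Suc p in \<open>auto intro!: times_cont_diff_on_add[OF S]\<close>)
qed

text \<open>The derivative of 1/f is built from f' and 1/f itself, so an induction on the order
  closes: the hypothesis supplies 1/f one order lower, exactly what the derivative requires.\<close>

lemma times_cont_diff_on_inverse:
  fixes f :: "'a::euclidean_space \<Rightarrow> real"
  assumes S: "open S" and "times_cont_diff_on k S f" and nz: "\<And>x. x \<in> S \<Longrightarrow> f x \<noteq> 0"
  shows "times_cont_diff_on k S (\<lambda>x. inverse (f x))"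
  using assms(2)
proof (induction k)
  case 0
  then show ?case using nz by (auto intro!: continuous_intros)
next
  case (Suc k)
  note d = times_cont_diff_on_SucD[OF S Suc.prems]
  note i = Suc.IH[OF times_cont_diff_on_pred[OF Suc.prems]]
  have "((\<lambda>x. inverse (f x)) has_derivative
      (\<lambda>v. (-1) * ((inverse (f x) * inverse (f x)) * frechet_derivative f (at x) v))) (at x)"
    if "x \<in> S" for x
    using Deriv.has_derivative_inverse[OF nz[OF that] d[OF that]] by (simp add: mult.commute mult.left_commute)
  moreover have "times_cont_diff_on k S (\<lambda>x. frechet_derivative f (at x) v)" for v
    using Suc.prems by simp
  ultimately show ?case using i
    by - (rule times_cont_diff_on_SucI[OF S], assumption,
      intro times_cont_diff_on_mult[OF S] times_cont_diff_on_const[OF S])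
qed

text \<open>The same self-reference: the derivative is f' / (2 sqrt f), and the reciprocal of sqrt f
  is available one order lower.\<close>

lemma times_cont_diff_on_sqrt:
  fixes f :: "'a::euclidean_space \<Rightarrow> real"
  assumes S: "open S" and "times_cont_diff_on k S f" and pos: "\<And>x. x \<in> S \<Longrightarrow> f x > 0"
  shows "times_cont_diff_on k S (\<lambda>x. sqrt (f x))"
  using assms(2)
proof (induction k)
  case 0
  then show ?case by (auto intro!: continuous_intros)
next
  case (Suc k)
  note d = times_cont_diff_on_SucD[OF S Suc.prems]
  have "times_cont_diff_on k S (\<lambda>x. inverse (sqrt (f x)))"
    using pos by (intro times_cont_diff_on_inverse[OF S] Suc.IH times_cont_diff_on_pred[OF Suc.prems])
      fastforce
  moreover have "((\<lambda>x. sqrt (f x)) has_derivative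
      (\<lambda>v. frechet_derivative f (at x) v * (1/2 * inverse (sqrt (f x))))) (at x)" if "x \<in> S" for x
    using has_derivative_real_sqrt[OF pos[OF that] d[OF that]] by (simp add: field_simps)
  moreover have "times_cont_diff_on k S (\<lambda>x. frechet_derivative f (at x) v)" for v
    using Suc.prems by simp
  ultimately show ?case
    by - (rule times_cont_diff_on_SucI[OF S], assumption,
      intro times_cont_diff_on_mult[OF S] times_cont_diff_on_const[OF S])
qed

text \<open>The chain rule is expanded over the basis because smoothness is tested on derivatives in
  fixed directions: each term is a component of a derivative of \<open>h\<close> times a composed
  partial derivative of \<open>f\<close>. The induction therefore varies \<open>f\<close> and keeps
  \<open>h\<close>.\<close>

lemma times_cont_diff_on_compose:
  fixes f :: "'a::euclidean_space \<Rightarrow> real" and h :: "'b::euclidean_space \<Rightarrow> 'a"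
  assumes S: "open S" and T: "open T" and "times_cont_diff_on k T f" "times_cont_diff_on k S h"
    and hS: "h ` S \<subseteq> T"
  shows "times_cont_diff_on k S (\<lambda>x. f (h x))"
  using assms(3,4)
proof (induction k arbitrary: f)
  case 0
  then show ?case using hS by (auto intro: continuous_on_compose2)
next
  case (Suc k)
  note df = times_cont_diff_on_SucD[OF T Suc.prems(1)]
  note dh = times_cont_diff_on_SucD[OF S Suc.prems(2)]
  have "((\<lambda>x. f (h x)) has_derivative (\<lambda>v. \<Sum>b\<in>Basis.
      (frechet_derivative h (at x) v \<bullet> b) * frechet_derivative f (at (h x)) b)) (at x)"
    if x: "x \<in> S" for x
  proof -
    let ?D = "frechet_derivative f (at (h x))"
    have hx: "h x \<in> T" using x hS by auto
    have lin: "linear ?D" using df[OF hx] by (simp add: has_derivative_linear)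
    have exp: "?D w = (\<Sum>b\<in>Basis. (w \<bullet> b) * ?D b)" for w
    proof -
      have "?D w = ?D (\<Sum>b\<in>Basis. (w \<bullet> b) *\<^sub>R b)" by (simp add: euclidean_representation)
      also have "\<dots> = (\<Sum>b\<in>Basis. (w \<bullet> b) * ?D b)" using lin by (simp add: linear_sum linear_scale)
      finally show ?thesis .
    qed
    show ?thesis
      by (rule has_derivative_eq_rhs[OF has_derivative_compose[OF dh[OF x] df[OF hx]]])
         (rule ext, rule exp)
  qed
  moreover have "times_cont_diff_on k S (\<lambda>x. frechet_derivative f (at (h x)) b)" for b
    using Suc.prems times_cont_diff_on_pred[OF Suc.prems(2)] by (intro Suc.IH) auto
  moreover have "times_cont_diff_on k S (\<lambda>x. frechet_derivative h (at x) v)" for v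
    using Suc.prems by simp
  ultimately show ?case
    by - (rule times_cont_diff_on_SucI[OF S], assumption,
      intro times_cont_diff_on_sum[OF S] times_cont_diff_on_mult[OF S]
      times_cont_diff_on_linear_comp[OF bounded_linear_inner_left S])
qed

lemma smooth_on_cong:
  "open S \<Longrightarrow> (\<And>x. x \<in> S \<Longrightarrow> f x = h x) \<Longrightarrow> smooth_on S f \<longleftrightarrow> smooth_on S h"
  unfolding smooth_on_def using times_cont_diff_on_cong by blast

lemma smooth_on_subset: "smooth_on S f \<Longrightarrow> T \<subseteq> S \<Longrightarrow> smooth_on T f"
  unfolding smooth_on_def using times_cont_diff_on_subset by blast

lemma smooth_on_local:
  "(\<And>x. x \<in> S \<Longrightarrow> \<exists>T. open T \<and> x \<in> T \<and> T \<subseteq> S \<and> smooth_on T f) \<Longrightarrow> smooth_on S f"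
  unfolding smooth_on_def by (intro allI times_cont_diff_on_local) meson

lemma smooth_on_has_derivative:
  "smooth_on S f \<Longrightarrow> open S \<Longrightarrow> x \<in> S \<Longrightarrow> (f has_derivative frechet_derivative f (at x)) (at x)"
  unfolding smooth_on_def using times_cont_diff_on_SucD by metis

lemma smooth_on_frechet_derivative:
  "smooth_on S f \<Longrightarrow> smooth_on S (\<lambda>x. frechet_derivative f (at x) v)"
  unfolding smooth_on_def by (metis times_cont_diff_on.simps(2))

lemma smooth_on_imp_continuous_on: "smooth_on S f \<Longrightarrow> continuous_on S f"
  unfolding smooth_on_def by (metis times_cont_diff_on.simps(1))

lemma smooth_on_compose:
  fixes f :: "'a::euclidean_space \<Rightarrow> real" and h :: "'b::euclidean_space \<Rightarrow> 'a"
  shows "open S \<Longrightarrow> open T \<Longrightarrow> smooth_on T f \<Longrightarrow> smooth_on S h \<Longrightarrow> h ` S \<subseteq> T \<Longrightarrow>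
    smooth_on S (\<lambda>x. f (h x))"
  unfolding smooth_on_def using times_cont_diff_on_compose by blast

section \<open>Symmetry of second derivatives\<close>

text \<open>The second difference over the parallelogram with sides h u and h v is differentiated
  one direction at a time, u first. The difference itself is symmetric in u and v, so both orders of
  differentiation lead to the same number at nearby points.\<close>

lemma second_derivative_mvt:
  fixes f :: "'a::euclidean_space \<Rightarrow> real"
  assumes b: "ball x r \<subseteq> S" and S: "open S" and f: "smooth_on S f"
    and h: "h > 0" "h * (norm u + norm v) < r"
  defines "D w y \<equiv> frechet_derivative f (at y) w"
  obtains s t where "0 < s" "s < h" "0 < t" "t < h"
    "f (x + h *\<^sub>R u + h *\<^sub>R v) - f (x + h *\<^sub>R u) - f (x + h *\<^sub>R v) + f x
      = h * h * frechet_derivative (D u) (at (x + s *\<^sub>R u + t *\<^sub>R v)) v"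
proof -
  have inS: "x + s *\<^sub>R u + t *\<^sub>R v \<in> S" if "0 \<le> s" "s \<le> h" "0 \<le> t" "t \<le> h" for s t
  proof -
    have "norm (s *\<^sub>R u + t *\<^sub>R v) \<le> s * norm u + t * norm v"
      using norm_triangle_ineq[of "s *\<^sub>R u" "t *\<^sub>R v"] that by simp
    also have "\<dots> \<le> h * norm u + h * norm v"
      using that by (intro add_mono mult_right_mono) auto
    finally have "x + s *\<^sub>R u + t *\<^sub>R v \<in> ball x r"
      using h(2) norm_minus_cancel[of "s *\<^sub>R u + t *\<^sub>R v"] by (simp add: dist_norm algebra_simps)
    then show ?thesis using b by auto
  qed
  have Ds: "smooth_on S (D u)" unfolding D_def using f by (rule smooth_on_frechet_derivative)
  \<comment> \<open>The first mean value theorem is applied to the difference of \<open>f\<close> on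
    two parallel lines, which leaves a difference of first derivatives for the second one.\<close>
  define F where "F s = f (x + s *\<^sub>R u + h *\<^sub>R v) - f (x + s *\<^sub>R u)" for s
  have line: "((\<lambda>s. f (y + s *\<^sub>R w)) has_real_derivative D w (y + s *\<^sub>R w)) (at s)"
    if "y + s *\<^sub>R w \<in> S" for s y w
  proof -
    have "((\<lambda>s. y + s *\<^sub>R w) has_derivative (\<lambda>t. t *\<^sub>R w)) (at s)"
      by (auto intro!: derivative_eq_intros)
    from has_derivative_compose[OF this smooth_on_has_derivative[OF f S that]]
    show ?thesis unfolding D_def has_field_derivative_def
      using smooth_on_has_derivative[OF f S that]
      by (simp add: has_derivative_linear linear_scale mult.commute[of _ "frechet_derivative _ _ _"])
  qed
  have "(F has_real_derivative (D u (x + s *\<^sub>R u + h *\<^sub>R v) - D u (x + s *\<^sub>R u))) (at s)"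
    if "0 \<le> s" "s \<le> h" for s
    unfolding F_def
    using line[of "x + h *\<^sub>R v" s u] line[of x s u] inS[of s h] inS[of s 0] that h
    by (auto intro!: derivative_eq_intros simp: algebra_simps)
  from MVT2[OF h(1) this] obtain s where s: "0 < s" "s < h"
    and 1: "F h - F 0 = h * (D u (x + s *\<^sub>R u + h *\<^sub>R v) - D u (x + s *\<^sub>R u))"
    by auto
  have "((\<lambda>t. D u (x + s *\<^sub>R u + t *\<^sub>R v)) has_real_derivative
      frechet_derivative (D u) (at (x + s *\<^sub>R u + t *\<^sub>R v)) v) (at t)" if "0 \<le> t" "t \<le> h" for t
  proof -
    note i = inS[of s t]
    have "((\<lambda>t. x + s *\<^sub>R u + t *\<^sub>R v) has_derivative (\<lambda>t. t *\<^sub>R v)) (at t)"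
      by (auto intro!: derivative_eq_intros)
    from has_derivative_compose[OF this smooth_on_has_derivative[OF Ds S i]]
    show ?thesis unfolding has_field_derivative_def
      using smooth_on_has_derivative[OF Ds S i] s that
      by (simp add: has_derivative_linear linear_scale mult.commute[of _ "frechet_derivative _ _ _"])
  qed
  from MVT2[OF h(1) this] obtain t where t: "0 < t" "t < h"
    and 2: "D u (x + s *\<^sub>R u + h *\<^sub>R v) - D u (x + s *\<^sub>R u)
      = h * frechet_derivative (D u) (at (x + s *\<^sub>R u + t *\<^sub>R v)) v"
    by auto
  show ?thesis
    using that[OF s t] 1 2 by (simp add: F_def mult.assoc)
qed

lemma second_derivative_symmetric:
  fixes f :: "'a::euclidean_space \<Rightarrow> real"
  assumes f: "smooth_on S f" and S: "open S" and x: "x \<in> S"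
  shows "frechet_derivative (\<lambda>y. frechet_derivative f (at y) u) (at x) v
    = frechet_derivative (\<lambda>y. frechet_derivative f (at y) v) (at x) u" (is "?A u v x = ?A v u x")
proof (rule ccontr)
  assume ne: "?A u v x \<noteq> ?A v u x"
  \<comment> \<open>Half the gap: a common value within \<open>e\<close> of both second derivatives
    would make the gap smaller than itself.\<close>
  define e where "e = \<bar>?A u v x - ?A v u x\<bar> / 2"
  have e: "e > 0" using ne by (simp add: e_def)
  obtain r where r: "r > 0" "ball x r \<subseteq> S" using S x openE by blast
  have "continuous_on S (?A a b)" for a b
    by (intro smooth_on_imp_continuous_on smooth_on_frechet_derivative f)
  then have "isCont (?A a b) x" for a b
    using S x by (simp add: continuous_on_eq_continuous_at)
  then obtain d1 d2 where d: "d1 > 0" "d2 > 0"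
    "\<And>y. dist y x < d1 \<Longrightarrow> dist (?A u v y) (?A u v x) < e"
    "\<And>y. dist y x < d2 \<Longrightarrow> dist (?A v u y) (?A v u x) < e"
    using e unfolding continuous_at_eps_delta by metis
  define d where "d = min r (min d1 d2)"
  \<comment> \<open>The summand 1 keeps the denominator positive when u = v = 0; halving
    \<open>d\<close> keeps all intermediate points strictly within distance \<open>d\<close> of
    \<open>x\<close>.\<close>
  define h where "h = d / 2 / (norm u + norm v + 1)"
  have dpos: "d > 0" using r d by (simp add: d_def)
  have hpos: "h > 0" using dpos unfolding h_def
    by (intro divide_pos_pos) (auto intro: add_nonneg_pos)
  have "h * (norm u + norm v + 1) = d / 2"
  proof -
    have "norm u + norm v + 1 \<noteq> 0" using norm_ge_zero[of u] norm_ge_zero[of v] by linarith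
    then show ?thesis unfolding h_def by (rule nonzero_eq_divide_eq[THEN iffD1, rotated, OF refl])
  qed
  then have hd: "h * (norm u + norm v) < d" using hpos dpos by (simp add: algebra_simps)
  have near: "dist (x + s *\<^sub>R a + t *\<^sub>R b) x < d"
    if "0 < s" "s < h" "0 < t" "t < h" "norm a + norm b = norm u + norm v" for s t a b
  proof -
    have "norm (s *\<^sub>R a + t *\<^sub>R b) \<le> s * norm a + t * norm b"
      using norm_triangle_ineq[of "s *\<^sub>R a" "t *\<^sub>R b"] that by simp
    also have "\<dots> \<le> h * norm a + h * norm b"
      using that by (intro add_mono mult_right_mono) auto
    also have "\<dots> = h * (norm u + norm v)" using that(5) by (metis distrib_left)
    finally show ?thesis using hd by (simp add: dist_norm add.assoc)
  qed
  obtain s t where st: "0 < s" "s < h" "0 < t" "t < h"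
    "f (x + h *\<^sub>R u + h *\<^sub>R v) - f (x + h *\<^sub>R u) - f (x + h *\<^sub>R v) + f x
      = h * h * ?A u v (x + s *\<^sub>R u + t *\<^sub>R v)"
    by (rule second_derivative_mvt[OF r(2) S f hpos, of u v]) (use hd d_def in auto)
  obtain s' t' where st': "0 < s'" "s' < h" "0 < t'" "t' < h"
    "f (x + h *\<^sub>R v + h *\<^sub>R u) - f (x + h *\<^sub>R v) - f (x + h *\<^sub>R u) + f x
      = h * h * ?A v u (x + s' *\<^sub>R v + t' *\<^sub>R u)"
    by (rule second_derivative_mvt[OF r(2) S f hpos, of v u]) (use hd d_def in \<open>auto simp: add.commute\<close>)
  have "x + h *\<^sub>R v + h *\<^sub>R u = x + h *\<^sub>R u + h *\<^sub>R v" by (simp add: algebra_simps)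
  then have "h * h * ?A u v (x + s *\<^sub>R u + t *\<^sub>R v) = h * h * ?A v u (x + s' *\<^sub>R v + t' *\<^sub>R u)"
    using st(5) st'(5) by (simp add: algebra_simps)
  then have "?A u v (x + s *\<^sub>R u + t *\<^sub>R v) = ?A v u (x + s' *\<^sub>R v + t' *\<^sub>R u)"
    using hpos by simp
  moreover have "dist (?A u v (x + s *\<^sub>R u + t *\<^sub>R v)) (?A u v x) < e"
    using near[OF st(1-4), of u v] by (intro d) (simp add: d_def)
  moreover have "dist (?A v u (x + s' *\<^sub>R v + t' *\<^sub>R u)) (?A v u x) < e"
    using near[OF st'(1-4), of v u] by (intro d) (simp add: d_def)
  ultimately have "dist (?A u v x) (?A v u x) < e + e"
    using dist_triangle3[of "?A u v x" "?A v u x" "?A u v (x + s *\<^sub>R u + t *\<^sub>R v)"] by simp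
  then show False by (simp add: e_def dist_real_def)
qed

section \<open>Zero sets of functions with logarithmic derivatives\<close>

text \<open>The remainder of one Euler step is o(h), uniformly in the starting point: by the mean
  value theorem it is h times the variation of a directional derivative along the step, and that
  derivative is uniformly continuous on a compact set of starting points and step sizes.\<close>

lemma euler_step_error:
  fixes f :: "'a::euclidean_space \<Rightarrow> real"
  assumes S: "open S" and f: "smooth_on S f" and R: "cball x0 R \<subseteq> S" "r < R"
    and V: "continuous_on (cball x0 R) V" and e: "e > 0"
  obtains d where "d > 0"
    "\<And>x h. x \<in> cball x0 r \<Longrightarrow> \<bar>h\<bar> \<le> d \<Longrightarrow>
      \<bar>f (x + h *\<^sub>R V x) - f x - h * frechet_derivative f (at x) (V x)\<bar> \<le> e * \<bar>h\<bar>"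
proof -
  let ?K = "cball x0 r"
  have "bounded (V ` cball x0 R)"
    using V by (intro compact_imp_bounded compact_continuous_image) auto
  then obtain m where m: "m > 0" "\<And>x. x \<in> cball x0 R \<Longrightarrow> norm (V x) \<le> m"
    by (auto simp: bounded_pos)
  \<comment> \<open>A step of this size moves by at most R - r, hence stays in the larger ball,
    where \<open>f\<close> is smooth.\<close>
  define d0 where "d0 = (R - r) / m"
  have d0: "d0 > 0" using R m by (simp add: d0_def)
  have stay: "x + s *\<^sub>R V x \<in> cball x0 R" if "x \<in> ?K" "\<bar>s\<bar> \<le> d0" for x s
  proof -
    have "norm (s *\<^sub>R V x) \<le> d0 * m"
      using that R m(2)[of x] by (auto intro!: mult_mono)
    then have "norm (s *\<^sub>R V x) \<le> R - r" using m by (simp add: d0_def)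
    then have "dist x0 (x + s *\<^sub>R V x) \<le> r + (R - r)"
      using that(1) norm_triangle_ineq4[of "x0 - x" "s *\<^sub>R V x"] by (simp add: dist_norm algebra_simps)
    then show ?thesis by simp
  qed
  have df: "(f has_derivative frechet_derivative f (at y)) (at y)" if "y \<in> cball x0 R" for y
    using smooth_on_has_derivative[OF f S] that R by auto
  \<comment> \<open>The derivative of \<open>f\<close> at the moved point in the direction taken
    from the old one. Its continuity is read off the basis expansion, since smoothness controls
    derivatives in fixed directions.\<close>
  define Ps where "Ps = (\<lambda>(x, s). frechet_derivative f (at (x + s *\<^sub>R V x)) (V x))"
  have Ps_sum: "Ps z = (\<Sum>b\<in>Basis. (V (fst z) \<bullet> b)
      * frechet_derivative f (at (fst z + snd z *\<^sub>R V (fst z))) b)" if "z \<in> ?K \<times> {-d0..d0}" for z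
  proof -
    let ?D = "frechet_derivative f (at (fst z + snd z *\<^sub>R V (fst z)))"
    have "linear ?D" using that by (intro has_derivative_linear[OF df] stay) auto
    then have "?D (\<Sum>b\<in>Basis. (V (fst z) \<bullet> b) *\<^sub>R b) = (\<Sum>b\<in>Basis. (V (fst z) \<bullet> b) * ?D b)"
      by (simp add: linear_sum linear_scale)
    then show ?thesis by (simp add: Ps_def case_prod_unfold euclidean_representation)
  qed
  have contV: "continuous_on (?K \<times> {-d0..d0}) (\<lambda>z. V (fst z))"
    using R by (intro continuous_on_compose2[OF V]) (auto intro: continuous_intros)
  have contD: "continuous_on (?K \<times> {-d0..d0})
      (\<lambda>z. frechet_derivative f (at (fst z + snd z *\<^sub>R V (fst z))) b)" for b
  proof (rule continuous_on_compose2[OF smooth_on_imp_continuous_on[OF smooth_on_frechet_derivative[OF f]]])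
    show "continuous_on (?K \<times> {-d0..d0}) (\<lambda>z. fst z + snd z *\<^sub>R V (fst z))"
      by (intro continuous_intros contV)
    show "(\<lambda>z. fst z + snd z *\<^sub>R V (fst z)) ` (?K \<times> {-d0..d0}) \<subseteq> S"
    proof (rule image_subsetI)
      fix z assume "z \<in> ?K \<times> {-d0..d0}"
      then have "fst z + snd z *\<^sub>R V (fst z) \<in> cball x0 R" by (intro stay) auto
      then show "fst z + snd z *\<^sub>R V (fst z) \<in> S" using R(1) by blast
    qed
  qed
  have "continuous_on (?K \<times> {-d0..d0}) Ps"
    by (subst continuous_on_cong[OF refl Ps_sum]) (auto intro!: continuous_intros contV contD)
  then have "uniformly_continuous_on (?K \<times> {-d0..d0}) Ps"
    by (intro compact_uniformly_continuous) (auto intro: compact_Times)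
  then obtain d1 where d1: "d1 > 0"
    "\<And>z z'. z \<in> ?K \<times> {-d0..d0} \<Longrightarrow> z' \<in> ?K \<times> {-d0..d0} \<Longrightarrow> dist z' z < d1 \<Longrightarrow> dist (Ps z') (Ps z) < e"
    using e unfolding uniformly_continuous_on_def by meson
  define d where "d = min d0 (d1 / 2)"
  show ?thesis
  proof
    show "d > 0" using d0 d1 by (simp add: d_def)
    fix x h assume x: "x \<in> ?K" and h: "\<bar>h\<bar> \<le> d"
    \<comment> \<open>The step is parametrised by t in [0, 1], so that the mean value theorem covers
      h of either sign and h = 0.\<close>
    have "((\<lambda>t. f (x + (t * h) *\<^sub>R V x)) has_real_derivative h * Ps (x, t * h)) (at t)"
      if t: "0 \<le> t" "t \<le> 1" for t
    proof -
      have "\<bar>t * h\<bar> \<le> \<bar>h\<bar>" using t by (simp add: abs_mult mult_left_le_one_le)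
      then have i: "x + (t * h) *\<^sub>R V x \<in> cball x0 R" using stay[OF x, of "t * h"] h by (simp add: d_def)
      have "((\<lambda>t. x + (t * h) *\<^sub>R V x) has_derivative (\<lambda>t. (t * h) *\<^sub>R V x)) (at t)"
        by (auto intro!: derivative_eq_intros)
      note comp = has_derivative_compose[OF this df[OF i]]
      have "frechet_derivative f (at (x + (t * h) *\<^sub>R V x)) (s *\<^sub>R V x)
          = s * Ps (x, t * h)" for s
        using linear_scale[OF has_derivative_linear[OF df[OF i]]] by (simp add: Ps_def)
      then show ?thesis unfolding has_field_derivative_def
        by (intro has_derivative_eq_rhs[OF comp]) (simp only: fun_eq_iff mult_ac simp_thms)
    qed
    from MVT2[OF _ this, of 0 1] obtain t where t: "0 < t" "t < 1"
      and eq: "f (x + h *\<^sub>R V x) - f x = h * Ps (x, t * h)" by auto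
    have "\<bar>t * h\<bar> \<le> \<bar>h\<bar>" using t by (simp add: abs_mult mult_left_le_one_le)
    moreover have "dist (Ps (x, t * h)) (Ps (x, 0)) < e"
      using x h d0 d1(1) calculation by (intro d1(2)) (auto simp: d_def dist_Pair_Pair)
    moreover have "f (x + h *\<^sub>R V x) - f x - h * frechet_derivative f (at x) (V x)
        = h * (Ps (x, t * h) - Ps (x, 0))"
      using eq by (simp add: Ps_def algebra_simps)
    ultimately show "\<bar>f (x + h *\<^sub>R V x) - f x - h * frechet_derivative f (at x) (V x)\<bar> \<le> e * \<bar>h\<bar>"
      by (simp add: abs_mult dist_real_def mult.commute[of e] mult_left_mono)
  qed
qed

text \<open>Euler polygons replace integral curves: with a step size that is small compared with \<open>c\<close>,
  a function with \<open>V f = \<beta> f\<close> does not vanish along the polygon if it does not vanish at the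
  start, and this needs no existence theorem for ordinary differential equations.\<close>

lemma euler_polygon:
  fixes f :: "'a::euclidean_space \<Rightarrow> real"
  assumes S: "open S" and f: "smooth_on S f" and R: "cball x0 R \<subseteq> S"
    and V: "continuous_on (cball x0 R) V"
    and \<delta>0: "\<delta> \<ge> 0" and \<delta>: "\<And>x. x \<in> cball x0 R \<Longrightarrow> norm (V x - V x0) \<le> \<delta>"
    and \<beta>: "\<And>x. x \<in> cball x0 R \<Longrightarrow> frechet_derivative f (at x) (V x) = \<beta> x * f x"
    and B: "\<And>x. x \<in> cball x0 R \<Longrightarrow> \<bar>\<beta> x\<bar> \<le> B"
    and T: "T > 0" "B * T \<le> 1/2" and r: "r \<ge> 0" "r + T * (norm (V x0) + \<delta>) < R" and c: "c > 0"
  obtains \<Phi> where "continuous_on ({-T..T} \<times> cball x0 r) (\<lambda>(t, x). \<Phi> t x)"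
    "\<And>t x. t \<in> {-T..T} \<Longrightarrow> x \<in> cball x0 r \<Longrightarrow> norm (\<Phi> t x - x - t *\<^sub>R V x0) \<le> \<delta> * \<bar>t\<bar>"
    "\<And>t x. t \<in> {-T..T} \<Longrightarrow> x \<in> cball x0 r \<Longrightarrow> c \<le> \<bar>f x\<bar> \<Longrightarrow> c / 4 \<le> \<bar>f (\<Phi> t x)\<bar>"
proof -
  define m where "m = norm (V x0) + \<delta>"
  define R' where "R' = r + T * m"
  have R': "R' < R" using r by (simp add: R'_def m_def)
  have m0: "m \<ge> 0" using \<delta>0 by (simp add: m_def)
  have "0 \<le> T * m" using T m0 by simp
  then have R0: "R > 0" using r R' unfolding R'_def by linarith
  have B0: "B \<ge> 0" using B[of x0] R0 by fastforce
  \<comment> \<open>With N steps of size |t|/N the local errors add up to at most c |t| / (4T),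
    hence to at most c/4.\<close>
  obtain d where d: "d > 0" "\<And>x h. x \<in> cball x0 R' \<Longrightarrow> \<bar>h\<bar> \<le> d \<Longrightarrow>
      \<bar>f (x + h *\<^sub>R V x) - f x - h * frechet_derivative f (at x) (V x)\<bar> \<le> c / (4 * T) * \<bar>h\<bar>"
    using euler_step_error[OF S f R R' V, of "c / (4 * T)"] c T by auto
  \<comment> \<open>N is so large that no step t/N exceeds \<open>d\<close>, uniformly in t.\<close>
  obtain N :: nat where N: "real N > T / d" using reals_Archimedean2 by blast
  have N0: "N > 0" using N d T by (metis divide_pos_pos gr0I less_asym of_nat_0)
  define E where "E j t = ((\<lambda>x. x + (t / N) *\<^sub>R V x) ^^ j)" for j t
  have E0: "E 0 t x = x" for t x by (simp add: E_def)
  have ES: "E (Suc j) t x = E j t x + (t / N) *\<^sub>R V (E j t x)" for j t x by (simp add: E_def)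
  have tN: "real j * \<bar>t / N\<bar> \<le> \<bar>t\<bar>" if "j \<le> N" for j t
    using that N0 mult_right_mono[of "real j" "real N" "\<bar>t\<bar>"] by (simp add: field_simps)
  \<comment> \<open>\<open>m\<close> bounds the speed, so a polygon moves by at most T m in total
    and remains in the ball of radius R', where the step error estimate and the bounds on V and
    \<beta> hold.\<close>
  have bnd: "norm (E j t x - x) \<le> real j * \<bar>t / N\<bar> * m \<and> E j t x \<in> cball x0 R'"
    if "j \<le> N" "t \<in> {-T..T}" "x \<in> cball x0 r" for j t x
    using that(1)
  proof (induction j)
    case 0
    then show ?case using that m0 T by (auto simp: E0 R'_def intro: order.trans)
  next
    case (Suc j)
    then have IH: "norm (E j t x - x) \<le> real j * \<bar>t / N\<bar> * m" "E j t x \<in> cball x0 R'" by auto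
    have "norm (V (E j t x)) \<le> m"
      using \<delta>[of "E j t x"] IH(2) R' norm_triangle_sub[of "V (E j t x)" "V x0"] by (auto simp: m_def)
    then have "norm ((t / N) *\<^sub>R V (E j t x)) \<le> \<bar>t / N\<bar> * m"
      by (simp add: mult_left_mono divide_right_mono)
    moreover have "E (Suc j) t x - x = (E j t x - x) + (t / N) *\<^sub>R V (E j t x)" by (simp add: ES)
    ultimately have "norm (E (Suc j) t x - x) \<le> real j * \<bar>t / N\<bar> * m + \<bar>t / N\<bar> * m"
      using IH(1) by (metis add_mono norm_triangle_le)
    also have "\<dots> = real (Suc j) * \<bar>t / N\<bar> * m" by (simp only: of_nat_Suc distrib_right mult_1 add.commute)
    finally have 1: "norm (E (Suc j) t x - x) \<le> real (Suc j) * \<bar>t / N\<bar> * m" .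
    have "real (Suc j) * \<bar>t / N\<bar> * m \<le> T * m"
      using tN[OF Suc.prems, of t] that(2) m0 by (intro mult_right_mono) auto
    then have "norm (E (Suc j) t x - x) \<le> T * m" using 1 by linarith
    then have "dist x0 (E (Suc j) t x) \<le> R'"
      using that(3) norm_triangle_ineq4[of "x0 - x" "E (Suc j) t x - x"]
      by (simp add: R'_def dist_norm algebra_simps)
    with 1 show ?case by simp
  qed
  have lin: "norm (E j t x - x - (real j * (t / N)) *\<^sub>R V x0) \<le> real j * \<bar>t / N\<bar> * \<delta>"
    if "j \<le> N" "t \<in> {-T..T}" "x \<in> cball x0 r" for j t x
    using that(1)
  proof (induction j)
    case 0
    then show ?case by (simp add: E0)
  next
    case (Suc j)
    have "norm (V (E j t x) - V x0) \<le> \<delta>"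
      using bnd[of j t x] Suc.prems that R' by (intro \<delta>) auto
    then have "norm ((t / N) *\<^sub>R (V (E j t x) - V x0)) \<le> \<bar>t / N\<bar> * \<delta>"
      by (simp add: mult_left_mono divide_right_mono)
    moreover have "E (Suc j) t x - x - (real (Suc j) * (t / N)) *\<^sub>R V x0
      = (E j t x - x - (real j * (t / N)) *\<^sub>R V x0) + (t / N) *\<^sub>R (V (E j t x) - V x0)"
      unfolding ES by (simp only: of_nat_Suc distrib_right mult_1 scaleR_add_left scaleR_diff_right) simp
    moreover have "norm (E j t x - x - (real j * (t / N)) *\<^sub>R V x0) \<le> real j * \<bar>t / N\<bar> * \<delta>"
      using Suc by simp
    ultimately have "norm (E (Suc j) t x - x - (real (Suc j) * (t / N)) *\<^sub>R V x0)
        \<le> real j * \<bar>t / N\<bar> * \<delta> + \<bar>t / N\<bar> * \<delta>"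
      by (metis add_mono norm_triangle_le)
    also have "\<dots> = real (Suc j) * \<bar>t / N\<bar> * \<delta>" by (simp only: of_nat_Suc distrib_right mult_1 add.commute)
    finally show ?case .
  qed
  \<comment> \<open>One step costs at most the factor 1 - B |t/N| and one local error. This factor
    lies in [0, 1], so earlier errors are not amplified and simply add up.\<close>
  have growth: "\<bar>f (E j t x)\<bar> \<ge> c * (1 - B * \<bar>t / N\<bar>) ^ j - real j * (c / (4 * T) * \<bar>t / N\<bar>)"
    if "j \<le> N" "t \<in> {-T..T}" "x \<in> cball x0 r" "c \<le> \<bar>f x\<bar>" for j t x
    using that(1)
  proof (induction j)
    case 0
    then show ?case using that by (simp add: E0)
  next
    case (Suc j)
    let ?h = "t / N" and ?y = "E j t x" and ?e = "c / (4 * T) * \<bar>t / N\<bar>"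
    have h1: "\<bar>?h\<bar> \<le> \<bar>t\<bar>" using tN[of 1 t] N0 by simp
    have "\<bar>?h\<bar> \<le> T / N" using that(2) N0 by (auto simp: divide_right_mono)
    also have "\<dots> \<le> d" using N N0 d by (simp add: field_simps)
    finally have hd: "\<bar>?h\<bar> \<le> d" .
    have y: "?y \<in> cball x0 R'" using bnd[of j t x] Suc.prems that by auto
    then have y': "?y \<in> cball x0 R" using R' by auto
    have "B * \<bar>?h\<bar> \<le> B * T" using h1 that(2) B0 by (intro mult_left_mono) auto
    then have Bh: "0 \<le> 1 - B * \<bar>?h\<bar>" "1 - B * \<bar>?h\<bar> \<le> 1" using T B0 by auto
    have "\<bar>f (E (Suc j) t x) - f ?y - ?h * (\<beta> ?y * f ?y)\<bar> \<le> ?e"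
      using d(2)[OF y hd] \<beta>[OF y'] by (simp add: ES)
    moreover have "\<bar>?h * (\<beta> ?y * f ?y)\<bar> \<le> B * \<bar>?h\<bar> * \<bar>f ?y\<bar>"
    proof -
      have "\<bar>?h * (\<beta> ?y * f ?y)\<bar> = \<bar>\<beta> ?y\<bar> * (\<bar>?h\<bar> * \<bar>f ?y\<bar>)" by (simp only: abs_mult mult_ac)
      also have "\<dots> \<le> B * (\<bar>?h\<bar> * \<bar>f ?y\<bar>)" using B[OF y'] by (intro mult_right_mono) auto
      finally show ?thesis by (simp only: mult_ac)
    qed
    moreover have "\<bar>a - b - g\<bar> \<le> e \<Longrightarrow> \<bar>g\<bar> \<le> w \<Longrightarrow> \<bar>b\<bar> - w - e \<le> \<bar>a\<bar>" for a b g e w :: real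
      by linarith
    ultimately have "\<bar>f (E (Suc j) t x)\<bar> \<ge> \<bar>f ?y\<bar> - B * \<bar>?h\<bar> * \<bar>f ?y\<bar> - ?e"
      by blast
    then have "\<bar>f (E (Suc j) t x)\<bar> \<ge> (1 - B * \<bar>?h\<bar>) * \<bar>f ?y\<bar> - ?e"
      by (simp only: left_diff_distrib mult_1)
    moreover have "(1 - B * \<bar>?h\<bar>) * \<bar>f ?y\<bar> \<ge>
        (1 - B * \<bar>?h\<bar>) * (c * (1 - B * \<bar>?h\<bar>) ^ j - real j * ?e)"
      using Suc Bh by (intro mult_left_mono) auto
    moreover have "(1 - B * \<bar>?h\<bar>) * (real j * ?e) \<le> real j * ?e"
      using Bh c T by (intro mult_left_le_one_le) auto
    ultimately have "\<bar>f (E (Suc j) t x)\<bar> \<ge>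
        (1 - B * \<bar>?h\<bar>) * (c * (1 - B * \<bar>?h\<bar>) ^ j) - real j * ?e - ?e"
      by (simp only: right_diff_distrib)
    moreover have "(1 - B * \<bar>?h\<bar>) * (c * (1 - B * \<bar>?h\<bar>) ^ j) = c * (1 - B * \<bar>?h\<bar>) ^ Suc j"
      by (simp only: power_Suc mult_ac)
    moreover have "real (Suc j) * ?e = real j * ?e + ?e"
      by (simp only: of_nat_Suc distrib_right mult_1 add.commute)
    ultimately show ?case by linarith
  qed
  have cont: "j \<le> N \<Longrightarrow> continuous_on ({-T..T} \<times> cball x0 r) (\<lambda>(t, x). E j t x)" for j
  proof (induction j)
    case 0
    then show ?case by (simp add: E0 case_prod_unfold continuous_intros)
  next
    case (Suc j)
    then have IH: "continuous_on ({-T..T} \<times> cball x0 r) (\<lambda>z. E j (fst z) (snd z))"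
      by (simp add: case_prod_unfold)
    have "continuous_on ({-T..T} \<times> cball x0 r) (\<lambda>z. V (E j (fst z) (snd z)))"
      using bnd[of j] Suc.prems R' by (intro continuous_on_compose2[OF V IH]) fastforce
    then show ?case using N0 unfolding case_prod_unfold ES
      by (intro continuous_intros IH) auto
  qed
  show ?thesis
  proof
    show "continuous_on ({-T..T} \<times> cball x0 r) (\<lambda>(t, x). E N t x)" by (rule cont) simp
    fix t x assume t: "t \<in> {-T..T}" and x: "x \<in> cball x0 r"
    show "norm (E N t x - x - t *\<^sub>R V x0) \<le> \<delta> * \<bar>t\<bar>"
      using lin[of N t x] t x N0 by (simp add: mult.commute)
    assume "c \<le> \<bar>f x\<bar>"
    from growth[OF order.refl t x this]
    have g: "\<bar>f (E N t x)\<bar> \<ge> c * (1 - B * \<bar>t / N\<bar>) ^ N - real N * (c / (4 * T) * \<bar>t / N\<bar>)" .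
    have "real N * (B * \<bar>t / N\<bar>) = B * \<bar>t\<bar>" using N0 by simp
    also have "\<dots> \<le> B * T" using t B0 by (intro mult_left_mono) auto
    finally have *: "real N * (B * \<bar>t / N\<bar>) \<le> 1/2" using T by simp
    have "1 * (B * \<bar>t / N\<bar>) \<le> real N * (B * \<bar>t / N\<bar>)"
      using N0 B0 by (intro mult_right_mono) auto
    \<comment> \<open>Bernoulli's inequality plays the part of the exponential exp(-B |t|): the
      factor stays above 1/2, and c/2 minus the accumulated error c/4 leaves c/4.\<close>
    then have "1 + real N * (- (B * \<bar>t / N\<bar>)) \<le> (1 + - (B * \<bar>t / N\<bar>)) ^ N"
      using * by (intro Bernoulli_inequality) auto
    then have "(1 - B * \<bar>t / N\<bar>) ^ N \<ge> 1/2" using * by simp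
    then have "c * (1 - B * \<bar>t / N\<bar>) ^ N \<ge> c * (1/2)" using c by (intro mult_left_mono) auto
    moreover have "real N * (c / (4 * T) * \<bar>t / N\<bar>) = c / 4 * (\<bar>t\<bar> / T)" using N0 by simp
    moreover have "c / 4 * (\<bar>t\<bar> / T) \<le> c / 4 * 1" using t T c by (intro mult_left_mono) auto
    ultimately show "c / 4 \<le> \<bar>f (E N t x)\<bar>" using g by linarith
  qed
qed

text \<open>A polygonal surface spanned by \<open>L\<close> and \<open>P\<close> on which \<open>f \<noteq> 0\<close> and a polygon along \<open>M\<close>
  on which \<open>k \<noteq> 0\<close> are transversal, so they meet by Brouwer's theorem; this contradicts
  \<open>f k = 0\<close>.\<close>

lemma zero_dichotomy:
  fixes f k :: "real ^ 3 \<Rightarrow> real" and P L M :: "real ^ 3 \<Rightarrow> real ^ 3"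
  assumes S: "open S" "x0 \<in> S" and f: "smooth_on S f" and k: "smooth_on S k"
    and cont: "continuous_on S P" "continuous_on S L" "continuous_on S M"
      "continuous_on S \<alpha>" "continuous_on S \<beta>" "continuous_on S \<gamma>"
    and indep: "\<And>a b c. a *\<^sub>R P x0 + b *\<^sub>R L x0 + c *\<^sub>R M x0 = 0 \<Longrightarrow> a = 0 \<and> b = 0 \<and> c = 0"
    and Pf: "\<And>x. x \<in> S \<Longrightarrow> frechet_derivative f (at x) (P x) = \<alpha> x * f x"
    and Lf: "\<And>x. x \<in> S \<Longrightarrow> frechet_derivative f (at x) (L x) = \<beta> x * f x"
    and Mk: "\<And>x. x \<in> S \<Longrightarrow> frechet_derivative k (at x) (M x) = \<gamma> x * k x"
    and fk: "\<And>x. x \<in> S \<Longrightarrow> f x * k x = 0"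
  obtains r where "r > 0" "ball x0 r \<subseteq> S"
    "(\<forall>x\<in>ball x0 r. f x = 0) \<or> (\<forall>x\<in>ball x0 r. k x = 0)"
proof -
  \<comment> \<open>The linear model of the map \<open>W\<close> below: the three fields are frozen
    at \<open>x0\<close> and the polygons become straight segments. Independence of three vectors in
    dimension three makes it invertible.\<close>
  define A where "A y = y $ 1 *\<^sub>R P x0 + y $ 2 *\<^sub>R L x0 + y $ 3 *\<^sub>R M x0" for y :: "real ^ 3"
  have linA: "linear A" by (rule linearI) (simp_all add: A_def algebra_simps)
  have "inj A"
    unfolding linear_injective_0[OF linA]
  proof (intro allI impI)
    fix y assume "A y = 0"
    then have "y $ 1 = 0 \<and> y $ 2 = 0 \<and> y $ 3 = 0" by (intro indep) (simp add: A_def)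
    then show "y = 0" by (simp add: vec_eq_iff forall_3)
  qed
  then obtain B where linB: "linear B" and AB: "\<And>y. B (A y) = y" "\<And>y. A (B y) = y"
    using linear_injective_isomorphism[OF linA] by auto
  obtain C where C: "C > 0" "\<And>y. norm (B y) \<le> C * norm y"
    using linear_bounded_pos[OF linB] by (auto simp: mult.commute)
  \<comment> \<open>Small compared with the inverse of \<open>A\<close>: after applying
    \<open>B\<close>, the deviations of the three polygons from straight segments cost at most
    3T/8.\<close>
  define \<delta> where "\<delta> = 1 / (8 * C)"
  have \<delta>: "\<delta> > 0" using C by (simp add: \<delta>_def)
  have isC: "isCont h x0" if "continuous_on S h" for h :: "real ^ 3 \<Rightarrow> real ^ 3"
    using that S by (simp add: continuous_on_eq_continuous_at)
  obtain R1 where R1: "R1 > 0" "\<And>x. dist x x0 < R1 \<Longrightarrow> dist (P x) (P x0) < \<delta>"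
    using isC[OF cont(1)] \<delta> unfolding continuous_at_eps_delta by blast
  obtain R2 where R2: "R2 > 0" "\<And>x. dist x x0 < R2 \<Longrightarrow> dist (L x) (L x0) < \<delta>"
    using isC[OF cont(2)] \<delta> unfolding continuous_at_eps_delta by blast
  obtain R3 where R3: "R3 > 0" "\<And>x. dist x x0 < R3 \<Longrightarrow> dist (M x) (M x0) < \<delta>"
    using isC[OF cont(3)] \<delta> unfolding continuous_at_eps_delta by blast
  obtain R4 where R4: "R4 > 0" "cball x0 R4 \<subseteq> S" using S open_contains_cball by blast
  define R where "R = min (min R1 R2) (min R3 R4) / 2"
  have R: "R > 0" using R1 R2 R3 R4 by (simp add: R_def)
  have RO: "cball x0 R \<subseteq> S" using R4 R by (auto simp: R_def)
  have near: "norm (P x - P x0) \<le> \<delta>" "norm (L x - L x0) \<le> \<delta>" "norm (M x - M x0) \<le> \<delta>"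
    if "x \<in> cball x0 R" for x
    using that R1(2)[of x] R2(2)[of x] R3(2)[of x] R unfolding R_def
    by (auto simp: dist_norm norm_minus_commute)
  have bounded: "\<exists>b>0. \<forall>x\<in>cball x0 R. \<bar>h x\<bar> \<le> b" if "continuous_on S h" for h :: "real ^ 3 \<Rightarrow> real"
  proof -
    have "bounded (h ` cball x0 R)"
      using continuous_on_subset[OF that RO] by (intro compact_imp_bounded compact_continuous_image) auto
    then show ?thesis by (auto simp: bounded_pos)
  qed
  obtain b1 b2 b3 where b: "b1 > 0" "b2 > 0" "b3 > 0" "\<forall>x\<in>cball x0 R. \<bar>\<alpha> x\<bar> \<le> b1"
      "\<forall>x\<in>cball x0 R. \<bar>\<beta> x\<bar> \<le> b2" "\<forall>x\<in>cball x0 R. \<bar>\<gamma> x\<bar> \<le> b3"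
    using bounded[OF cont(4)] bounded[OF cont(5)] bounded[OF cont(6)] by blast
  define b where "b = b1 + b2 + b3"
  define m where "m = norm (P x0) + norm (L x0) + norm (M x0) + \<delta>"
  have mpos: "m > 0" unfolding m_def using \<delta> by (intro add_nonneg_pos) auto
  \<comment> \<open>The first bound limits the logarithmic loss to 1/2, the second keeps every
    polygon within distance R/4 of its start.\<close>
  define T where "T = min (1 / (2 * b)) (R / (4 * m))"
  have bpos: "b > 0" using b by (simp add: b_def)
  have T: "T > 0" using bpos mpos R by (simp add: T_def)
  have bT: "b * T \<le> 1/2"
  proof -
    have "b * T \<le> b * (1 / (2 * b))" using bpos by (intro mult_left_mono) (auto simp: T_def)
    then show ?thesis using bpos by simp
  qed
  have bT': "b' * T \<le> 1/2" if "b' \<le> b" for b'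
    using mult_right_mono[OF that, of T] T bT by linarith
  have mT: "T * m \<le> R / 4"
  proof -
    have "T * m \<le> R / (4 * m) * m" using mpos by (intro mult_right_mono) (auto simp: T_def)
    then show ?thesis using mpos by simp
  qed
  have mT': "T * (n + \<delta>) \<le> R / 4" if "n + \<delta> \<le> m" for n
    using mult_left_mono[OF that, of T] T mT by linarith
  have mV: "norm (P x0) + \<delta> \<le> m" "norm (L x0) + \<delta> \<le> m" "norm (M x0) + \<delta> \<le> m"
    by (simp_all add: m_def add_nonneg_nonneg)
  \<comment> \<open>\<open>p\<close> and \<open>q\<close> will be at most 2r apart, which after
    applying \<open>B\<close> costs 2 C r, at most T/4.\<close>
  define r where "r = min (R / 4) (T / (8 * C))"
  have r: "r > 0" using R T C by (simp add: r_def)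
  have rR: "r \<le> R / 4" by (simp add: r_def)
  have rO: "ball x0 r \<subseteq> S" using RO rR R by auto
  have "(\<forall>x\<in>ball x0 r. f x = 0) \<or> (\<forall>x\<in>ball x0 r. k x = 0)"
  proof (rule ccontr)
    assume "\<not> ?thesis"
    then obtain p q where "p \<in> ball x0 r" and p0: "f p \<noteq> 0" and "q \<in> ball x0 r" and q0: "k q \<noteq> 0"
      by blast
    then have p: "p \<in> cball x0 r" "f p \<noteq> 0" and q: "q \<in> cball x0 r" "k q \<noteq> 0" by auto
    note cR = continuous_on_subset[OF _ RO]
    obtain F where F: "continuous_on ({-T..T} \<times> cball x0 r) (\<lambda>(t, x). F t x)"
      "\<And>t x. t \<in> {-T..T} \<Longrightarrow> x \<in> cball x0 r \<Longrightarrow> norm (F t x - x - t *\<^sub>R L x0) \<le> \<delta> * \<bar>t\<bar>"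
      "\<And>t x. t \<in> {-T..T} \<Longrightarrow> x \<in> cball x0 r \<Longrightarrow> \<bar>f p\<bar> \<le> \<bar>f x\<bar> \<Longrightarrow> \<bar>f p\<bar> / 4 \<le> \<bar>f (F t x)\<bar>"
      by (rule euler_polygon[OF S(1) f RO cR[OF cont(2)], of \<delta> \<beta> b2 T r "\<bar>f p\<bar>"])
         (use \<delta> near Lf RO b T bT'[of b2] r mT'[OF mV(2)] rR R p in \<open>auto simp: b_def\<close>)
    \<comment> \<open>These polygons start at end points of the previous ones, hence in the ball of
      radius R/2, where |f| is only known to be at least |f p| / 4.\<close>
    obtain G where G: "continuous_on ({-T..T} \<times> cball x0 (R/2)) (\<lambda>(t, x). G t x)"
      "\<And>t x. t \<in> {-T..T} \<Longrightarrow> x \<in> cball x0 (R/2) \<Longrightarrow> norm (G t x - x - t *\<^sub>R P x0) \<le> \<delta> * \<bar>t\<bar>"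
      "\<And>t x. t \<in> {-T..T} \<Longrightarrow> x \<in> cball x0 (R/2) \<Longrightarrow> \<bar>f p\<bar> / 4 \<le> \<bar>f x\<bar> \<Longrightarrow> \<bar>f p\<bar> / 4 / 4 \<le> \<bar>f (G t x)\<bar>"
      by (rule euler_polygon[OF S(1) f RO cR[OF cont(1)], of \<delta> \<alpha> b1 T "R/2" "\<bar>f p\<bar> / 4"])
         (use \<delta> near Pf RO b T bT'[of b1] r mT'[OF mV(1)] rR R p in \<open>auto simp: b_def\<close>)
    obtain H where H: "continuous_on ({-T..T} \<times> cball x0 r) (\<lambda>(t, x). H t x)"
      "\<And>t x. t \<in> {-T..T} \<Longrightarrow> x \<in> cball x0 r \<Longrightarrow> norm (H t x - x - t *\<^sub>R M x0) \<le> \<delta> * \<bar>t\<bar>"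
      "\<And>t x. t \<in> {-T..T} \<Longrightarrow> x \<in> cball x0 r \<Longrightarrow> \<bar>k q\<bar> \<le> \<bar>k x\<bar> \<Longrightarrow> \<bar>k q\<bar> / 4 \<le> \<bar>k (H t x)\<bar>"
      by (rule euler_polygon[OF S(1) k RO cR[OF cont(3)], of \<delta> \<gamma> b3 T r "\<bar>k q\<bar>"])
         (use \<delta> near Mk RO b T bT'[of b3] r mT'[OF mV(3)] rR R q in \<open>auto simp: b_def\<close>)
    have stay: "y \<in> cball x0 (r' + R / 4)"
      if "norm (y - x - t *\<^sub>R v) \<le> \<delta> * \<bar>t\<bar>" "t \<in> {-T..T}" "x \<in> cball x0 r'" "norm v + \<delta> \<le> m" for y x t v r'
    proof -
      have "norm (y - x) \<le> \<delta> * \<bar>t\<bar> + \<bar>t\<bar> * norm v"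
        using that(1) norm_triangle_ineq[of "y - x - t *\<^sub>R v" "t *\<^sub>R v"] by simp
      also have "\<dots> = \<bar>t\<bar> * (norm v + \<delta>)" by (simp add: algebra_simps)
      also have "\<dots> \<le> T * (norm v + \<delta>)" using that \<delta> by (intro mult_right_mono) auto
      also have "\<dots> \<le> R / 4" using mT'[OF that(4)] .
      finally show ?thesis
        using that(3) norm_triangle_ineq4[of "x0 - x" "y - x"] by (simp add: dist_norm algebra_simps)
    qed
    let ?Y = "cball (0 :: real ^ 3) T"
    have comp: "y $ i \<in> {-T..T}" "- y $ i \<in> {-T..T}" if "y \<in> ?Y" for y i
      using that component_le_norm_cart[of y i] by auto
    have Fin: "F t p \<in> cball x0 (R/2)" if "t \<in> {-T..T}" for t
      using stay[OF F(2)[OF that p(1)] that p(1) mV(2)] rR by auto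
    \<comment> \<open>A zero of \<open>W\<close> is an intersection point of the surface through
      \<open>p\<close> with the curve through \<open>q\<close>. The sign of the third coordinate
      makes \<open>A\<close> the linear part.\<close>
    define W where "W y = G (y $ 1) (F (y $ 2) p) - H (- y $ 3) q" for y :: "real ^ 3"
    have coord: "continuous_on ?Y (\<lambda>y. y $ i)" for i
      by (intro linear_continuous_on bounded_linear_vec_nth)
    have cF: "continuous_on ?Y (\<lambda>y. F (y $ 2) p)"
      using continuous_on_compose2[OF F(1) continuous_on_Pair[OF coord continuous_on_const], of 2 p] comp p
      by (auto simp: image_subset_iff)
    have cG: "continuous_on ?Y (\<lambda>y. G (y $ 1) (F (y $ 2) p))"
      using continuous_on_compose2[OF G(1) continuous_on_Pair[OF coord cF], of 1] comp Fin
      by (auto simp: image_subset_iff)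
    have cH: "continuous_on ?Y (\<lambda>y. H (- y $ 3) q)"
      using continuous_on_compose2[OF H(1)
          continuous_on_Pair[OF continuous_on_minus[OF coord] continuous_on_const], of 3 q] comp q
      by (auto simp: image_subset_iff)
    have cW: "continuous_on ?Y W" unfolding W_def by (intro continuous_intros cG cH)
    have err: "norm (W y - A y) \<le> 2 * r + 3 * \<delta> * T" if y: "y \<in> ?Y" for y
    proof -
      let ?t = "y $ 1" and ?s = "y $ 2" and ?u = "- y $ 3"
      have dT: "\<delta> * \<bar>t\<bar> \<le> \<delta> * T" if "t \<in> {-T..T}" for t
        using that \<delta> by (intro mult_left_mono) auto
      have "norm (G ?t (F ?s p) - F ?s p - ?t *\<^sub>R P x0) \<le> \<delta> * T"
        by (rule order.trans[OF G(2)[OF comp(1)[OF y] Fin[OF comp(1)[OF y]]] dT[OF comp(1)[OF y]]])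
      moreover have "norm (F ?s p - p - ?s *\<^sub>R L x0) \<le> \<delta> * T"
        by (rule order.trans[OF F(2)[OF comp(1)[OF y] p(1)] dT[OF comp(1)[OF y]]])
      moreover have "norm (H ?u q - q - ?u *\<^sub>R M x0) \<le> \<delta> * T"
        by (rule order.trans[OF H(2)[OF comp(2)[OF y] q(1)] dT[OF comp(2)[OF y]]])
      moreover have "norm (p - q) \<le> 2 * r"
        using p(1) q(1) dist_triangle3[of p q x0] by (simp add: dist_norm norm_minus_commute)
      moreover have "W y - A y = (G ?t (F ?s p) - F ?s p - ?t *\<^sub>R P x0)
          + (F ?s p - p - ?s *\<^sub>R L x0) - (H ?u q - q - ?u *\<^sub>R M x0) + (p - q)"
        by (simp add: W_def A_def algebra_simps)
      moreover have "norm (a + b - c + d) \<le> e + e + e + w"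
        if "norm a \<le> e" "norm b \<le> e" "norm c \<le> e" "norm d \<le> w" for a b c d :: "real ^ 3" and e w
        using that norm_triangle_ineq[of "a + b - c" d] norm_triangle_ineq4[of "a + b" c]
          norm_triangle_ineq[of a b] by linarith
      ultimately have "norm (W y - A y) \<le> \<delta> * T + \<delta> * T + \<delta> * T + 2 * r"
        by presburger
      then show ?thesis by (simp add: algebra_simps)
    qed
    \<comment> \<open>The two error budgets T/4 and 3T/8 together stay below T, so that the map fed
      to Brouwer's theorem sends the ball into itself.\<close>
    have Cr: "C * (2 * r + 3 * \<delta> * T) \<le> T"
    proof -
      have "C * r \<le> C * (T / (8 * C))" using C by (intro mult_left_mono) (auto simp: r_def)
      then have "C * r \<le> T / 8" using C by simp
      moreover have C\<delta>: "C * \<delta> = 1 / 8" using C by (simp add: \<delta>_def)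
      have "C * (2 * r + 3 * \<delta> * T) = 2 * (C * r) + 3 * (C * \<delta>) * T"
        by (simp add: algebra_simps)
      then have "C * (2 * r + 3 * \<delta> * T) = 2 * (C * r) + 3 / 8 * T"
        unfolding C\<delta> by simp
      ultimately show ?thesis using T by linarith
    qed
    have step: "y - B (W y) = - B (W y - A y)" for y
      using linear_diff[OF linB] AB by simp
    have "y - B (W y) \<in> ?Y" if "y \<in> ?Y" for y
    proof -
      have "norm (y - B (W y)) \<le> C * norm (W y - A y)" unfolding step using C(2) by simp
      also have "\<dots> \<le> C * (2 * r + 3 * \<delta> * T)" using err[OF that] C by (intro mult_left_mono) auto
      finally show ?thesis using Cr by simp
    qed
    moreover have "continuous_on ?Y (\<lambda>y. y - B (W y))"
      by (intro continuous_on_diff continuous_on_id linear_continuous_on_compose[OF cW linB])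
    \<comment> \<open>A fixed point of y - B (W y) is a zero of \<open>W\<close>, as
      \<open>B\<close> is invertible.\<close>
    ultimately obtain y where y: "y \<in> ?Y" "y - B (W y) = y"
      by (rule_tac brouwer_ball[OF T, of 0 "\<lambda>y. y - B (W y)"]) auto
    then have "B (W y) = 0" by simp
    then have "W y = 0" using AB(2)[of "W y"] linear_0[OF linA] by simp
    then have eq: "G (y $ 1) (F (y $ 2) p) = H (- y $ 3) q" by (simp add: W_def)
    have "\<bar>f p\<bar> / 4 / 4 \<le> \<bar>f (G (y $ 1) (F (y $ 2) p))\<bar>"
      using comp[OF y(1)] Fin p by (intro G(3) F(3)) auto
    then have "f (H (- y $ 3) q) \<noteq> 0" using p eq by auto
    moreover have "\<bar>k q\<bar> / 4 \<le> \<bar>k (H (- y $ 3) q)\<bar>"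
      using comp[OF y(1)] q by (intro H(3)) auto
    then have "k (H (- y $ 3) q) \<noteq> 0" using q by auto
    moreover have "H (- y $ 3) q \<in> S"
      using stay[OF H(2)[OF comp(2)[OF y(1)] q(1)] comp(2)[OF y(1)] q(1) mV(3), of 3] rR RO R
      by auto
    ultimately show False using fk by fastforce
  qed
  then show ?thesis using that r rO by blast
qed

section \<open>Smooth functions, tangent vectors and vector fields\<close>

lemma smooth_on_const: "open S \<Longrightarrow> smooth_on S (\<lambda>x. a)"
  by (simp add: smooth_on_def times_cont_diff_on_const)

lemma smooth_on_linear_comp:
  "bounded_linear L \<Longrightarrow> open S \<Longrightarrow> smooth_on S f \<Longrightarrow> smooth_on S (\<lambda>x. L (f x))"
  by (simp add: smooth_on_def times_cont_diff_on_linear_comp)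

lemma smooth_on_add:
  "open S \<Longrightarrow> smooth_on S f \<Longrightarrow> smooth_on S h \<Longrightarrow> smooth_on S (\<lambda>x. f x + h x)"
  by (simp add: smooth_on_def times_cont_diff_on_add)

lemma smooth_on_mult:
  fixes f h :: "'a::euclidean_space \<Rightarrow> real"
  shows "open S \<Longrightarrow> smooth_on S f \<Longrightarrow> smooth_on S h \<Longrightarrow> smooth_on S (\<lambda>x. f x * h x)"
  by (simp add: smooth_on_def times_cont_diff_on_mult)

lemma smooth_on_inverse:
  fixes f :: "'a::euclidean_space \<Rightarrow> real"
  shows "open S \<Longrightarrow> smooth_on S f \<Longrightarrow> (\<And>x. x \<in> S \<Longrightarrow> f x \<noteq> 0) \<Longrightarrow> smooth_on S (\<lambda>x. inverse (f x))"
  by (simp add: smooth_on_def times_cont_diff_on_inverse)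

lemma smooth_on_sqrt:
  fixes f :: "'a::euclidean_space \<Rightarrow> real"
  shows "open S \<Longrightarrow> smooth_on S f \<Longrightarrow> (\<And>x. x \<in> S \<Longrightarrow> f x > 0) \<Longrightarrow> smooth_on S (\<lambda>x. sqrt (f x))"
  by (simp add: smooth_on_def times_cont_diff_on_sqrt)

section \<open>Functions on a manifold through charts\<close>

locale manifold =
  fixes A :: "('a::{t2_space,second_countable_topology}) atlas"
  assumes smooth_manifold: "smooth_manifold A"
begin

lemma ex_chart: obtains U c where "(U, c) \<in> A" "p \<in> U"
proof -
  have "p \<in> (\<Union>(U, c)\<in>A. U)" using smooth_manifold unfolding smooth_manifold_def by simp
  then show ?thesis using that by auto
qed

lemma chart:
  assumes "(U, c) \<in> A"
  shows chart_open: "open U" and chart_open_image: "open (c ` U)"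
    and chart_cont: "continuous_on U c" and chart_cont_inv: "continuous_on (c ` U) (inv_into U c)"
    and chart_inv: "q \<in> U \<Longrightarrow> inv_into U c (c q) = q"
proof -
  have "\<forall>(U, c)\<in>A. open U \<and> open (c ` U) \<and> homeomorphism U (c ` U) c (inv_into U c)"
    using smooth_manifold unfolding smooth_manifold_def by (elim conjE)
  from bspec[OF this assms]
  have h: "open U" "open (c ` U)" "homeomorphism U (c ` U) c (inv_into U c)"
    by simp_all
  then show "open U" "open (c ` U)" "continuous_on U c" "continuous_on (c ` U) (inv_into U c)"
    "q \<in> U \<Longrightarrow> inv_into U c (c q) = q"
    unfolding homeomorphism_def by auto
qed

lemma chart_open_map:
  assumes "(U, c) \<in> A" "open W"
  shows "open (c ` (U \<inter> W))"
proof -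
  have "c ` (U \<inter> W) = inv_into U c -` W \<inter> c ` U"
    using chart_inv[OF assms(1)] by auto
  then show ?thesis
    using continuous_on_open_vimage[OF chart_open_image[OF assms(1)], of "inv_into U c"]
      chart_cont_inv[OF assms(1)] assms(2)
    by metis
qed

lemma transition_smooth:
  assumes "(U, c) \<in> A" "(V, d) \<in> A"
  shows "smooth_on (c ` (U \<inter> V)) (\<lambda>x. d (inv_into U c x))"
proof -
  have "\<forall>(U, c)\<in>A. \<forall>(V, d)\<in>A. smooth_on (c ` (U \<inter> V)) (d \<circ> inv_into U c)"
    using smooth_manifold unfolding smooth_manifold_def by (elim conjE)
  from bspec[OF this assms(1)] assms(2) show ?thesis by (auto simp: comp_def)
qed

lemma smooth_funD:
  "smooth_fun A W f \<Longrightarrow> (U, c) \<in> A \<Longrightarrow> smooth_on (c ` (U \<inter> W)) (\<lambda>x. f (inv_into U c x))"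
  unfolding smooth_fun_def comp_def by blast

lemma smooth_funI:
  "(\<And>U c. (U, c) \<in> A \<Longrightarrow> smooth_on (c ` (U \<inter> W)) (\<lambda>x. f (inv_into U c x))) \<Longrightarrow> smooth_fun A W f"
  unfolding smooth_fun_def comp_def by blast

lemma smooth_fun_subset: "smooth_fun A W f \<Longrightarrow> V \<subseteq> W \<Longrightarrow> smooth_fun A V f"
  by (rule smooth_funI, rule smooth_on_subset, erule (1) smooth_funD) auto

lemma smooth_fun_cong:
  assumes "open W" "smooth_fun A W f" "\<And>q. q \<in> W \<Longrightarrow> h q = f q"
  shows "smooth_fun A W h"
proof (rule smooth_funI)
  fix U c assume ch: "(U, c) \<in> A"
  then have "h (inv_into U c x) = f (inv_into U c x)" if "x \<in> c ` (U \<inter> W)" for x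
    using that chart_inv[OF ch] assms(3) by auto
  then show "smooth_on (c ` (U \<inter> W)) (\<lambda>x. h (inv_into U c x))"
    using iffD2[OF smooth_on_cong[OF chart_open_map[OF ch assms(1)]] smooth_funD[OF assms(2) ch]] by simp
qed

lemma smooth_fun_local:
  assumes "\<And>p. p \<in> W \<Longrightarrow> \<exists>V. open V \<and> p \<in> V \<and> V \<subseteq> W \<and> smooth_fun A V f"
  shows "smooth_fun A W f"
proof (rule smooth_funI, rule smooth_on_local)
  fix U c x assume ch: "(U, c) \<in> A" and "x \<in> c ` (U \<inter> W)"
  then obtain q where q: "q \<in> U" "q \<in> W" "x = c q" by auto
  obtain V where V: "open V" "q \<in> V" "V \<subseteq> W" "smooth_fun A V f" using assms[OF q(2)] by auto
  show "\<exists>T. open T \<and> x \<in> T \<and> T \<subseteq> c ` (U \<inter> W) \<and> smooth_on T (\<lambda>x. f (inv_into U c x))"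
    using V q chart_open_map[OF ch V(1)] smooth_funD[OF V(4) ch]
    by (intro exI[of _ "c ` (U \<inter> V)"]) auto
qed

lemma smooth_fun_const: "open W \<Longrightarrow> smooth_fun A W (\<lambda>q. a)"
  by (intro smooth_funI smooth_on_const chart_open_map)

lemma smooth_fun_add:
  "open W \<Longrightarrow> smooth_fun A W f \<Longrightarrow> smooth_fun A W h \<Longrightarrow> smooth_fun A W (\<lambda>q. f q + h q)"
  by (rule smooth_funI, rule smooth_on_add) (simp_all add: chart_open_map smooth_funD)

lemma smooth_fun_mult:
  "open W \<Longrightarrow> smooth_fun A W f \<Longrightarrow> smooth_fun A W h \<Longrightarrow> smooth_fun A W (\<lambda>q. f q * h q)"
  by (rule smooth_funI, rule smooth_on_mult) (simp_all add: chart_open_map smooth_funD)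

lemma smooth_fun_minus: "open W \<Longrightarrow> smooth_fun A W f \<Longrightarrow> smooth_fun A W (\<lambda>q. - f q)"
  using smooth_fun_mult[OF _ smooth_fun_const, of W f "- 1"] by simp

lemma smooth_fun_diff:
  "open W \<Longrightarrow> smooth_fun A W f \<Longrightarrow> smooth_fun A W h \<Longrightarrow> smooth_fun A W (\<lambda>q. f q - h q)"
  using smooth_fun_add[OF _ _ smooth_fun_minus, of W f h] by simp

lemma smooth_fun_divide_const: "open W \<Longrightarrow> smooth_fun A W f \<Longrightarrow> smooth_fun A W (\<lambda>q. f q / a)"
  using smooth_fun_mult[OF _ _ smooth_fun_const, of W f "inverse a"] by (simp add: divide_inverse)

lemma smooth_fun_sum:
  "open W \<Longrightarrow> (\<And>i. i \<in> I \<Longrightarrow> smooth_fun A W (f i)) \<Longrightarrow> smooth_fun A W (\<lambda>q. \<Sum>i\<in>I. f i q)"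
  by (induction I rule: infinite_finite_induct) (auto simp: smooth_fun_const smooth_fun_add)

lemma smooth_fun_inverse:
  assumes "open W" "smooth_fun A W f" "\<And>q. q \<in> W \<Longrightarrow> f q \<noteq> 0"
  shows "smooth_fun A W (\<lambda>q. inverse (f q))"
  using assms chart_inv
  by (intro smooth_funI smooth_on_inverse chart_open_map) (auto intro: smooth_funD)

lemma smooth_fun_sqrt:
  assumes "open W" "smooth_fun A W f" "\<And>q. q \<in> W \<Longrightarrow> f q > 0"
  shows "smooth_fun A W (\<lambda>q. sqrt (f q))"
  using assms chart_inv
  by (intro smooth_funI smooth_on_sqrt chart_open_map) (auto intro: smooth_funD)

lemmas smooth_fun_intros = smooth_fun_const smooth_fun_add smooth_fun_mult smooth_fun_minus
  smooth_fun_diff smooth_fun_divide_const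

text \<open>\<open>smooth_fun\<close> tests all charts of the atlas. Inside one chart domain a
  single test decides, because every other coordinate expression is this one composed with a
  transition map.\<close>

lemma smooth_fun_chart:
  assumes ch: "(U, c) \<in> A" and W: "open W" "W \<subseteq> U"
    and f: "smooth_on (c ` W) (\<lambda>x. f (inv_into U c x))"
  shows "smooth_fun A W f"
proof (rule smooth_funI)
  fix V d assume ch': "(V, d) \<in> A"
  let ?t = "\<lambda>x. c (inv_into V d x)"
  have op: "open (d ` (V \<inter> W))" "open (c ` W)"
    using chart_open_map[OF ch' W(1)] chart_open_map[OF ch W(1)] W(2) by (auto simp: Int_absorb1)
  have "smooth_on (d ` (V \<inter> W)) ?t"
    using transition_smooth[OF ch' ch] by (rule smooth_on_subset) (use W in auto)
  then have "smooth_on (d ` (V \<inter> W)) (\<lambda>x. f (inv_into U c (?t x)))"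
    using chart_inv[OF ch'] by (intro smooth_on_compose[OF op f]) auto
  then show "smooth_on (d ` (V \<inter> W)) (\<lambda>x. f (inv_into V d x))"
    by (rule iffD1[OF smooth_on_cong[OF op(1)], rotated])
       (use W chart_inv[OF ch] chart_inv[OF ch'] in auto)
qed

lemma smooth_fun_coord:
  assumes ch: "(U, c) \<in> A"
  shows "smooth_fun A U (\<lambda>q. c q $ i)"
  by (intro smooth_funI smooth_on_linear_comp[OF bounded_linear_vec_nth] transition_smooth[OF _ ch]
      chart_open_map chart_open[OF ch])

lemma continuous_on_smooth_fun:
  assumes "open W" "smooth_fun A W f"
  shows "continuous_on W f"
proof -
  have "continuous (at p) f" if p: "p \<in> W" for p
  proof -
    obtain U c where ch: "(U, c) \<in> A" "p \<in> U" by (rule ex_chart)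
    have "continuous_on (U \<inter> W) (\<lambda>q. f (inv_into U c (c q)))"
      by (intro continuous_on_compose2[OF smooth_on_imp_continuous_on[OF smooth_funD[OF assms(2) ch(1)]]]
          continuous_on_subset[OF chart_cont[OF ch(1)]]) auto
    then have "continuous_on (U \<inter> W) f"
      by (rule continuous_on_eq) (use chart_inv[OF ch(1)] in auto)
    then show ?thesis
      using p ch(2) assms(1) chart_open[OF ch(1)] by (simp add: continuous_on_eq_continuous_at open_Int)
  qed
  then show ?thesis by (simp add: continuous_at_imp_continuous_on)
qed

lemma smooth_nearI: "open W \<Longrightarrow> p \<in> W \<Longrightarrow> smooth_fun A W f \<Longrightarrow> smooth_near A p f"
  unfolding smooth_near_def by blast

lemma smooth_nearE:
  assumes "smooth_near A p f" "open U" "p \<in> U"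
  obtains W where "open W" "p \<in> W" "W \<subseteq> U" "smooth_fun A W f"
proof -
  obtain V where "open V" "p \<in> V" "smooth_fun A V f" using assms(1) unfolding smooth_near_def by auto
  then show ?thesis using that[of "V \<inter> U"] assms smooth_fun_subset[of V f "V \<inter> U"] by (simp add: open_Int)
qed

lemma smooth_near_cong:
  assumes "smooth_near A p f" "open U" "p \<in> U" "\<And>q. q \<in> U \<Longrightarrow> h q = f q"
  shows "smooth_near A p h"
proof -
  obtain W where "open W" "p \<in> W" "W \<subseteq> U" "smooth_fun A W f" using smooth_nearE[OF assms(1-3)] .
  then show ?thesis using assms(4) by (intro smooth_nearI[of W] smooth_fun_cong[of W f h]) auto
qed

lemma chart_has_derivative:
  assumes ch: "(U, c) \<in> A" "p \<in> U" and f: "smooth_near A p f"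
  shows "((\<lambda>x. f (inv_into U c x)) has_derivative
    frechet_derivative (\<lambda>x. f (inv_into U c x)) (at (c p))) (at (c p))"
proof -
  obtain W where W: "open W" "p \<in> W" "W \<subseteq> U" "smooth_fun A W f"
    using smooth_nearE[OF f chart_open[OF ch(1)] ch(2)] .
  show ?thesis
    by (rule smooth_on_has_derivative[OF smooth_funD[OF W(4) ch(1)] chart_open_map[OF ch(1) W(1)]])
       (use W ch in auto)
qed

section \<open>Tangent vectors as derivations in coordinates\<close>

lemma dir_deriv_eq:
  assumes ch: "(U, c) \<in> A" "p \<in> U" and f: "smooth_near A p f"
    and D: "((\<lambda>x. f (inv_into U c x)) has_derivative D) (at (c p))"
  shows "dir_deriv A (U, c) v p f = D v"
  using f frechet_derivative_at[OF D] by (simp add: dir_deriv_def comp_def)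

text \<open>For \<open>f\<close> not smooth near \<open>p\<close> both sides are 0 by the default
  value of \<open>dir_deriv\<close>, so the identity is one of tangent vectors as functions.\<close>

lemma dir_deriv_sum:
  assumes ch: "(U, c) \<in> A" "p \<in> U"
  shows "dir_deriv A (U, c) v p f = (\<Sum>i\<in>UNIV. v $ i * coord_field A (U, c) i p f)"
proof (cases "smooth_near A p f")
  case True
  note D = chart_has_derivative[OF ch True]
  let ?D = "frechet_derivative (\<lambda>x. f (inv_into U c x)) (at (c p))"
  have "v = (\<Sum>i\<in>UNIV. v $ i *\<^sub>R axis i 1)" by (simp add: vec_eq_iff axis_def if_distrib cong: if_cong)
  then have "?D v = ?D (\<Sum>i\<in>UNIV. v $ i *\<^sub>R axis i 1)" by simp
  also have "\<dots> = (\<Sum>i\<in>UNIV. v $ i * ?D (axis i 1))"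
    using has_derivative_linear[OF D] by (simp add: linear_sum linear_scale)
  finally show ?thesis by (simp add: coord_field_def dir_deriv_eq[OF ch True D])
next
  case False
  then show ?thesis by (simp add: dir_deriv_def coord_field_def)
qed

lemma coord_field_coord:
  assumes ch: "(U, c) \<in> A" "p \<in> U"
  shows "coord_field A (U, c) i p (\<lambda>q. c q $ j) = (if i = j then 1 else 0)"
proof -
  have "((\<lambda>x. x $ j) has_derivative (\<lambda>x. x $ j)) (at (c p))"
    by (rule bounded_linear_imp_has_derivative) (rule bounded_linear_vec_nth)
  then have "((\<lambda>x. c (inv_into U c x) $ j) has_derivative (\<lambda>x. x $ j)) (at (c p))"
    by (rule has_derivative_transform_within_open[OF _ chart_open_image[OF ch(1)]])
       (use ch chart_inv[OF ch(1)] in auto)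
  from dir_deriv_eq[OF ch _ this] show ?thesis
    using smooth_nearI[OF chart_open[OF ch(1)] ch(2) smooth_fun_coord[OF ch(1)]]
    by (simp add: coord_field_def axis_def)
qed

text \<open>Change of chart by the chain rule: the derivative of the transition map acts on the
  coefficient vector. From here on a tangent vector may be written in any chart around
  \<open>p\<close>.\<close>

lemma tangent_space_chart:
  assumes ch: "(U, c) \<in> A" "p \<in> U" and v: "v \<in> tangent_space A p"
  obtains w where "v = dir_deriv A (U, c) w p"
proof -
  obtain V d u where ch': "(V, d) \<in> A" "p \<in> V" and u: "v = dir_deriv A (V, d) u p"
    using v unfolding tangent_space_def by auto
  let ?t = "\<lambda>x. c (inv_into V d x)"
  have op: "open (d ` (V \<inter> U))" "d p \<in> d ` (V \<inter> U)"
    using chart_open_map[OF ch'(1) chart_open[OF ch(1)]] ch ch' by auto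
  note t = smooth_on_has_derivative[OF transition_smooth[OF ch'(1) ch(1)] op]
  let ?D = "frechet_derivative ?t (at (d p))"
  have tp: "?t (d p) = c p" using chart_inv[OF ch'(1)] ch' by simp
  have "v f = dir_deriv A (U, c) (?D u) p f" for f
  proof (cases "smooth_near A p f")
    case True
    note D = chart_has_derivative[OF ch True]
    have "((\<lambda>x. f (inv_into U c (?t x))) has_derivative
        (\<lambda>u. frechet_derivative (\<lambda>x. f (inv_into U c x)) (at (c p)) (?D u))) (at (d p))"
      using has_derivative_compose[OF t, of "\<lambda>x. f (inv_into U c x)"] D tp by simp
    then have "((\<lambda>x. f (inv_into V d x)) has_derivative
        (\<lambda>u. frechet_derivative (\<lambda>x. f (inv_into U c x)) (at (c p)) (?D u))) (at (d p))"
      by (rule has_derivative_transform_within_open[OF _ op])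
         (use chart_inv[OF ch(1)] chart_inv[OF ch'(1)] in auto)
    from dir_deriv_eq[OF ch' True this] dir_deriv_eq[OF ch True D] show ?thesis by (simp add: u)
  next
    case False
    then show ?thesis by (simp add: u dir_deriv_def)
  qed
  then show ?thesis using that by blast
qed

lemma tangentI:
  assumes "(U, c) \<in> A" "p \<in> U"
  shows "(\<lambda>f. \<Sum>i\<in>UNIV. a i * coord_field A (U, c) i p f) \<in> tangent_space A p"
proof -
  have "(\<lambda>f. \<Sum>i\<in>UNIV. a i * coord_field A (U, c) i p f) = dir_deriv A (U, c) (\<chi> i. a i) p"
    using dir_deriv_sum[OF assms, of "\<chi> i. a i"] by auto
  then show ?thesis using assms unfolding tangent_space_def by force
qed

lemma tangent_expand:
  assumes ch: "(U, c) \<in> A" "p \<in> U" and v: "v \<in> tangent_space A p"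
  shows "v f = (\<Sum>i\<in>UNIV. v (\<lambda>q. c q $ i) * coord_field A (U, c) i p f)"
proof -
  obtain w where w: "v = dir_deriv A (U, c) w p" using tangent_space_chart[OF assms] .
  have "v (\<lambda>q. c q $ i) = w $ i" for i
    by (simp add: w dir_deriv_sum[OF ch] coord_field_coord[OF ch] if_distrib cong: if_cong)
  then show ?thesis using dir_deriv_sum[OF ch] by (simp add: w)
qed

lemma tangent_not_smooth: "v \<in> tangent_space A p \<Longrightarrow> \<not> smooth_near A p f \<Longrightarrow> v f = 0"
  unfolding tangent_space_def dir_deriv_def by auto

lemma tangent_add: "v \<in> tangent_space A p \<Longrightarrow> w \<in> tangent_space A p \<Longrightarrow> v + w \<in> tangent_space A p"
  and tangent_scale: "v \<in> tangent_space A p \<Longrightarrow> s *\<^sub>T v \<in> tangent_space A p"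
proof -
  obtain U c where ch: "(U, c) \<in> A" "p \<in> U" by (rule ex_chart)
  let ?x = "\<lambda>i q. c q $ i"
  assume v: "v \<in> tangent_space A p"
  have "s *\<^sub>T v = (\<lambda>f. \<Sum>i\<in>UNIV. (s * v (?x i)) * coord_field A (U, c) i p f)"
    unfolding tv_scale_def
    by (rule ext, subst tangent_expand[OF ch v]) (simp add: sum_distrib_left mult.assoc)
  then show "s *\<^sub>T v \<in> tangent_space A p" by (simp only: tangentI[OF ch])
  assume w: "w \<in> tangent_space A p"
  have "v + w = (\<lambda>f. \<Sum>i\<in>UNIV. (v (?x i) + w (?x i)) * coord_field A (U, c) i p f)"
  proof
    fix f
    show "(v + w) f = (\<Sum>i\<in>UNIV. (v (?x i) + w (?x i)) * coord_field A (U, c) i p f)"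
      using tangent_expand[OF ch v, of f] tangent_expand[OF ch w, of f]
      by (simp only: plus_fun_apply distrib_right sum.distrib)
  qed
  then show "v + w \<in> tangent_space A p" by (simp only: tangentI[OF ch])
qed

lemma tangent_zero: "0 \<in> tangent_space A p"
proof -
  obtain U c where ch: "(U, c) \<in> A" "p \<in> U" by (rule ex_chart)
  show ?thesis using tangentI[OF ch, of "\<lambda>_. 0"] by (simp add: zero_fun_def)
qed

lemma tangent_minus: "v \<in> tangent_space A p \<Longrightarrow> - v \<in> tangent_space A p"
  using tangent_scale[of v p "- 1"] by (simp add: tv_scale_def fun_Compl_def)

lemma tangent_diff: "v \<in> tangent_space A p \<Longrightarrow> w \<in> tangent_space A p \<Longrightarrow> v - w \<in> tangent_space A p"
  using tangent_add[OF _ tangent_minus] by (metis diff_conv_add_uminus)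

lemmas tangent_intros = tangent_add tangent_scale tangent_zero tangent_minus tangent_diff

text \<open>A tangent vector sees only the germ of its argument. Smoothness near \<open>p\<close> is
  itself a property of the germ, so the default value 0 is taken for both functions or for neither.
  Identities that hold only on an open set are differentiated through this lemma.\<close>

lemma tangent_cong:
  assumes v: "v \<in> tangent_space A p" and U: "open U" "p \<in> U" "\<And>q. q \<in> U \<Longrightarrow> f q = h q"
  shows "v f = v h"
proof (cases "smooth_near A p f")
  case True
  then have T: "smooth_near A p h" using smooth_near_cong[OF True U(1,2)] U(3) by simp
  obtain V c w where ch: "(V, c) \<in> A" "p \<in> V" and w: "v = dir_deriv A (V, c) w p"
    using v unfolding tangent_space_def by auto
  note D = chart_has_derivative[OF ch True]
  have "((\<lambda>x. h (inv_into V c x)) has_derivative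
      frechet_derivative (\<lambda>x. f (inv_into V c x)) (at (c p))) (at (c p))"
    using chart_open_map[OF ch(1) U(1)] ch U chart_inv[OF ch(1)]
    by (intro has_derivative_transform_within_open[OF D]) auto
  then show ?thesis using dir_deriv_eq[OF ch True D] dir_deriv_eq[OF ch T] by (simp add: w)
next
  case False
  then have "\<not> smooth_near A p h" using smooth_near_cong[OF _ U(1,2)] U(3) by blast
  then show ?thesis using False v by (simp add: tangent_not_smooth)
qed

lemma tangent_derivation:
  assumes v: "v \<in> tangent_space A p" and f: "smooth_near A p f" and h: "smooth_near A p h"
  shows tangent_apply_add: "v (\<lambda>q. f q + h q) = v f + v h"
    and tangent_apply_mult: "v (\<lambda>q. f q * h q) = f p * v h + v f * h p"
proof -
  obtain V c w where ch: "(V, c) \<in> A" "p \<in> V" and w: "v = dir_deriv A (V, c) w p"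
    using v unfolding tangent_space_def by auto
  obtain W1 where W1: "open W1" "p \<in> W1" "W1 \<subseteq> V" "smooth_fun A W1 f"
    using smooth_nearE[OF f chart_open[OF ch(1)] ch(2)] .
  obtain W2 where W2: "open W2" "p \<in> W2" "W2 \<subseteq> W1" "smooth_fun A W2 h"
    using smooth_nearE[OF h W1(1,2)] .
  note f2 = smooth_fun_subset[OF W1(4) W2(3)]
  note D = chart_has_derivative[OF ch f] chart_has_derivative[OF ch h]
  have e: "inv_into V c (c p) = p" using chart_inv[OF ch(1)] ch by simp
  show "v (\<lambda>q. f q + h q) = v f + v h"
    using dir_deriv_eq[OF ch smooth_nearI[OF W2(1,2) smooth_fun_add[OF W2(1) f2 W2(4)]] has_derivative_add[OF D]]
      dir_deriv_eq[OF ch f D(1)] dir_deriv_eq[OF ch h D(2)] by (simp add: w)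
  show "v (\<lambda>q. f q * h q) = f p * v h + v f * h p"
    using dir_deriv_eq[OF ch smooth_nearI[OF W2(1,2) smooth_fun_mult[OF W2(1) f2 W2(4)]] has_derivative_mult[OF D]]
      dir_deriv_eq[OF ch f D(1)] dir_deriv_eq[OF ch h D(2)] by (simp add: w e)
qed

lemma tangent_apply_const:
  assumes v: "v \<in> tangent_space A p"
  shows "v (\<lambda>q. a) = 0"
proof -
  obtain V c w where ch: "(V, c) \<in> A" "p \<in> V" and w: "v = dir_deriv A (V, c) w p"
    using v unfolding tangent_space_def by auto
  have "smooth_near A p (\<lambda>q. a)"
    by (rule smooth_nearI[of UNIV]) (auto intro: smooth_fun_const)
  from dir_deriv_eq[OF ch this has_derivative_const] show ?thesis by (simp add: w)
qed

lemma coord_field_smooth: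
  assumes ch: "(U, c) \<in> A" and W: "open W" "W \<subseteq> U" "smooth_fun A W f"
  shows "smooth_fun A W (\<lambda>q. coord_field A (U, c) i q f)"
proof (rule smooth_fun_chart[OF ch W(1,2)])
  have im: "c ` (U \<inter> W) = c ` W" using W(2) by (auto simp: Int_absorb1)
  have op: "open (c ` W)" using chart_open_map[OF ch W(1)] im by simp
  note s = smooth_funD[OF W(3) ch, unfolded im]
  have eq: "coord_field A (U, c) i (inv_into U c x) f
      = frechet_derivative (\<lambda>x. f (inv_into U c x)) (at x) (axis i 1)" if x: "x \<in> c ` W" for x
  proof -
    obtain q where q: "q \<in> W" "x = c q" using x by auto
    then show ?thesis using W chart_inv[OF ch, of q] smooth_nearI[OF W(1) q(1) W(3)]
      by (auto simp: coord_field_def dir_deriv_def comp_def)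
  qed
  show "smooth_on (c ` W) (\<lambda>x. coord_field A (U, c) i (inv_into U c x) f)"
    by (rule iffD2[OF smooth_on_cong[OF op eq] smooth_on_frechet_derivative[OF s]])
qed

text \<open>The symmetry of second derivatives, read in the chart; it is what makes the Lie bracket
  a first-order operator.\<close>

lemma coord_field_commute:
  assumes ch: "(U, c) \<in> A" "p \<in> U" and f: "smooth_near A p f"
  shows "coord_field A (U, c) i p (\<lambda>q. coord_field A (U, c) j q f)
    = coord_field A (U, c) j p (\<lambda>q. coord_field A (U, c) i q f)"
proof -
  obtain W where W: "open W" "p \<in> W" "W \<subseteq> U" "smooth_fun A W f"
    using smooth_nearE[OF f chart_open[OF ch(1)] ch(2)] .
  let ?f = "\<lambda>x. f (inv_into U c x)"
  have im: "c ` (U \<inter> W) = c ` W" using W(3) by (auto simp: Int_absorb1)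
  have op: "open (c ` W)" "c p \<in> c ` W" using chart_open_map[OF ch(1) W(1)] im W by auto
  note s = smooth_funD[OF W(4) ch(1), unfolded im]
  have D: "coord_field A (U, c) i p (\<lambda>q. coord_field A (U, c) j q f)
    = frechet_derivative (\<lambda>x. frechet_derivative ?f (at x) (axis j 1)) (at (c p)) (axis i 1)" for i j
  proof -
    have "((\<lambda>x. coord_field A (U, c) j (inv_into U c x) f) has_derivative
       frechet_derivative (\<lambda>x. frechet_derivative ?f (at x) (axis j 1)) (at (c p))) (at (c p))"
    proof (rule has_derivative_transform_within_open[OF _ op])
      show "((\<lambda>x. frechet_derivative ?f (at x) (axis j 1)) has_derivative
       frechet_derivative (\<lambda>x. frechet_derivative ?f (at x) (axis j 1)) (at (c p))) (at (c p))"
        by (rule smooth_on_has_derivative[OF smooth_on_frechet_derivative[OF s] op])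
      fix x assume "x \<in> c ` W"
      then obtain q where q: "q \<in> W" "x = c q" by auto
      then show "frechet_derivative ?f (at x) (axis j 1) = coord_field A (U, c) j (inv_into U c x) f"
        using W chart_inv[OF ch(1), of q] smooth_nearI[OF W(1) q(1) W(4)]
        by (auto simp: coord_field_def dir_deriv_def comp_def)
    qed
    from dir_deriv_eq[OF ch _ this]
    show ?thesis
      using smooth_nearI[OF W(1,2) coord_field_smooth[OF ch(1) W(1,3,4)]]
      by (simp add: coord_field_def)
  qed
  show ?thesis unfolding D by (rule second_derivative_symmetric[OF s op])
qed

section \<open>Vector fields and the Lie bracket\<close>

lemma vf_tangent: "X \<in> vector_fields A U \<Longrightarrow> p \<in> U \<Longrightarrow> X p \<in> tangent_space A p"
  unfolding vector_fields_def by blast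

lemma vf_smooth:
  "X \<in> vector_fields A U \<Longrightarrow> open W \<Longrightarrow> W \<subseteq> U \<Longrightarrow> smooth_fun A W f \<Longrightarrow> smooth_fun A W (\<lambda>q. X q f)"
  unfolding vector_fields_def by simp

lemma vfI:
  assumes "\<And>p. p \<in> U \<Longrightarrow> X p \<in> tangent_space A p"
    and "\<And>W f. open W \<Longrightarrow> W \<subseteq> U \<Longrightarrow> smooth_fun A W f \<Longrightarrow> smooth_fun A W (\<lambda>q. X q f)"
  shows "X \<in> vector_fields A U"
  using assms unfolding vector_fields_def by simp

lemma vf_subset: "X \<in> vector_fields A U \<Longrightarrow> V \<subseteq> U \<Longrightarrow> X \<in> vector_fields A V"
  by (rule vfI) (auto intro: vf_tangent vf_smooth)

lemma vf_local:
  assumes "\<And>p. p \<in> U \<Longrightarrow> \<exists>V. open V \<and> p \<in> V \<and> X \<in> vector_fields A V"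
  shows "X \<in> vector_fields A U"
proof (rule vfI)
  show "X p \<in> tangent_space A p" if "p \<in> U" for p using assms[OF that] vf_tangent by blast
  fix W f assume W: "open W" "W \<subseteq> U" "smooth_fun A W f"
  show "smooth_fun A W (\<lambda>p. X p f)"
  proof (rule smooth_fun_local)
    fix p assume p: "p \<in> W"
    then obtain V where V: "open V" "p \<in> V" "X \<in> vector_fields A V" using assms W by blast
    have "smooth_fun A (W \<inter> V) (\<lambda>p. X p f)"
      using W V by (intro vf_smooth[OF V(3)]) (auto intro: smooth_fun_subset[of W f])
    then show "\<exists>V. open V \<and> p \<in> V \<and> V \<subseteq> W \<and> smooth_fun A V (\<lambda>p. X p f)"
      using W V p by (intro exI[of _ "W \<inter> V"]) auto
  qed
qed

lemma vf_cong:
  assumes "X \<in> vector_fields A U" "\<And>q. q \<in> U \<Longrightarrow> Y q = X q"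
  shows "Y \<in> vector_fields A U"
proof (rule vfI)
  show "Y p \<in> tangent_space A p" if "p \<in> U" for p using vf_tangent[OF assms(1)] assms(2) that by simp
  fix W f assume "open W" "W \<subseteq> U" "smooth_fun A W f"
  then show "smooth_fun A W (\<lambda>p. Y p f)"
    using assms(2) vf_smooth[OF assms(1)] by (intro smooth_fun_cong[of W "\<lambda>p. X p f" "\<lambda>p. Y p f"]) auto
qed

lemma vf_add:
  assumes "X \<in> vector_fields A U" "Y \<in> vector_fields A U"
  shows "(\<lambda>q. X q + Y q) \<in> vector_fields A U"
  using assms by (intro vfI) (simp_all add: tangent_add vf_tangent smooth_fun_add vf_smooth)

lemma vf_scale:
  assumes "X \<in> vector_fields A U" "smooth_fun A U f"
  shows "(\<lambda>q. f q *\<^sub>T X q) \<in> vector_fields A U"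
  using assms
  by (intro vfI, simp add: tangent_scale vf_tangent)
    (simp add: tv_scale_def smooth_fun_mult vf_smooth smooth_fun_subset[of U f])

lemma vf_const_scale: "X \<in> vector_fields A U \<Longrightarrow> (\<lambda>q. s *\<^sub>T X q) \<in> vector_fields A U"
  by (intro vfI, simp add: tangent_scale vf_tangent)
    (simp add: tv_scale_def smooth_fun_mult vf_smooth smooth_fun_const)

lemma vf_diff:
  assumes "X \<in> vector_fields A U" "Y \<in> vector_fields A U"
  shows "(\<lambda>q. X q - Y q) \<in> vector_fields A U"
  using assms by (intro vfI) (simp_all add: tangent_diff vf_tangent smooth_fun_diff vf_smooth)

lemma vf_coord:
  assumes "(U, c) \<in> A"
  shows "coord_field A (U, c) i \<in> vector_fields A U"
  using assms coord_field_smooth[OF assms]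
  by (intro vfI) (force simp: tangent_space_def coord_field_def, simp)

lemma bracket_apply:
  "smooth_near A p f \<Longrightarrow> lie_bracket A X Y p f = X p (\<lambda>q. Y q f) - Y p (\<lambda>q. X q f)"
  by (simp add: lie_bracket_def)

text \<open>X (Y f) has a first-order and a second-order part. The latter is symmetric in X and Y
  because coordinate fields commute, so it cancels in the commutator and a combination of coordinate
  vectors remains.\<close>

lemma bracket_tangent:
  assumes X: "X \<in> vector_fields A U" and Y: "Y \<in> vector_fields A U" and U: "open U" "p \<in> U"
  shows "lie_bracket A X Y p \<in> tangent_space A p"
proof -
  obtain V c where ch: "(V, c) \<in> A" "p \<in> V" by (rule ex_chart)
  let ?E = "coord_field A (V, c)" and ?x = "\<lambda>i q. c q $ i"
  define W where "W = U \<inter> V"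
  have W: "open W" "p \<in> W" "W \<subseteq> U" "W \<subseteq> V"
    using U ch chart_open[OF ch(1)] by (auto simp: W_def)
  have half: "X p (\<lambda>q. Y q f) = (\<Sum>j\<in>UNIV. X p (\<lambda>q. Y q (?x j)) * ?E j p f)
      + (\<Sum>j\<in>UNIV. \<Sum>i\<in>UNIV. Y p (?x j) * X p (?x i) * ?E i p (\<lambda>q. ?E j q f))"
    if X: "X \<in> vector_fields A U" and Y: "Y \<in> vector_fields A U" and f: "smooth_near A p f" for X Y f
  proof -
    obtain S where S: "open S" "p \<in> S" "S \<subseteq> W" "smooth_fun A S f" using smooth_nearE[OF f W(1,2)] .
    have Xp: "X p \<in> tangent_space A p" using vf_tangent[OF X U(2)] .
    have sY: "smooth_fun A S (\<lambda>q. Y q (?x j))" for j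
      using smooth_fun_subset[OF smooth_fun_coord[OF ch(1)]] S W by (intro vf_smooth[OF Y]) auto
    have sE: "smooth_fun A S (\<lambda>q. ?E j q f)" for j
      using S W by (intro coord_field_smooth[OF ch(1)]) auto
    have n: "smooth_near A p h" if "smooth_fun A S h" for h
      using smooth_nearI[OF S(1,2) that] .
    have sum: "X p (\<lambda>q. \<Sum>j\<in>I. h j q) = (\<Sum>j\<in>I. X p (h j))" if "finite I" "\<And>j. smooth_fun A S (h j)"
      for I :: "3 set" and h
      using that(1)
    proof (induction I)
      case empty
      then show ?case using tangent_apply_const[OF Xp] by simp
    next
      case (insert a I)
      then show ?case
        using tangent_apply_add[OF Xp n n, OF that(2)[of a] smooth_fun_sum[OF S(1), of I h, OF that(2)]]
        by simp
    qed
    have "X p (\<lambda>q. Y q f) = X p (\<lambda>q. \<Sum>j\<in>UNIV. Y q (?x j) * ?E j q f)"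
      by (rule tangent_cong[OF Xp S(1,2)])
         (use tangent_expand[OF ch(1) _ vf_tangent[OF Y]] S W in blast)
    also have "\<dots> = (\<Sum>j\<in>UNIV. X p (\<lambda>q. Y q (?x j) * ?E j q f))"
      using sY sE S by (intro sum smooth_fun_mult) auto
    also have "\<dots> = (\<Sum>j\<in>UNIV. Y p (?x j) * X p (\<lambda>q. ?E j q f) + X p (\<lambda>q. Y q (?x j)) * ?E j p f)"
      using sY sE n by (intro sum.cong tangent_apply_mult[OF Xp]) auto
    also have "\<dots> = (\<Sum>j\<in>UNIV. Y p (?x j) * (\<Sum>i\<in>UNIV. X p (?x i) * ?E i p (\<lambda>q. ?E j q f))
        + X p (\<lambda>q. Y q (?x j)) * ?E j p f)"
      by (intro sum.cong refl arg_cong2[of _ _ _ _ "(+)"] arg_cong2[of _ _ _ _ "(*)"] tangent_expand[OF ch Xp])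
    finally show ?thesis by (simp add: sum.distrib sum_distrib_left mult.assoc)
  qed
  have "lie_bracket A X Y p f
      = (\<Sum>j\<in>UNIV. (X p (\<lambda>q. Y q (?x j)) - Y p (\<lambda>q. X q (?x j))) * ?E j p f)" for f
  proof (cases "smooth_near A p f")
    case True
    have "(\<Sum>j\<in>UNIV. \<Sum>i\<in>UNIV. X p (?x j) * Y p (?x i) * ?E i p (\<lambda>q. ?E j q f))
        = (\<Sum>i\<in>UNIV. \<Sum>j\<in>UNIV. X p (?x j) * Y p (?x i) * ?E i p (\<lambda>q. ?E j q f))"
      by (rule sum.swap)
    also have "\<dots> = (\<Sum>i\<in>UNIV. \<Sum>j\<in>UNIV. Y p (?x i) * X p (?x j) * ?E j p (\<lambda>q. ?E i q f))"
      by (simp add: coord_field_commute[OF ch True] mult.commute)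
    finally show ?thesis
      unfolding bracket_apply[OF True] half[OF X Y True] half[OF Y X True]
      by (simp add: left_diff_distrib sum_subtractf)
  next
    case False
    then show ?thesis by (simp add: lie_bracket_def coord_field_def dir_deriv_def)
  qed
  then have "lie_bracket A X Y p
      = (\<lambda>f. \<Sum>j\<in>UNIV. (X p (\<lambda>q. Y q (?x j)) - Y p (\<lambda>q. X q (?x j))) * ?E j p f)" by blast
  then show ?thesis by (simp only: tangentI[OF ch])
qed

lemma vf_bracket:
  assumes X: "X \<in> vector_fields A U" and Y: "Y \<in> vector_fields A U" and U: "open U"
  shows "lie_bracket A X Y \<in> vector_fields A U"
proof (rule vfI)
  show "lie_bracket A X Y p \<in> tangent_space A p" if "p \<in> U" for p
    using bracket_tangent[OF X Y U that] .
  fix W f assume W: "open W" "W \<subseteq> U" "smooth_fun A W f"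
  then have "smooth_fun A W (\<lambda>p. X p (\<lambda>q. Y q f) - Y p (\<lambda>q. X q f))"
    by (intro smooth_fun_diff vf_smooth[OF X] vf_smooth[OF Y]) auto
  then show "smooth_fun A W (\<lambda>p. lie_bracket A X Y p f)"
    using W by (elim smooth_fun_cong[rotated]) (auto intro!: bracket_apply smooth_nearI)
qed

lemma bracket_anti: "lie_bracket A X Y p = - lie_bracket A Y X p"
  by (auto simp: lie_bracket_def)

lemma bracket_cong:
  assumes X: "X \<in> vector_fields A U" and Y: "Y \<in> vector_fields A U" and U: "open U" "p \<in> U"
    and eq: "\<And>q. q \<in> U \<Longrightarrow> X' q = X q" "\<And>q. q \<in> U \<Longrightarrow> Y' q = Y q"
  shows "lie_bracket A X' Y' p = lie_bracket A X Y p"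
proof
  fix f
  have "X p (\<lambda>q. Y' q f) = X p (\<lambda>q. Y q f)"
    by (rule tangent_cong[OF vf_tangent[OF X U(2)] U]) (simp add: eq)
  moreover have "Y p (\<lambda>q. X' q f) = Y p (\<lambda>q. X q f)"
    by (rule tangent_cong[OF vf_tangent[OF Y U(2)] U]) (simp add: eq)
  ultimately show "lie_bracket A X' Y' p f = lie_bracket A X Y p f"
    using eq U(2) by (simp add: lie_bracket_def)
qed

lemma bracket_add_right:
  assumes X: "X \<in> vector_fields A U" and Y: "Y \<in> vector_fields A U" and Z: "Z \<in> vector_fields A U"
    and U: "open U" "p \<in> U"
  shows "lie_bracket A X (\<lambda>q. Y q + Z q) p = lie_bracket A X Y p + lie_bracket A X Z p"
proof
  fix f
  show "lie_bracket A X (\<lambda>q. Y q + Z q) p f = (lie_bracket A X Y p + lie_bracket A X Z p) f"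
  proof (cases "smooth_near A p f")
    case True
    obtain W where W: "open W" "p \<in> W" "W \<subseteq> U" "smooth_fun A W f" using smooth_nearE[OF True U] .
    have "X p (\<lambda>q. Y q f + Z q f) = X p (\<lambda>q. Y q f) + X p (\<lambda>q. Z q f)"
      by (intro tangent_apply_add[OF vf_tangent[OF X U(2)]] smooth_nearI[OF W(1,2)]
          vf_smooth[OF Y] vf_smooth[OF Z] W)
    then show ?thesis by (simp add: bracket_apply[OF True])
  qed (simp add: lie_bracket_def)
qed

lemma bracket_scale_right:
  assumes X: "X \<in> vector_fields A U" and Y: "Y \<in> vector_fields A U" and h: "smooth_fun A U h"
    and U: "open U" "p \<in> U"
  shows "lie_bracket A X (\<lambda>q. h q *\<^sub>T Y q) p = h p *\<^sub>T lie_bracket A X Y p + X p h *\<^sub>T Y p"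
proof
  fix f
  show "lie_bracket A X (\<lambda>q. h q *\<^sub>T Y q) p f = (h p *\<^sub>T lie_bracket A X Y p + X p h *\<^sub>T Y p) f"
  proof (cases "smooth_near A p f")
    case True
    obtain W where W: "open W" "p \<in> W" "W \<subseteq> U" "smooth_fun A W f" using smooth_nearE[OF True U] .
    have "X p (\<lambda>q. h q * Y q f) = h p * X p (\<lambda>q. Y q f) + X p h * Y p f"
      by (intro tangent_apply_mult[OF vf_tangent[OF X U(2)]] smooth_nearI[OF W(1,2)]
          vf_smooth[OF Y] smooth_fun_subset[OF h] W)
    then show ?thesis by (simp add: bracket_apply[OF True] tv_scale_def algebra_simps)
  next
    case False
    then show ?thesis using tangent_not_smooth[OF vf_tangent[OF Y U(2)] False]
      by (simp add: lie_bracket_def tv_scale_def)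
  qed
qed

end

section \<open>The Levi-Civita connection\<close>

lemma sum_tvec_apply: "(\<Sum>i\<in>I. F i) f = (\<Sum>i\<in>I. (F i f :: real))" for F :: "'i \<Rightarrow> 'a tvec"
  by (induction I rule: infinite_finite_induct) (simp_all add: zero_fun_def)

lemma tv_scale_apply: "(r *\<^sub>T v) f = r * v f"
  by (simp add: tv_scale_def)

lemma tv_scale_one [simp]: "1 *\<^sub>T v = v"
  by (simp add: tv_scale_def)

context manifold
begin

lemma tangent_sum: "(\<And>i. i \<in> I \<Longrightarrow> F i \<in> tangent_space A p) \<Longrightarrow> (\<Sum>i\<in>I. F i) \<in> tangent_space A p"
  by (induction I rule: infinite_finite_induct) (simp_all add: tangent_zero tangent_add)

lemma vf_sum: "(\<And>i. i \<in> I \<Longrightarrow> F i \<in> vector_fields A U) \<Longrightarrow> (\<lambda>q. \<Sum>i\<in>I. F i q) \<in> vector_fields A U"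
proof (induction I rule: infinite_finite_induct)
  case (insert i I)
  then have "(\<lambda>q. F i q + (\<Sum>i\<in>I. F i q)) \<in> vector_fields A U" by (intro vf_add) auto
  then show ?case by (simp only: sum.insert[OF insert.hyps])
qed (intro vfI; simp add: tangent_zero smooth_fun_const)+

lemma tangent_expand_sum:
  assumes ch: "(U, c) \<in> A" "p \<in> U" and v: "v \<in> tangent_space A p"
  shows "v = (\<Sum>i\<in>UNIV. v (\<lambda>q. c q $ i) *\<^sub>T coord_field A (U, c) i p)"
  by (rule ext, subst tangent_expand[OF ch v]) (simp add: sum_tvec_apply tv_scale_apply)

text \<open>The extension has constant coefficients in one chart and so lives on its domain only.
  This suffices because metric and connection are given on fields over every open set.\<close>

lemma tangent_extend:
  assumes v: "v \<in> tangent_space A p" and U: "open U" "p \<in> U"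
  obtains W Z where "open W" "p \<in> W" "W \<subseteq> U" "Z \<in> vector_fields A W" "Z p = v"
proof -
  obtain V c where ch: "(V, c) \<in> A" "p \<in> V" by (rule ex_chart)
  let ?Z = "\<lambda>q. \<Sum>i\<in>UNIV. v (\<lambda>q. c q $ i) *\<^sub>T coord_field A (V, c) i q"
  have "?Z \<in> vector_fields A (U \<inter> V)"
    by (intro vf_sum vf_const_scale vf_subset[OF vf_coord[OF ch(1)]]) auto
  then show ?thesis
    using that[of "U \<inter> V" ?Z] U ch chart_open[OF ch(1)] tangent_expand_sum[OF ch v] by (simp add: open_Int)
qed

end

locale pseudo_riemannian = manifold A
  for A :: "('a::{t2_space,second_countable_topology}) atlas" +
  fixes g :: "'a metric_field"
  assumes metric: "pseudo_riemannian_metric A g"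
begin

lemma
  assumes "v \<in> tangent_space A p" "w \<in> tangent_space A p"
  shows g_sym: "g p v w = g p w v"
    and g_add_left: "u \<in> tangent_space A p \<Longrightarrow> g p (v + w) u = g p v u + g p w u"
    and g_scale_left: "g p (s *\<^sub>T v) w = s * g p v w"
proof -
  have lin: "g p (s *\<^sub>T v + t *\<^sub>T w) u = s * g p v u + t * g p w u"
    if "u \<in> tangent_space A p" "v \<in> tangent_space A p" "w \<in> tangent_space A p" for u v w s t
    using metric that unfolding pseudo_riemannian_metric_def by (elim conjE) simp
  show "g p v w = g p w v"
    using metric assms unfolding pseudo_riemannian_metric_def by (elim conjE) simp
  show "g p (v + w) u = g p v u + g p w u" if "u \<in> tangent_space A p"
    using lin[OF that assms, of 1 1] by simp
  have "s *\<^sub>T v = s *\<^sub>T v + 0 *\<^sub>T v" by (simp add: tv_scale_def fun_eq_iff)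
  then show "g p (s *\<^sub>T v) w = s * g p v w"
    using lin[OF assms(2,1,1), of s 0] by simp
qed

lemma g_nondegenerate:
  "v \<in> tangent_space A p \<Longrightarrow> (\<And>w. w \<in> tangent_space A p \<Longrightarrow> g p v w = 0) \<Longrightarrow> v = 0"
  using metric unfolding pseudo_riemannian_metric_def by (elim conjE) simp

lemma g_smooth:
  "X \<in> vector_fields A U \<Longrightarrow> Y \<in> vector_fields A U \<Longrightarrow> open U \<Longrightarrow> smooth_fun A U (\<lambda>p. g p (X p) (Y p))"
  using metric unfolding pseudo_riemannian_metric_def by (elim conjE) simp

lemma g_add_right:
  "u \<in> tangent_space A p \<Longrightarrow> v \<in> tangent_space A p \<Longrightarrow> w \<in> tangent_space A p \<Longrightarrow>
    g p u (v + w) = g p u v + g p u w"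
  using g_add_left[of v p w u] g_sym[of u p] by (simp add: tangent_add)

lemma g_scale_right:
  "v \<in> tangent_space A p \<Longrightarrow> w \<in> tangent_space A p \<Longrightarrow> g p v (s *\<^sub>T w) = s * g p v w"
  using g_scale_left[of w p v s] g_sym[of v p] by (simp add: tangent_scale)

lemma g_minus_left: "v \<in> tangent_space A p \<Longrightarrow> w \<in> tangent_space A p \<Longrightarrow> g p (- v) w = - g p v w"
  using g_scale_left[of v p w "- 1"] by (simp add: tv_scale_def fun_Compl_def)

lemma g_diff_left:
  "v \<in> tangent_space A p \<Longrightarrow> w \<in> tangent_space A p \<Longrightarrow> u \<in> tangent_space A p \<Longrightarrow>
    g p (v - w) u = g p v u - g p w u"
  using g_add_left[of v p "- w" u] by (simp add: tangent_minus g_minus_left)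

lemma g_zero_left: "w \<in> tangent_space A p \<Longrightarrow> g p 0 w = 0"
proof -
  assume w: "w \<in> tangent_space A p"
  have "0 *\<^sub>T 0 = (0 :: 'a tvec)" by (simp add: fun_eq_iff tv_scale_apply)
  then show ?thesis using g_scale_left[OF tangent_zero w, of 0] by simp
qed

lemma g_sum_left:
  "(\<And>i. i \<in> I \<Longrightarrow> F i \<in> tangent_space A p) \<Longrightarrow> w \<in> tangent_space A p \<Longrightarrow>
    g p (\<Sum>i\<in>I. F i) w = (\<Sum>i\<in>I. g p (F i) w)"
  by (induction I rule: infinite_finite_induct)
     (simp_all add: g_zero_left g_add_left tangent_sum)

lemma tangent_eqI:
  assumes "v \<in> tangent_space A p" "w \<in> tangent_space A p"
    and "\<And>u. u \<in> tangent_space A p \<Longrightarrow> g p v u = g p w u"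
  shows "v = w"
proof -
  have "v - w = 0"
    by (rule g_nondegenerate[of _ p]) (simp_all add: assms tangent_diff g_diff_left)
  then show ?thesis by simp
qed

text \<open>Nondegeneracy with test vectors that are values of local fields: the Koszul expression
  differentiates its arguments and can therefore be evaluated on fields only.\<close>

lemma tangent_eqI_fields:
  assumes vw: "v \<in> tangent_space A p" "w \<in> tangent_space A p" and U: "open U" "p \<in> U"
    and eq: "\<And>W Z. open W \<Longrightarrow> p \<in> W \<Longrightarrow> W \<subseteq> U \<Longrightarrow> Z \<in> vector_fields A W \<Longrightarrow> g p v (Z p) = g p w (Z p)"
  shows "v = w"
proof (rule tangent_eqI[OF vw])
  fix u assume "u \<in> tangent_space A p"
  then obtain W Z where "open W" "p \<in> W" "W \<subseteq> U" "Z \<in> vector_fields A W" "Z p = u"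
    using tangent_extend U by blast
  then show "g p v u = g p w u" using eq by blast
qed

section \<open>The Koszul expression\<close>

lemma deriv_g_add:
  assumes "open U" "p \<in> U" "X \<in> vector_fields A U" "Y \<in> vector_fields A U" "Z \<in> vector_fields A U"
    "V \<in> vector_fields A U"
  shows deriv_g_add_left: "V p (\<lambda>q. g q (X q + Y q) (Z q)) = V p (\<lambda>q. g q (X q) (Z q)) + V p (\<lambda>q. g q (Y q) (Z q))"
    and deriv_g_add_right: "V p (\<lambda>q. g q (Z q) (X q + Y q)) = V p (\<lambda>q. g q (Z q) (X q)) + V p (\<lambda>q. g q (Z q) (Y q))"
proof -
  note V = vf_tangent[OF assms(6,2)]
  note t = vf_tangent[OF assms(3)] vf_tangent[OF assms(4)] vf_tangent[OF assms(5)]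
  have "V p (\<lambda>q. g q (X q + Y q) (Z q)) = V p (\<lambda>q. g q (X q) (Z q) + g q (Y q) (Z q))"
    by (rule tangent_cong[OF V assms(1,2)]) (simp add: g_add_left t)
  also have "\<dots> = V p (\<lambda>q. g q (X q) (Z q)) + V p (\<lambda>q. g q (Y q) (Z q))"
    by (rule tangent_apply_add[OF V]) (intro smooth_nearI[OF assms(1,2)] g_smooth assms)+
  finally show "V p (\<lambda>q. g q (X q + Y q) (Z q)) = V p (\<lambda>q. g q (X q) (Z q)) + V p (\<lambda>q. g q (Y q) (Z q))" .
  have "V p (\<lambda>q. g q (Z q) (X q + Y q)) = V p (\<lambda>q. g q (Z q) (X q) + g q (Z q) (Y q))"
    by (rule tangent_cong[OF V assms(1,2)]) (simp add: g_add_right t)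
  also have "\<dots> = V p (\<lambda>q. g q (Z q) (X q)) + V p (\<lambda>q. g q (Z q) (Y q))"
    by (rule tangent_apply_add[OF V]) (intro smooth_nearI[OF assms(1,2)] g_smooth assms)+
  finally show "V p (\<lambda>q. g q (Z q) (X q + Y q)) = V p (\<lambda>q. g q (Z q) (X q)) + V p (\<lambda>q. g q (Z q) (Y q))" .
qed

lemma deriv_g_scale:
  assumes "open U" "p \<in> U" "X \<in> vector_fields A U" "Z \<in> vector_fields A U" "smooth_fun A U f"
    "V \<in> vector_fields A U"
  shows deriv_g_scale_left: "V p (\<lambda>q. g q (f q *\<^sub>T X q) (Z q)) = f p * V p (\<lambda>q. g q (X q) (Z q)) + V p f * g p (X p) (Z p)"
    and deriv_g_scale_right: "V p (\<lambda>q. g q (Z q) (f q *\<^sub>T X q)) = f p * V p (\<lambda>q. g q (Z q) (X q)) + V p f * g p (Z p) (X p)"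
proof -
  note V = vf_tangent[OF assms(6,2)]
  note t = vf_tangent[OF assms(3)] vf_tangent[OF assms(4)]
  have "V p (\<lambda>q. g q (f q *\<^sub>T X q) (Z q)) = V p (\<lambda>q. f q * g q (X q) (Z q))"
    by (rule tangent_cong[OF V assms(1,2)]) (simp add: g_scale_left t)
  also have "\<dots> = f p * V p (\<lambda>q. g q (X q) (Z q)) + V p f * g p (X p) (Z p)"
    by (rule tangent_apply_mult[OF V]) (intro smooth_nearI[OF assms(1,2)] g_smooth assms)+
  finally show "V p (\<lambda>q. g q (f q *\<^sub>T X q) (Z q)) = f p * V p (\<lambda>q. g q (X q) (Z q)) + V p f * g p (X p) (Z p)" .
  have "V p (\<lambda>q. g q (Z q) (f q *\<^sub>T X q)) = V p (\<lambda>q. f q * g q (Z q) (X q))"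
    by (rule tangent_cong[OF V assms(1,2)]) (simp add: g_scale_right t)
  also have "\<dots> = f p * V p (\<lambda>q. g q (Z q) (X q)) + V p f * g p (Z p) (X p)"
    by (rule tangent_apply_mult[OF V]) (intro smooth_nearI[OF assms(1,2)] g_smooth assms)+
  finally show "V p (\<lambda>q. g q (Z q) (f q *\<^sub>T X q)) = f p * V p (\<lambda>q. g q (Z q) (X q)) + V p f * g p (Z p) (X p)" .
qed

lemma deriv_g_sym:
  assumes "open U" "p \<in> U" "X \<in> vector_fields A U" "Y \<in> vector_fields A U" "V \<in> vector_fields A U"
  shows "V p (\<lambda>q. g q (X q) (Y q)) = V p (\<lambda>q. g q (Y q) (X q))"
  by (rule tangent_cong[OF vf_tangent[OF assms(5,2)] assms(1,2)])
     (use g_sym vf_tangent assms in blast)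

text \<open>Normalised by 1/2, so that it is the prospective value of g(D_X Y, Z) itself.\<close>

definition koszul :: "'a vfield \<Rightarrow> 'a vfield \<Rightarrow> 'a vfield \<Rightarrow> 'a \<Rightarrow> real" where
  "koszul X Y Z p =
     (X p (\<lambda>q. g q (Y q) (Z q)) + Y p (\<lambda>q. g q (X q) (Z q)) - Z p (\<lambda>q. g q (X q) (Y q))
      + g p (lie_bracket A X Y p) (Z p) - g p (lie_bracket A X Z p) (Y p)
      - g p (lie_bracket A Y Z p) (X p)) / 2"

lemma bracket_add_left:
  assumes "X \<in> vector_fields A U" "Y \<in> vector_fields A U" "Z \<in> vector_fields A U" "open U" "p \<in> U"
  shows "lie_bracket A (\<lambda>q. X q + Y q) Z p = lie_bracket A X Z p + lie_bracket A Y Z p"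
  using bracket_add_right[OF assms(3,1,2,4,5)]
  by (simp add: bracket_anti[of "\<lambda>q. X q + Y q" Z] bracket_anti[of X Z] bracket_anti[of Y Z])

lemma bracket_scale_left:
  assumes "X \<in> vector_fields A U" "Y \<in> vector_fields A U" "smooth_fun A U h" "open U" "p \<in> U"
  shows "lie_bracket A (\<lambda>q. h q *\<^sub>T X q) Y p = h p *\<^sub>T lie_bracket A X Y p - Y p h *\<^sub>T X p"
  using bracket_scale_right[OF assms(2,1,3,4,5)]
  by (simp add: bracket_anti[of "\<lambda>q. h q *\<^sub>T X q" Y] bracket_anti[of X Y] fun_eq_iff tv_scale_apply)

context
  fixes U X Y Z p
  assumes U: "open U" "p \<in> U"
    and X: "X \<in> vector_fields A U" and Y: "Y \<in> vector_fields A U" and Z: "Z \<in> vector_fields A U"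
begin

lemma koszul_cong:
  assumes "\<And>q. q \<in> U \<Longrightarrow> X' q = X q" "\<And>q. q \<in> U \<Longrightarrow> Y' q = Y q" "\<And>q. q \<in> U \<Longrightarrow> Z' q = Z q"
  shows "koszul X' Y' Z' p = koszul X Y Z p"
proof -
  have c: "v (\<lambda>q. g q (Y' q) (Z' q)) = v (\<lambda>q. g q (Y q) (Z q))"
    "v (\<lambda>q. g q (X' q) (Z' q)) = v (\<lambda>q. g q (X q) (Z q))"
    "v (\<lambda>q. g q (X' q) (Y' q)) = v (\<lambda>q. g q (X q) (Y q))" if "v \<in> tangent_space A p" for v
    using assms by (auto intro!: tangent_cong[OF that U])
  show ?thesis
    unfolding koszul_def
    using assms(1-3)[OF U(2)] c[OF vf_tangent[OF X U(2)]] c[OF vf_tangent[OF Y U(2)]]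
      c[OF vf_tangent[OF Z U(2)]] bracket_cong[OF X Y U assms(1,2)] bracket_cong[OF X Z U assms(1,3)]
      bracket_cong[OF Y Z U assms(2,3)]
    by simp
qed

lemmas koszul_tangent = vf_tangent[OF X U(2)] vf_tangent[OF Y U(2)] vf_tangent[OF Z U(2)]
  bracket_tangent[OF X Y U] bracket_tangent[OF X Z U] bracket_tangent[OF Y Z U]

text \<open>This and the next identity are vanishing torsion and metric compatibility, stated before
  any vector represents the expression.\<close>

lemma koszul_torsion: "koszul X Y Z p - koszul Y X Z p = g p (lie_bracket A X Y p) (Z p)"
  unfolding koszul_def bracket_anti[of Y X] using koszul_tangent
  by (simp add: deriv_g_sym[OF U X Y Z] g_minus_left field_simps)

lemma koszul_metric: "koszul X Y Z p + koszul X Z Y p = X p (\<lambda>q. g q (Y q) (Z q))"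
  unfolding koszul_def bracket_anti[of Z Y] using koszul_tangent
  by (simp add: deriv_g_sym[OF U Z Y X] deriv_g_sym[OF U X Z Y] deriv_g_sym[OF U X Y Z]
      g_minus_left field_simps)

lemma koszul_add1:
  assumes V: "V \<in> vector_fields A U"
  shows "koszul (\<lambda>q. X q + V q) Y Z p = koszul X Y Z p + koszul V Y Z p"
  unfolding koszul_def
  using koszul_tangent vf_tangent[OF V U(2)] bracket_tangent[OF V Y U] bracket_tangent[OF V Z U]
  by (simp add: deriv_g_add_left[OF U X V] Y Z bracket_add_left[OF X V _ U] g_add_left g_add_right)
     (simp add: field_simps)

lemma koszul_add2:
  assumes V: "V \<in> vector_fields A U"
  shows "koszul X (\<lambda>q. Y q + V q) Z p = koszul X Y Z p + koszul X V Z p"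
  unfolding koszul_def
  using koszul_tangent vf_tangent[OF V U(2)] bracket_tangent[OF X V U] bracket_tangent[OF V Z U]
  by (simp add: deriv_g_add_left[OF U Y V] deriv_g_add_right[OF U Y V] X Z
      bracket_add_left[OF Y V _ U] bracket_add_right[OF X Y V U] g_add_left g_add_right)
     (simp add: field_simps)

lemma koszul_add3:
  assumes V: "V \<in> vector_fields A U"
  shows "koszul X Y (\<lambda>q. Z q + V q) p = koszul X Y Z p + koszul X Y V p"
  unfolding koszul_def
  using koszul_tangent vf_tangent[OF V U(2)] bracket_tangent[OF X V U] bracket_tangent[OF Y V U]
  by (simp add: deriv_g_add_right[OF U Z V] X Y
      bracket_add_right[OF X Z V U] bracket_add_right[OF Y Z V U] g_add_left g_add_right)
     (simp add: field_simps)

lemma koszul_scale1: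
  assumes f: "smooth_fun A U f"
  shows "koszul (\<lambda>q. f q *\<^sub>T X q) Y Z p = f p * koszul X Y Z p"
  unfolding koszul_def using koszul_tangent g_sym[OF koszul_tangent(1,2)] g_sym[OF koszul_tangent(1,3)]
  by (simp add: deriv_g_scale_left[OF U X _ f] Y Z bracket_scale_left[OF X _ f U] g_scale_left
      g_scale_right g_diff_left tangent_scale)
     (simp add: tv_scale_apply field_simps)

text \<open>The middle slot is the one that is differentiated: the extra term is the Leibniz rule of
  a connection. In the first and third slot the derivatives of \<open>f\<close> from the metric
  terms cancel those from the brackets.\<close>

lemma koszul_scale2:
  assumes f: "smooth_fun A U f"
  shows "koszul X (\<lambda>q. f q *\<^sub>T Y q) Z p = f p * koszul X Y Z p + X p f * g p (Y p) (Z p)"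
  unfolding koszul_def using koszul_tangent g_sym[OF koszul_tangent(1,2)] g_sym[OF koszul_tangent(1,3)]
    g_sym[OF koszul_tangent(2,3)]
  by (simp add: deriv_g_scale_left[OF U Y _ f] deriv_g_scale_right[OF U Y _ f] X Z
      bracket_scale_left[OF Y _ f U] bracket_scale_right[OF X Y f U] g_scale_left g_add_left
      g_scale_right g_diff_left tangent_scale)
     (simp add: tv_scale_apply field_simps)

lemma koszul_scale3:
  assumes f: "smooth_fun A U f"
  shows "koszul X Y (\<lambda>q. f q *\<^sub>T Z q) p = f p * koszul X Y Z p"
  unfolding koszul_def using koszul_tangent g_sym[OF koszul_tangent(1,2)] g_sym[OF koszul_tangent(1,3)]
    g_sym[OF koszul_tangent(2,3)]
  by (simp add: deriv_g_scale_right[OF U Z _ f] X Y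
      bracket_scale_right[OF X Z f U] bracket_scale_right[OF Y Z f U] g_scale_left g_add_left
      g_scale_right g_diff_left tangent_scale)
     (simp add: tv_scale_apply field_simps)

end

end

section \<open>Pseudo-orthonormal frames and existence of the Levi-Civita connection\<close>

definition orthonormal_frame ::
  "('a::topological_space) atlas \<Rightarrow> 'a metric_field \<Rightarrow> (3 \<Rightarrow> real) \<Rightarrow> 'a set \<Rightarrow> (3 \<Rightarrow> 'a vfield) \<Rightarrow> bool" where
  "orthonormal_frame A g s U E \<longleftrightarrow> open U \<and> (\<forall>i. E i \<in> vector_fields A U) \<and>
     (\<forall>p\<in>U. \<forall>i j. g p (E i p) (E j p) = (if i = j then s i else 0))"

text \<open>Frames of one fixed signature around every point are assumed here and will be supplied
  by \<phi>-bases. In such a frame raising an index is multiplication by the sign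
  \<open>s i\<close>, which replaces the inverse metric matrix.\<close>

locale framed_manifold = pseudo_riemannian A g
  for A :: "('a::{t2_space,second_countable_topology}) atlas" and g +
  fixes s :: "3 \<Rightarrow> real"
  assumes sign: "s i * s i = 1"
    and ex_frame: "\<exists>U E. p \<in> U \<and> orthonormal_frame A g s U E"
begin

lemma frameD:
  assumes "orthonormal_frame A g s U E"
  shows frame_open: "open U" and frame_vf: "E i \<in> vector_fields A U"
    and frame_g: "p \<in> U \<Longrightarrow> g p (E i p) (E j p) = (if i = j then s i else 0)"
    and frame_tangent: "p \<in> U \<Longrightarrow> E i p \<in> tangent_space A p"
  using assms vf_tangent unfolding orthonormal_frame_def by auto

lemma frame_subset: "orthonormal_frame A g s U E \<Longrightarrow> open V \<Longrightarrow> V \<subseteq> U \<Longrightarrow> orthonormal_frame A g s V E"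
  unfolding orthonormal_frame_def using vf_subset by blast

text \<open>The two matrices express frame and coordinate vectors through each other. Orthonormality
  gives the product in one order; the other order follows because a one-sided inverse of a square
  matrix is two-sided, and this is where the frame is seen to span.\<close>

lemma frame_chart_matrices:
  assumes E: "orthonormal_frame A g s U E" "p \<in> U" and ch: "(V, c) \<in> A" "p \<in> V"
  defines "d \<equiv> \<lambda>i. coord_field A (V, c) i p" and "x \<equiv> \<lambda>i q. c q $ i"
  shows "(\<Sum>k\<in>UNIV. E i p (x k) * (s j * g p (d k) (E j p))) = (if i = j then 1 else 0)"
    and "(\<Sum>j\<in>UNIV. (s j * g p (d k) (E j p)) * E j p (x l)) = (if k = l then 1 else 0)"
proof -
  let ?S = "\<chi> i k. E i p (x k)" and ?N = "\<chi> k j. s j * g p (d k) (E j p)"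
  have d: "d k \<in> tangent_space A p" for k unfolding d_def by (rule vf_tangent[OF vf_coord ch(2)]) (rule ch)
  note E' = frame_tangent[OF E]
  have 1: "(\<Sum>k\<in>UNIV. E i p (x k) * (s j * g p (d k) (E j p))) = (if i = j then 1 else 0)" for i j
  proof -
    have "(\<Sum>k\<in>UNIV. E i p (x k) * (s j * g p (d k) (E j p)))
        = s j * g p (\<Sum>k\<in>UNIV. E i p (x k) *\<^sub>T d k) (E j p)"
      by (simp add: g_sum_left g_scale_left tangent_scale d E' sum_distrib_left mult_ac)
    also have "(\<Sum>k\<in>UNIV. E i p (x k) *\<^sub>T d k) = E i p"
      unfolding d_def x_def by (rule tangent_expand_sum[OF ch E', symmetric])
    finally show ?thesis using sign[of i] frame_g[OF E] by (cases "i = j") simp_all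
  qed
  then show "(\<Sum>k\<in>UNIV. E i p (x k) * (s j * g p (d k) (E j p))) = (if i = j then 1 else 0)" .
  have "?S ** ?N = mat 1" by (simp add: vec_eq_iff matrix_matrix_mult_def mat_def 1)
  then have "?N ** ?S = mat 1" using matrix_left_right_inverse by blast
  then have "(?N ** ?S) $ k $ l = mat 1 $ k $ l" by simp
  then show "(\<Sum>j\<in>UNIV. (s j * g p (d k) (E j p)) * E j p (x l)) = (if k = l then 1 else 0)"
    by (simp add: matrix_matrix_mult_def mat_def)
qed

lemma frame_expand:
  assumes E: "orthonormal_frame A g s U E" "p \<in> U" and v: "v \<in> tangent_space A p"
  shows "v = (\<Sum>i\<in>UNIV. (s i * g p v (E i p)) *\<^sub>T E i p)"
proof
  fix f
  obtain V c where ch: "(V, c) \<in> A" "p \<in> V" by (rule ex_chart)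
  let ?d = "\<lambda>i. coord_field A (V, c) i p" and ?x = "\<lambda>i q. c q $ i"
  have d: "?d k \<in> tangent_space A p" for k by (rule vf_tangent[OF vf_coord ch(2)]) (rule ch)
  note E' = frame_tangent[OF E]
  have v': "v = (\<Sum>k\<in>UNIV. v (?x k) *\<^sub>T ?d k)" by (rule tangent_expand_sum[OF ch v])
  have gv: "g p v (E j p) = (\<Sum>k\<in>UNIV. v (?x k) * g p (?d k) (E j p))" for j
    by (subst v') (simp add: g_sum_left g_scale_left tangent_scale d E')
  have "(\<Sum>j\<in>UNIV. (s j * g p v (E j p)) * E j p f)
      = (\<Sum>j\<in>UNIV. \<Sum>k\<in>UNIV. v (?x k) * ((s j * g p (?d k) (E j p)) * E j p f))"
    by (simp add: gv sum_distrib_left sum_distrib_right mult_ac)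
  also have "\<dots> = (\<Sum>k\<in>UNIV. v (?x k) * (\<Sum>j\<in>UNIV. (s j * g p (?d k) (E j p)) * E j p f))"
    by (subst sum.swap) (simp add: sum_distrib_left)
  finally have v1: "(\<Sum>j\<in>UNIV. (s j * g p v (E j p)) * E j p f)
    = (\<Sum>k\<in>UNIV. v (?x k) * (\<Sum>j\<in>UNIV. (s j * g p (?d k) (E j p)) * E j p f))" .
  have dk: "(\<Sum>j\<in>UNIV. (s j * g p (?d k) (E j p)) * E j p f) = ?d k f" for k
  proof -
    have "(\<Sum>j\<in>UNIV. (s j * g p (?d k) (E j p)) * E j p f)
        = (\<Sum>j\<in>UNIV. (s j * g p (?d k) (E j p)) * (\<Sum>l\<in>UNIV. E j p (?x l) * ?d l f))"
      by (intro sum.cong refl arg_cong2[of _ _ _ _ "(*)"] tangent_expand[OF ch E'])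
    also have "\<dots> = (\<Sum>l\<in>UNIV. (\<Sum>j\<in>UNIV. (s j * g p (?d k) (E j p)) * E j p (?x l)) * ?d l f)"
      by (simp add: sum_distrib_left sum_distrib_right mult.assoc) (rule sum.swap)
    also have "\<dots> = (\<Sum>l\<in>UNIV. (if k = l then 1 else 0) * ?d l f)"
      by (intro sum.cong refl arg_cong2[of _ _ _ _ "(*)"] frame_chart_matrices(2)[OF E ch])
    also have "\<dots> = ?d k f" by (simp add: if_distrib[of "\<lambda>z. z * _"] cong: if_cong)
    finally show ?thesis .
  qed
  show "v f = (\<Sum>i\<in>UNIV. (s i * g p v (E i p)) *\<^sub>T E i p) f"
    unfolding sum_tvec_apply tv_scale_apply v1 dk by (rule tangent_expand[OF ch v])
qed

lemma koszul_smooth: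
  assumes "open U" "X \<in> vector_fields A U" "Y \<in> vector_fields A U" "Z \<in> vector_fields A U"
  shows "smooth_fun A U (koszul X Y Z)"
proof -
  have "smooth_fun A U (\<lambda>p. koszul X Y Z p)"
    unfolding koszul_def
    by (intro smooth_fun_intros vf_smooth[OF assms(2,1)] vf_smooth[OF assms(3,1)]
        vf_smooth[OF assms(4,1)] g_smooth vf_bracket assms order.refl)
  then show ?thesis by simp
qed

text \<open>Tensoriality in the last slot: the expression depends on \<open>Z\<close> through its
  value at \<open>p\<close>, so a vector can represent it.\<close>

lemma koszul_frame:
  assumes E: "orthonormal_frame A g s U E" and p: "p \<in> U"
    and X: "X \<in> vector_fields A U" and Y: "Y \<in> vector_fields A U" and Z: "Z \<in> vector_fields A U"
  shows "koszul X Y Z p = (\<Sum>i\<in>UNIV. s i * g p (Z p) (E i p) * koszul X Y (E i) p)"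
proof -
  note U = frame_open[OF E] p
  let ?f = "\<lambda>i q. s i * g q (Z q) (E i q)"
  have f: "smooth_fun A U (?f i)" for i
    by (intro smooth_fun_intros g_smooth U Z frame_vf[OF E])
  have F: "(\<lambda>q. ?f i q *\<^sub>T E i q) \<in> vector_fields A U" for i
    by (rule vf_scale[OF frame_vf[OF E] f])
  have F12: "(\<lambda>q. ?f 1 q *\<^sub>T E 1 q + ?f 2 q *\<^sub>T E 2 q) \<in> vector_fields A U"
    by (rule vf_add[OF F F])
  have "koszul X Y (\<lambda>q. ?f 1 q *\<^sub>T E 1 q + ?f 2 q *\<^sub>T E 2 q + ?f 3 q *\<^sub>T E 3 q) p = koszul X Y Z p"
    by (rule koszul_cong[OF U X Y Z refl refl]) (use frame_expand[OF E _ vf_tangent[OF Z]] in \<open>simp add: sum_3\<close>)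
  then show ?thesis
    unfolding koszul_add3[OF U X Y F12 F] koszul_add3[OF U X Y F F]
      koszul_scale3[OF U X Y frame_vf[OF E] f]
    by (simp add: sum_3)
qed

text \<open>The vector representing \<open>koszul X Y\<close> at \<open>p\<close>. The frame is
  chosen anew at every point, so smoothness in \<open>p\<close> is not visible from the formula; it
  follows once any frame is known to give the same vector.\<close>

definition nabla :: "'a vfield \<Rightarrow> 'a vfield \<Rightarrow> 'a vfield" where
  "nabla X Y p = (let E = SOME E. \<exists>U. p \<in> U \<and> orthonormal_frame A g s U E
     in \<Sum>i\<in>UNIV. (s i * koszul X Y (E i) p) *\<^sub>T E i p)"

lemma nabla_at:
  assumes U: "open U" "p \<in> U" and X: "X \<in> vector_fields A U" and Y: "Y \<in> vector_fields A U"
  shows nabla_tangent: "nabla X Y p \<in> tangent_space A p"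
    and nabla_koszul: "Z \<in> vector_fields A U \<Longrightarrow> g p (nabla X Y p) (Z p) = koszul X Y Z p"
proof -
  define E where "E = (SOME E. \<exists>U. p \<in> U \<and> orthonormal_frame A g s U E)"
  have "\<exists>E U. p \<in> U \<and> orthonormal_frame A g s U E" using ex_frame[of p] by blast
  from someI_ex[OF this, folded E_def] obtain V where "p \<in> V" and V: "orthonormal_frame A g s V E" by blast
  then have E: "orthonormal_frame A g s (U \<inter> V) E" and p: "p \<in> U \<inter> V"
    using frame_subset[OF V, of "U \<inter> V"] U frame_open[OF V] by auto
  have n: "nabla X Y p = (\<Sum>i\<in>UNIV. (s i * koszul X Y (E i) p) *\<^sub>T E i p)"
    unfolding nabla_def Let_def E_def ..
  note t = frame_tangent[OF E p]
  show "nabla X Y p \<in> tangent_space A p" unfolding n by (intro tangent_sum tangent_scale t)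
  assume Z: "Z \<in> vector_fields A U"
  have Zp: "Z p \<in> tangent_space A p" using vf_tangent[OF Z U(2)] .
  have XYZ: "X \<in> vector_fields A (U \<inter> V)" "Y \<in> vector_fields A (U \<inter> V)" "Z \<in> vector_fields A (U \<inter> V)"
    using vf_subset[OF X] vf_subset[OF Y] vf_subset[OF Z] by auto
  show "g p (nabla X Y p) (Z p) = koszul X Y Z p"
    unfolding n koszul_frame[OF E p XYZ]
    by (simp add: g_sum_left g_scale_left tangent_scale t Zp g_sym[OF Zp t] mult_ac)
qed

lemma nabla_frame:
  assumes E: "orthonormal_frame A g s U E" "p \<in> U"
    and X: "X \<in> vector_fields A U" and Y: "Y \<in> vector_fields A U"
  shows "nabla X Y p = (\<Sum>i\<in>UNIV. (s i * koszul X Y (E i) p) *\<^sub>T E i p)"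
  by (subst frame_expand[OF E nabla_tangent[OF frame_open[OF E(1)] E(2) X Y]])
     (simp add: nabla_koszul[OF frame_open[OF E(1)] E(2) X Y frame_vf[OF E(1)]])

lemma nabla_vf:
  assumes U: "open U" and X: "X \<in> vector_fields A U" and Y: "Y \<in> vector_fields A U"
  shows "nabla X Y \<in> vector_fields A U"
proof (rule vf_local)
  fix p assume p: "p \<in> U"
  obtain V E where V: "p \<in> V" "orthonormal_frame A g s V E" using ex_frame[of p] by blast
  let ?W = "U \<inter> V"
  have E: "orthonormal_frame A g s ?W E" using frame_subset[OF V(2)] U frame_open[OF V(2)] by auto
  note W = frame_open[OF E]
  have XY: "X \<in> vector_fields A ?W" "Y \<in> vector_fields A ?W"
    using vf_subset[OF X] vf_subset[OF Y] by auto
  have "(\<lambda>q. \<Sum>i\<in>UNIV. (s i * koszul X Y (E i) q) *\<^sub>T E i q) \<in> vector_fields A ?W"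
    by (intro vf_sum vf_scale frame_vf[OF E] smooth_fun_mult smooth_fun_const W
        koszul_smooth XY)
  then have "nabla X Y \<in> vector_fields A ?W"
    by (rule vf_cong) (rule nabla_frame[OF E _ XY])
  then show "\<exists>V. open V \<and> p \<in> V \<and> nabla X Y \<in> vector_fields A V" using W p V(1) by blast
qed

text \<open>\<open>levi_civita\<close> is a choice among the connections with these axioms, so
  nothing can be said about it before a witness exists. Each axiom is a property of
  \<open>koszul\<close> read through nondegeneracy.\<close>

lemma nabla_levi_civita: "is_levi_civita A g nabla"
  unfolding is_levi_civita_def is_connection_def
proof (intro conjI allI impI ballI)
  fix U X Y assume U: "open U" and X: "X \<in> vector_fields A U" and Y: "Y \<in> vector_fields A U"
  show "nabla X Y \<in> vector_fields A U" by (rule nabla_vf[OF U X Y])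
  note sub = vf_subset[OF X] vf_subset[OF Y]
  {
    fix Z p assume Z: "Z \<in> vector_fields A U" and p: "p \<in> U"
    note t = nabla_tangent[OF U p X Y] nabla_tangent[OF U p Z Y] nabla_tangent[OF U p X Z]
      nabla_tangent[OF U p vf_add[OF X Z] Y] nabla_tangent[OF U p X vf_add[OF Y Z]]
    show "nabla (\<lambda>q. X q + Z q) Y p = nabla X Y p + nabla Z Y p"
    proof (rule tangent_eqI_fields[OF _ _ U p])
      fix W V assume W: "open W" "p \<in> W" "W \<subseteq> U" and V: "V \<in> vector_fields A W"
      note s = sub[OF W(3)] vf_subset[OF Z W(3)]
      show "g p (nabla (\<lambda>q. X q + Z q) Y p) (V p) = g p (nabla X Y p + nabla Z Y p) (V p)"
        using t vf_tangent[OF V W(2)] nabla_koszul[OF W(1,2) vf_add[OF s(1,3)] s(2) V]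
          nabla_koszul[OF W(1,2) s(1,2) V] nabla_koszul[OF W(1,2) s(3,2) V]
          koszul_add1[OF W(1,2) s(1,2) V s(3)]
        by (simp add: g_add_left)
    qed (intro t tangent_add)+
    show "nabla X (\<lambda>q. Y q + Z q) p = nabla X Y p + nabla X Z p"
    proof (rule tangent_eqI_fields[OF _ _ U p])
      fix W V assume W: "open W" "p \<in> W" "W \<subseteq> U" and V: "V \<in> vector_fields A W"
      note s = sub[OF W(3)] vf_subset[OF Z W(3)]
      show "g p (nabla X (\<lambda>q. Y q + Z q) p) (V p) = g p (nabla X Y p + nabla X Z p) (V p)"
        using t vf_tangent[OF V W(2)] nabla_koszul[OF W(1,2) s(1) vf_add[OF s(2,3)] V]
          nabla_koszul[OF W(1,2) s(1,2) V] nabla_koszul[OF W(1,2) s(1,3) V]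
          koszul_add2[OF W(1,2) s(1,2) V s(3)]
        by (simp add: g_add_left)
    qed (intro t tangent_add)+
  }
  {
    fix f p assume f: "smooth_fun A U f" and p: "p \<in> U"
    note t = nabla_tangent[OF U p X Y] nabla_tangent[OF U p vf_scale[OF X f] Y]
      nabla_tangent[OF U p X vf_scale[OF Y f]] vf_tangent[OF Y p]
    show "nabla (\<lambda>q. f q *\<^sub>T X q) Y p = f p *\<^sub>T nabla X Y p"
    proof (rule tangent_eqI_fields[OF _ _ U p])
      fix W V assume W: "open W" "p \<in> W" "W \<subseteq> U" and V: "V \<in> vector_fields A W"
      note s = sub[OF W(3)] and f' = smooth_fun_subset[OF f W(3)]
      show "g p (nabla (\<lambda>q. f q *\<^sub>T X q) Y p) (V p) = g p (f p *\<^sub>T nabla X Y p) (V p)"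
        using t vf_tangent[OF V W(2)] nabla_koszul[OF W(1,2) vf_scale[OF s(1) f'] s(2) V]
          nabla_koszul[OF W(1,2) s(1,2) V] koszul_scale1[OF W(1,2) s(1,2) V f']
        by (simp add: g_scale_left)
    qed (intro t tangent_scale)+
    show "nabla X (\<lambda>q. f q *\<^sub>T Y q) p = X p f *\<^sub>T Y p + f p *\<^sub>T nabla X Y p"
    proof (rule tangent_eqI_fields[OF _ _ U p])
      fix W V assume W: "open W" "p \<in> W" "W \<subseteq> U" and V: "V \<in> vector_fields A W"
      note s = sub[OF W(3)] and f' = smooth_fun_subset[OF f W(3)]
      show "g p (nabla X (\<lambda>q. f q *\<^sub>T Y q) p) (V p) = g p (X p f *\<^sub>T Y p + f p *\<^sub>T nabla X Y p) (V p)"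
        using t vf_tangent[OF V W(2)] nabla_koszul[OF W(1,2) s(1) vf_scale[OF s(2) f'] V]
          nabla_koszul[OF W(1,2) s(1,2) V] koszul_scale2[OF W(1,2) s(1,2) V f']
        by (simp add: g_scale_left g_add_left tangent_scale)
    qed (intro t tangent_scale tangent_add)+
  }
  fix p assume p: "p \<in> U"
  note t = nabla_tangent[OF U p X Y] nabla_tangent[OF U p Y X]
  show "nabla X Y p - nabla Y X p = lie_bracket A X Y p"
  proof (rule tangent_eqI_fields[OF _ _ U p])
    fix W V assume W: "open W" "p \<in> W" "W \<subseteq> U" and V: "V \<in> vector_fields A W"
    note s = sub[OF W(3)]
    show "g p (nabla X Y p - nabla Y X p) (V p) = g p (lie_bracket A X Y p) (V p)"
      using t vf_tangent[OF V W(2)] nabla_koszul[OF W(1,2) s(1,2) V] nabla_koszul[OF W(1,2) s(2,1) V]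
        koszul_torsion[OF W(1,2) s(1,2) V]
      by (simp add: g_diff_left)
  qed (intro t tangent_diff bracket_tangent[OF X Y U p])+
  fix Z assume Z: "Z \<in> vector_fields A U"
  show "X p (\<lambda>q. g q (Y q) (Z q)) = g p (nabla X Y p) (Z p) + g p (Y p) (nabla X Z p)"
    using nabla_koszul[OF U p X Y Z] nabla_koszul[OF U p X Z Y] koszul_metric[OF U p X Y Z]
      g_sym[OF vf_tangent[OF Y p] nabla_tangent[OF U p X Z]]
    by simp
qed

abbreviation LC :: "'a vfield \<Rightarrow> 'a vfield \<Rightarrow> 'a vfield" where
  "LC \<equiv> levi_civita A g"

lemma levi_civita: "is_levi_civita A g LC"
  unfolding levi_civita_def by (rule someI[where P = "is_levi_civita A g"]) (rule nabla_levi_civita)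

lemma
  assumes U: "open U" and X: "X \<in> vector_fields A U" and Y: "Y \<in> vector_fields A U"
  shows lc_vf: "LC X Y \<in> vector_fields A U"
    and lc_add1: "Z \<in> vector_fields A U \<Longrightarrow> p \<in> U \<Longrightarrow> LC (\<lambda>q. X q + Z q) Y p = LC X Y p + LC Z Y p"
    and lc_add2: "Z \<in> vector_fields A U \<Longrightarrow> p \<in> U \<Longrightarrow> LC X (\<lambda>q. Y q + Z q) p = LC X Y p + LC X Z p"
    and lc_scale1: "smooth_fun A U f \<Longrightarrow> p \<in> U \<Longrightarrow> LC (\<lambda>q. f q *\<^sub>T X q) Y p = f p *\<^sub>T LC X Y p"
    and lc_scale2: "smooth_fun A U f \<Longrightarrow> p \<in> U \<Longrightarrow>
      LC X (\<lambda>q. f q *\<^sub>T Y q) p = X p f *\<^sub>T Y p + f p *\<^sub>T LC X Y p"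
    and lc_torsion: "p \<in> U \<Longrightarrow> LC X Y p - LC Y X p = lie_bracket A X Y p"
    and lc_metric: "Z \<in> vector_fields A U \<Longrightarrow> p \<in> U \<Longrightarrow>
      X p (\<lambda>q. g q (Y q) (Z q)) = g p (LC X Y p) (Z p) + g p (Y p) (LC X Z p)"
proof -
  from levi_civita have *: "is_connection A LC" and
    **: "open U \<longrightarrow> (\<forall>X\<in>vector_fields A U. \<forall>Y\<in>vector_fields A U. \<forall>p\<in>U.
        LC X Y p - LC Y X p = lie_bracket A X Y p \<and>
        (\<forall>Z\<in>vector_fields A U.
           X p (\<lambda>q. g q (Y q) (Z q)) = g p (LC X Y p) (Z p) + g p (Y p) (LC X Z p)))"
    unfolding is_levi_civita_def by simp_all
  from * have c: "LC X Y \<in> vector_fields A U \<and>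
        (\<forall>Z\<in>vector_fields A U. \<forall>p\<in>U.
           LC (\<lambda>q. X q + Z q) Y p = LC X Y p + LC Z Y p \<and>
           LC X (\<lambda>q. Y q + Z q) p = LC X Y p + LC X Z p) \<and>
        (\<forall>f. smooth_fun A U f \<longrightarrow> (\<forall>p\<in>U.
           LC (\<lambda>q. f q *\<^sub>T X q) Y p = f p *\<^sub>T LC X Y p \<and>
           LC X (\<lambda>q. f q *\<^sub>T Y q) p = X p f *\<^sub>T Y p + f p *\<^sub>T LC X Y p))"
    unfolding is_connection_def using U X Y by simp
  from c show "LC X Y \<in> vector_fields A U" by (elim conjE)
  show "LC (\<lambda>q. X q + Z q) Y p = LC X Y p + LC Z Y p"
    "LC X (\<lambda>q. Y q + Z q) p = LC X Y p + LC X Z p" if "Z \<in> vector_fields A U" "p \<in> U"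
    using c that by simp_all
  show "LC (\<lambda>q. f q *\<^sub>T X q) Y p = f p *\<^sub>T LC X Y p"
    "LC X (\<lambda>q. f q *\<^sub>T Y q) p = X p f *\<^sub>T Y p + f p *\<^sub>T LC X Y p" if "smooth_fun A U f" "p \<in> U"
    using c that by simp_all
  show "LC X Y p - LC Y X p = lie_bracket A X Y p" if "p \<in> U"
    using ** U X Y that by simp
  show "X p (\<lambda>q. g q (Y q) (Z q)) = g p (LC X Y p) (Z p) + g p (Y p) (LC X Z p)"
    if "Z \<in> vector_fields A U" "p \<in> U"
    using ** U X Y that by simp
qed

text \<open>Uniqueness: the axioms alone determine this value, whichever connection the choice has
  picked.\<close>

lemma lc_koszul:
  assumes U: "open U" "p \<in> U" and X: "X \<in> vector_fields A U" and Y: "Y \<in> vector_fields A U"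
    and Z: "Z \<in> vector_fields A U"
  shows "g p (LC X Y p) (Z p) = koszul X Y Z p"
proof -
  have t: "X p \<in> tangent_space A p" "Y p \<in> tangent_space A p" "Z p \<in> tangent_space A p"
    using vf_tangent X Y Z U(2) by blast+
  have l: "LC V W p \<in> tangent_space A p" if "V \<in> vector_fields A U" "W \<in> vector_fields A U" for V W
    using vf_tangent[OF lc_vf[OF U(1) that] U(2)] .
  show ?thesis
    unfolding koszul_def lc_metric[OF U(1) X Y Z U(2)] lc_metric[OF U(1) Y X Z U(2)]
      lc_metric[OF U(1) Z X Y U(2)] lc_torsion[OF U(1) X Y U(2), symmetric]
      lc_torsion[OF U(1) X Z U(2), symmetric] lc_torsion[OF U(1) Y Z U(2), symmetric]
    using t l[OF X Y] l[OF Y X] l[OF X Z] l[OF Z X] l[OF Y Z] l[OF Z Y]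
    by (simp add: g_diff_left g_sym[OF t(1)] g_sym[OF t(2)] g_sym[OF t(3)])
qed

lemma lc_frame:
  assumes E: "orthonormal_frame A g s U E" "p \<in> U"
    and X: "X \<in> vector_fields A U" and Y: "Y \<in> vector_fields A U"
  shows "LC X Y p = (\<Sum>i\<in>UNIV. (s i * koszul X Y (E i) p) *\<^sub>T E i p)"
  by (subst frame_expand[OF E vf_tangent[OF lc_vf[OF frame_open[OF E(1)] X Y] E(2)]])
     (simp add: lc_koszul[OF frame_open[OF E(1)] E(2) X Y frame_vf[OF E(1)]])

text \<open>Fields are total functions with arbitrary values outside \<open>U\<close>, and frame
  expansions hold on \<open>U\<close> only. This permits inserting them under a covariant
  derivative.\<close>

lemma lc_cong:
  assumes U: "open U" "p \<in> U" and X: "X \<in> vector_fields A U" and Y: "Y \<in> vector_fields A U"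
    and eq: "\<And>q. q \<in> U \<Longrightarrow> X' q = X q" "\<And>q. q \<in> U \<Longrightarrow> Y' q = Y q"
  shows "LC X' Y' p = LC X Y p"
proof -
  have X': "X' \<in> vector_fields A U" and Y': "Y' \<in> vector_fields A U"
    using vf_cong[OF X] vf_cong[OF Y] eq by auto
  show ?thesis
  proof (rule tangent_eqI_fields[OF _ _ U])
    fix W Z assume W: "open W" "p \<in> W" "W \<subseteq> U" and Z: "Z \<in> vector_fields A W"
    note sub = vf_subset[OF _ W(3)]
    have "koszul X' Y' Z p = koszul X Y Z p"
      using W(3) eq by (intro koszul_cong[OF W(1,2) sub[OF X] sub[OF Y] Z]) auto
    then show "g p (LC X' Y' p) (Z p) = g p (LC X Y p) (Z p)"
      by (simp add: lc_koszul[OF W(1,2) sub[OF X'] sub[OF Y'] Z]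
          lc_koszul[OF W(1,2) sub[OF X] sub[OF Y] Z])
  qed (rule vf_tangent[OF lc_vf[OF U(1)] U(2)]; fact X Y X' Y')+
qed

end

section \<open>Curvature\<close>

context framed_manifold
begin

lemma lc_diff1:
  assumes "open U" "X \<in> vector_fields A U" "Y \<in> vector_fields A U" "Z \<in> vector_fields A U" "p \<in> U"
  shows "LC (\<lambda>q. X q - Z q) Y p = LC X Y p - LC Z Y p"
  using lc_add1[OF assms(1) vf_diff[OF assms(2,4)] assms(3,4,5)] by (simp add: algebra_simps)

abbreviation R :: "'a vfield \<Rightarrow> 'a vfield \<Rightarrow> 'a vfield \<Rightarrow> 'a vfield" where
  "R \<equiv> curvature A g"

lemma curvature_LC: "R X Y Z p = LC X (LC Y Z) p - LC Y (LC X Z) p - LC (lie_bracket A X Y) Z p"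
  by (simp add: curvature_def Let_def)

section \<open>Tensoriality of the curvature\<close>

context
  fixes U X Y Z p
  assumes U: "open U" "p \<in> U"
    and X: "X \<in> vector_fields A U" and Y: "Y \<in> vector_fields A U" and Z: "Z \<in> vector_fields A U"
begin

lemma R_tangent: "R X Y Z p \<in> tangent_space A p"
  unfolding curvature_LC using X Y Z U
  by (intro tangent_diff vf_tangent[OF lc_vf[of U]] lc_vf[of U] vf_bracket)

lemma R_cong:
  assumes eq: "\<And>q. q \<in> U \<Longrightarrow> X' q = X q" "\<And>q. q \<in> U \<Longrightarrow> Y' q = Y q" "\<And>q. q \<in> U \<Longrightarrow> Z' q = Z q"
  shows "R X' Y' Z' p = R X Y Z p"
proof -
  have "LC Y' Z' q = LC Y Z q" "LC X' Z' q = LC X Z q" "lie_bracket A X' Y' q = lie_bracket A X Y q"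
    if "q \<in> U" for q
    using lc_cong[OF U(1) that Y Z eq(2,3)] lc_cong[OF U(1) that X Z eq(1,3)]
      bracket_cong[OF X Y U(1) that eq(1,2)] by auto
  then show ?thesis
    unfolding curvature_LC
    using lc_cong[OF U X lc_vf[OF U(1) Y Z] eq(1)] lc_cong[OF U Y lc_vf[OF U(1) X Z] eq(2)]
      lc_cong[OF U vf_bracket[OF X Y U(1)] Z _ eq(3)]
    by simp
qed

lemma R_anti: "R X Y Z p = - R Y X Z p"
proof -
  have "lie_bracket A X Y = (\<lambda>q. (- 1) *\<^sub>T lie_bracket A Y X q)"
    by (intro ext, subst bracket_anti) (simp add: tv_scale_apply)
  then have "LC (lie_bracket A X Y) Z p = LC (\<lambda>q. (- 1) *\<^sub>T lie_bracket A Y X q) Z p"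
    by (simp only:)
  also have "\<dots> = (- 1) *\<^sub>T LC (lie_bracket A Y X) Z p"
    by (rule lc_scale1[OF U(1) vf_bracket[OF Y X U(1)] Z smooth_fun_const[OF U(1)] U(2)])
  finally show ?thesis unfolding curvature_LC by (simp add: fun_eq_iff tv_scale_apply)
qed

lemma R_add1:
  assumes V: "V \<in> vector_fields A U"
  shows "R (\<lambda>q. X q + V q) Y Z p = R X Y Z p + R V Y Z p"
proof -
  note l = lc_vf[OF U(1)]
  have "LC Y (LC (\<lambda>q. X q + V q) Z) p = LC Y (\<lambda>q. LC X Z q + LC V Z q) p"
    by (rule lc_cong[OF U Y vf_add[OF l[OF X Z] l[OF V Z]] refl]) (rule lc_add1[OF U(1) X Z V])
  moreover have "LC (lie_bracket A (\<lambda>q. X q + V q) Y) Z p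
      = LC (\<lambda>q. lie_bracket A X Y q + lie_bracket A V Y q) Z p"
    by (rule lc_cong[OF U vf_add[OF vf_bracket[OF X Y U(1)] vf_bracket[OF V Y U(1)]] Z _ refl])
       (rule bracket_add_left[OF X V Y U(1)])
  ultimately show ?thesis
    unfolding curvature_LC lc_add1[OF U(1) X l[OF Y Z] V U(2)]
    by (simp add: lc_add2[OF U(1) Y l[OF X Z] l[OF V Z] U(2)]
        lc_add1[OF U(1) vf_bracket[OF X Y U(1)] Z vf_bracket[OF V Y U(1)] U(2)])
qed

text \<open>The Leibniz term Y(f) D_X Z is cancelled by the summand -Y(f) X of [f X, Y].\<close>

lemma R_scale1:
  assumes f: "smooth_fun A U f"
  shows "R (\<lambda>q. f q *\<^sub>T X q) Y Z p = f p *\<^sub>T R X Y Z p"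
proof -
  note l = lc_vf[OF U(1)] and b = vf_bracket[OF X Y U(1)]
  have f': "smooth_fun A U (\<lambda>q. Y q f)" by (rule vf_smooth[OF Y U(1) order.refl f])
  have "LC Y (LC (\<lambda>q. f q *\<^sub>T X q) Z) p = LC Y (\<lambda>q. f q *\<^sub>T LC X Z q) p"
    by (rule lc_cong[OF U Y vf_scale[OF l[OF X Z] f] refl]) (rule lc_scale1[OF U(1) X Z f])
  moreover have "LC (lie_bracket A (\<lambda>q. f q *\<^sub>T X q) Y) Z p
      = LC (\<lambda>q. f q *\<^sub>T lie_bracket A X Y q - Y q f *\<^sub>T X q) Z p"
    by (rule lc_cong[OF U vf_diff[OF vf_scale[OF b f] vf_scale[OF X f']] Z _ refl])
       (rule bracket_scale_left[OF X Y f U(1)])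
  ultimately show ?thesis
    unfolding curvature_LC
    by (simp add: lc_scale1[OF U(1) X l[OF Y Z] f U(2)] lc_scale2[OF U(1) Y l[OF X Z] f U(2)]
        lc_diff1[OF U(1) vf_scale[OF b f] Z vf_scale[OF X f'] U(2)]
        lc_scale1[OF U(1) b Z f U(2)] lc_scale1[OF U(1) X Z f' U(2)])
       (simp add: fun_eq_iff tv_scale_apply algebra_simps)
qed

lemma R_add3:
  assumes V: "V \<in> vector_fields A U"
  shows "R X Y (\<lambda>q. Z q + V q) p = R X Y Z p + R X Y V p"
proof -
  note l = lc_vf[OF U(1)]
  have "LC X (LC Y (\<lambda>q. Z q + V q)) p = LC X (\<lambda>q. LC Y Z q + LC Y V q) p"
    by (rule lc_cong[OF U X vf_add[OF l[OF Y Z] l[OF Y V]] refl]) (rule lc_add2[OF U(1) Y Z V])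
  moreover have "LC Y (LC X (\<lambda>q. Z q + V q)) p = LC Y (\<lambda>q. LC X Z q + LC X V q) p"
    by (rule lc_cong[OF U Y vf_add[OF l[OF X Z] l[OF X V]] refl]) (rule lc_add2[OF U(1) X Z V])
  ultimately show ?thesis
    unfolding curvature_LC
    by (simp add: lc_add2[OF U(1) X l[OF Y Z] l[OF Y V] U(2)] lc_add2[OF U(1) Y l[OF X Z] l[OF X V] U(2)]
        lc_add2[OF U(1) vf_bracket[OF X Y U(1)] Z V U(2)])
qed

text \<open>The second derivatives of \<open>f\<close> combine to X (Y f) - Y (X f) - [X, Y] f = 0,
  and the mixed first-order terms are the same for both orders of differentiation.\<close>

lemma R_scale3:
  assumes f: "smooth_fun A U f"
  shows "R X Y (\<lambda>q. f q *\<^sub>T Z q) p = f p *\<^sub>T R X Y Z p"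
proof -
  note l = lc_vf[OF U(1)] and b = vf_bracket[OF X Y U(1)]
  have fY: "smooth_fun A U (\<lambda>q. Y q f)" by (rule vf_smooth[OF Y U(1) order.refl f])
  have fX: "smooth_fun A U (\<lambda>q. X q f)" by (rule vf_smooth[OF X U(1) order.refl f])
  have "LC X (LC Y (\<lambda>q. f q *\<^sub>T Z q)) p = LC X (\<lambda>q. Y q f *\<^sub>T Z q + f q *\<^sub>T LC Y Z q) p"
    by (rule lc_cong[OF U X vf_add[OF vf_scale[OF Z fY] vf_scale[OF l[OF Y Z] f]] refl])
       (rule lc_scale2[OF U(1) Y Z f])
  moreover have "LC Y (LC X (\<lambda>q. f q *\<^sub>T Z q)) p = LC Y (\<lambda>q. X q f *\<^sub>T Z q + f q *\<^sub>T LC X Z q) p"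
    by (rule lc_cong[OF U Y vf_add[OF vf_scale[OF Z fX] vf_scale[OF l[OF X Z] f]] refl])
       (rule lc_scale2[OF U(1) X Z f])
  moreover have "lie_bracket A X Y p f = X p (\<lambda>q. Y q f) - Y p (\<lambda>q. X q f)"
    by (rule bracket_apply[OF smooth_nearI[OF U f]])
  ultimately show ?thesis
    unfolding curvature_LC
    by (simp add: lc_add2[OF U(1) X vf_scale[OF Z fY] vf_scale[OF l[OF Y Z] f] U(2)]
        lc_add2[OF U(1) Y vf_scale[OF Z fX] vf_scale[OF l[OF X Z] f] U(2)]
        lc_scale2[OF U(1) X Z fY U(2)] lc_scale2[OF U(1) Y Z fX U(2)]
        lc_scale2[OF U(1) X l[OF Y Z] f U(2)] lc_scale2[OF U(1) Y l[OF X Z] f U(2)]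
        lc_scale2[OF U(1) b Z f U(2)])
       (simp add: fun_eq_iff tv_scale_apply algebra_simps)
qed

end

lemma R_add2:
  assumes U: "open U" "p \<in> U" and X: "X \<in> vector_fields A U" and Y: "Y \<in> vector_fields A U"
    and Z: "Z \<in> vector_fields A U" and V: "V \<in> vector_fields A U"
  shows "R X (\<lambda>q. Y q + V q) Z p = R X Y Z p + R X V Z p"
  unfolding R_anti[OF U X vf_add[OF Y V] Z] R_anti[OF U X Y Z] R_anti[OF U X V Z]
    R_add1[OF U Y X Z V] by simp

lemma R_scale2:
  assumes U: "open U" "p \<in> U" and X: "X \<in> vector_fields A U" and Y: "Y \<in> vector_fields A U"
    and Z: "Z \<in> vector_fields A U" and f: "smooth_fun A U f"
  shows "R X (\<lambda>q. f q *\<^sub>T Y q) Z p = f p *\<^sub>T R X Y Z p"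
  unfolding R_anti[OF U X vf_scale[OF Y f] Z] R_anti[OF U X Y Z] R_scale1[OF U Y X Z f]
  by (simp add: fun_eq_iff tv_scale_apply)

text \<open>The partial sum of two terms is listed because additivity of connection and curvature is
  applied to two fields at a time.\<close>

lemma frame_field_expand:
  fixes U E X
  defines "y \<equiv> \<lambda>i q. s i * g q (X q) (E i q)"
  assumes E: "orthonormal_frame A g s U E" and X: "X \<in> vector_fields A U"
  shows "smooth_fun A U (y i)" and "(\<lambda>q. y i q *\<^sub>T E i q) \<in> vector_fields A U"
    and "(\<lambda>q. y 1 q *\<^sub>T E 1 q + y 2 q *\<^sub>T E 2 q) \<in> vector_fields A U"
    and "q \<in> U \<Longrightarrow> y 1 q *\<^sub>T E 1 q + y 2 q *\<^sub>T E 2 q + y 3 q *\<^sub>T E 3 q = X q"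
proof -
  show y: "smooth_fun A U (y i)" for i
    unfolding y_def by (intro smooth_fun_intros g_smooth frame_open[OF E] X frame_vf[OF E])
  show v: "(\<lambda>q. y i q *\<^sub>T E i q) \<in> vector_fields A U" for i by (rule vf_scale[OF frame_vf[OF E] y])
  show "(\<lambda>q. y 1 q *\<^sub>T E 1 q + y 2 q *\<^sub>T E 2 q) \<in> vector_fields A U" by (rule vf_add[OF v v])
  show "q \<in> U \<Longrightarrow> y 1 q *\<^sub>T E 1 q + y 2 q *\<^sub>T E 2 q + y 3 q *\<^sub>T E 3 q = X q"
    using frame_expand[OF E _ vf_tangent[OF X]] by (simp add: sum_3 y_def)
qed

lemma R_frame1:
  assumes E: "orthonormal_frame A g s U E" "p \<in> U" and X: "X \<in> vector_fields A U"
    and Y: "Y \<in> vector_fields A U" and Z: "Z \<in> vector_fields A U"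
  shows "R X Y Z p = (\<Sum>i\<in>UNIV. (s i * g p (X p) (E i p)) *\<^sub>T R (E i) Y Z p)"
proof -
  note U = frame_open[OF E(1)] E(2) and e = frame_vf[OF E(1)]
    let ?y = "\<lambda>i q. s i * g q (X q) (E i q)"
    note y = frame_field_expand[OF E(1) X]
  have "R (\<lambda>q. ?y 1 q *\<^sub>T E 1 q + ?y 2 q *\<^sub>T E 2 q + ?y 3 q *\<^sub>T E 3 q) Y Z p = R X Y Z p"
    by (rule R_cong[OF U X Y Z y(4) refl refl])
  then show ?thesis
    unfolding R_add1[OF U y(3) Y Z y(2)] R_add1[OF U y(2) Y Z y(2)] R_scale1[OF U e Y Z y(1)]
    by (simp add: sum_3)
qed

section \<open>Ricci tensor and scalar curvature as frame traces\<close>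

lemma chart_at_cases:
  obtains V c where "chart_at A p = (V, c)" "(V, c) \<in> A" "p \<in> V"
proof -
  obtain V0 c0 where "(V0, c0) \<in> A" "p \<in> V0" by (rule ex_chart)
  then have ex: "\<exists>ch. ch \<in> A \<and> p \<in> fst ch" by force
  obtain V c where Vc: "chart_at A p = (V, c)" by force
  then show ?thesis using that someI_ex[OF ex] by (auto simp: chart_at_def)
qed

text \<open>Basis independence of the trace: coordinate fields in the first slot are expanded in the
  frame, and the coordinate components of R(E_a, Y)Z are then reassembled into a vector.\<close>

lemma ricci_frame:
  assumes E: "orthonormal_frame A g s U E" "p \<in> U"
    and Y: "Y \<in> vector_fields A U" and Z: "Z \<in> vector_fields A U"
  shows "ricci A g Y Z p = (\<Sum>a\<in>UNIV. s a * g p (R (E a) Y Z p) (E a p))"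
proof -
  obtain V c where Vc: "chart_at A p = (V, c)" and ch: "(V, c) \<in> A" "p \<in> V"
    by (rule chart_at_cases)
  let ?W = "U \<inter> V" and ?d = "coord_field A (V, c)" and ?x = "\<lambda>i q. c q $ i"
  have W: "open ?W" "p \<in> ?W" using frame_open[OF E(1)] chart_open[OF ch(1)] E(2) ch(2) by auto
  have E': "orthonormal_frame A g s ?W E" by (rule frame_subset[OF E(1) W(1)]) simp
  have vf: "?d i \<in> vector_fields A ?W" "E i \<in> vector_fields A ?W" "Y \<in> vector_fields A ?W"
    "Z \<in> vector_fields A ?W" for i
    using vf_subset[OF vf_coord[OF ch(1)]] frame_vf[OF E'] vf_subset[OF Y] vf_subset[OF Z] by auto
  have d: "?d i p \<in> tangent_space A p" for i by (rule vf_tangent[OF vf(1) W(2)])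
  note e = frame_tangent[OF E]
  have Rt: "R (E a) Y Z p \<in> tangent_space A p" for a by (rule R_tangent[OF W vf(2,3,4)])
  have Rx: "(\<Sum>i\<in>UNIV. R (E a) Y Z p (?x i) *\<^sub>T ?d i p) = R (E a) Y Z p" for a
    by (rule tangent_expand_sum[OF ch Rt, symmetric])
  have "ricci A g Y Z p = (\<Sum>i\<in>UNIV. R (?d i) Y Z p (?x i))"
    by (simp add: ricci_def Let_def Vc)
  also have "\<dots> = (\<Sum>i\<in>UNIV. \<Sum>a\<in>UNIV. (s a * g p (?d i p) (E a p)) * R (E a) Y Z p (?x i))"
    unfolding R_frame1[OF E' W(2) vf(1,3,4)] by (simp add: sum_tvec_apply tv_scale_apply)
  also have "\<dots> = (\<Sum>a\<in>UNIV. s a * g p (\<Sum>i\<in>UNIV. R (E a) Y Z p (?x i) *\<^sub>T ?d i p) (E a p))"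
    by (subst sum.swap)
       (simp add: g_sum_left g_scale_left tangent_scale d e sum_distrib_left mult_ac)
  finally show ?thesis unfolding Rx .
qed

lemma ricci_expand:
  assumes E: "orthonormal_frame A g s U E" "p \<in> U"
    and Y: "Y \<in> vector_fields A U" and Z: "Z \<in> vector_fields A U"
  shows "ricci A g Y Z p = (\<Sum>b\<in>UNIV. s b * g p (Y p) (E b p) *
    (\<Sum>c\<in>UNIV. s c * g p (Z p) (E c p) * ricci A g (E b) (E c) p))"
proof -
  note U = frame_open[OF E(1)] E(2) and e = frame_vf[OF E(1)] and et = frame_tangent[OF E]
  have lin1: "ricci A g Y Z p = (\<Sum>b\<in>UNIV. s b * g p (Y p) (E b p) * ricci A g (E b) Z p)"
    if Y: "Y \<in> vector_fields A U" and Z: "Z \<in> vector_fields A U" for Y Z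
  proof -
    let ?y = "\<lambda>i q. s i * g q (Y q) (E i q)"
    note y = frame_field_expand[OF E(1) Y]
    have "R (E a) Y Z p = ?y 1 p *\<^sub>T R (E a) (E 1) Z p + ?y 2 p *\<^sub>T R (E a) (E 2) Z p
        + ?y 3 p *\<^sub>T R (E a) (E 3) Z p" for a
    proof -
      have "R (E a) (\<lambda>q. ?y 1 q *\<^sub>T E 1 q + ?y 2 q *\<^sub>T E 2 q + ?y 3 q *\<^sub>T E 3 q) Z p = R (E a) Y Z p"
        by (rule R_cong[OF U e Y Z refl y(4) refl])
      then show ?thesis
        unfolding R_add2[OF U e y(3) Z y(2)] R_add2[OF U e y(2) Z y(2)] R_scale2[OF U e e Z y(1)]
        by simp
    qed
    then show ?thesis
      unfolding ricci_frame[OF E Y Z] ricci_frame[OF E e Z]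
      by (simp add: sum_3 g_add_left g_scale_left tangent_intros et R_tangent[OF U e e Z])
         (simp add: algebra_simps)
  qed
  have lin2: "ricci A g Y Z p = (\<Sum>b\<in>UNIV. s b * g p (Z p) (E b p) * ricci A g Y (E b) p)"
    if Y: "Y \<in> vector_fields A U" and Z: "Z \<in> vector_fields A U" for Y Z
  proof -
    let ?y = "\<lambda>i q. s i * g q (Z q) (E i q)"
    note y = frame_field_expand[OF E(1) Z]
    have "R (E a) Y Z p = ?y 1 p *\<^sub>T R (E a) Y (E 1) p + ?y 2 p *\<^sub>T R (E a) Y (E 2) p
        + ?y 3 p *\<^sub>T R (E a) Y (E 3) p" for a
    proof -
      have "R (E a) Y (\<lambda>q. ?y 1 q *\<^sub>T E 1 q + ?y 2 q *\<^sub>T E 2 q + ?y 3 q *\<^sub>T E 3 q) p = R (E a) Y Z p"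
        by (rule R_cong[OF U e Y Z refl refl y(4)])
      then show ?thesis
        unfolding R_add3[OF U e Y y(3) y(2)] R_add3[OF U e Y y(2) y(2)] R_scale3[OF U e Y e y(1)]
        by simp
    qed
    then show ?thesis
      unfolding ricci_frame[OF E Y Z] ricci_frame[OF E Y e]
      by (simp add: sum_3 g_add_left g_scale_left tangent_intros et R_tangent[OF U e Y e])
         (simp add: algebra_simps)
  qed
  show ?thesis unfolding lin1[OF Y Z] lin2[OF e Z] ..
qed

text \<open>The inverse Gram matrix of the coordinate fields is
  \<open>\<Sum>a. s a * S a i * S a j\<close>, where \<open>S\<close> holds the frame components.
  Contracting it with the Ricci components undoes the change of basis.\<close>

lemma scalar_curvature_frame:
  assumes E: "orthonormal_frame A g s U E" "p \<in> U"
  shows "scalar_curvature A g p = (\<Sum>a\<in>UNIV. s a * ricci A g (E a) (E a) p)"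
proof -
  obtain V c where Vc: "chart_at A p = (V, c)" and ch: "(V, c) \<in> A" "p \<in> V"
    by (rule chart_at_cases)
  let ?W = "U \<inter> V" and ?d = "coord_field A (V, c)" and ?x = "\<lambda>i q. c q $ i"
  have W: "open ?W" "p \<in> ?W" using frame_open[OF E(1)] chart_open[OF ch(1)] E(2) ch(2) by auto
  have E': "orthonormal_frame A g s ?W E" by (rule frame_subset[OF E(1) W(1)]) simp
  have vd: "?d i \<in> vector_fields A ?W" for i using vf_subset[OF vf_coord[OF ch(1)]] by auto
  have d: "?d i p \<in> tangent_space A p" for i by (rule vf_tangent[OF vd W(2)])
  note e = frame_tangent[OF E]
  define S where "S a i = E a p (?x i)" for a i
  define N where "N i b = s b * g p (?d i p) (E b p)" for i b
  have SN: "(\<Sum>i\<in>UNIV. S a i * N i b) = (if a = b then 1 else 0)"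
    and NS: "(\<Sum>b\<in>UNIV. N i b * S b j) = (if i = j then 1 else 0)" for a b i j
    using frame_chart_matrices[OF E ch] unfolding S_def N_def by auto
  define r where "r b c = ricci A g (E b) (E c) p" for b c
  have ric: "ricci A g (?d i) (?d j) p = (\<Sum>b\<in>UNIV. N i b * (\<Sum>c\<in>UNIV. N j c * r b c))" for i j
    unfolding ricci_expand[OF E' W(2) vd vd] N_def r_def ..
  let ?G = "\<chi> i j. g p (?d i p) (?d j p)"
  let ?H = "\<chi> i j. \<Sum>a\<in>UNIV. s a * S a i * S a j"
  have gdd: "(\<Sum>j\<in>UNIV. g p (?d i p) (?d j p) * S a j) = s a * N i a" for i a
  proof -
    have "(\<Sum>j\<in>UNIV. g p (?d i p) (?d j p) * S a j) = g p (\<Sum>j\<in>UNIV. S a j *\<^sub>T ?d j p) (?d i p)"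
      by (simp add: g_sum_left g_scale_left tangent_scale d g_sym[OF d d] mult.commute)
    also have "(\<Sum>j\<in>UNIV. S a j *\<^sub>T ?d j p) = E a p"
      unfolding S_def by (rule tangent_expand_sum[OF ch e, symmetric])
    finally show ?thesis using sign[of a] by (simp add: N_def g_sym[OF e d] flip: mult.assoc)
  qed
  have "(\<Sum>j\<in>UNIV. g p (?d i p) (?d j p) * (\<Sum>a\<in>UNIV. s a * S a j * S a k)) = (if i = k then 1 else 0)"
    for i k
  proof -
    have "(\<Sum>j\<in>UNIV. g p (?d i p) (?d j p) * (\<Sum>a\<in>UNIV. s a * S a j * S a k))
        = (\<Sum>j\<in>UNIV. \<Sum>a\<in>UNIV. s a * S a k * (g p (?d i p) (?d j p) * S a j))"
      by (simp add: sum_distrib_left sum_distrib_right mult_ac)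
    also have "\<dots> = (\<Sum>a\<in>UNIV. s a * S a k * (\<Sum>j\<in>UNIV. g p (?d i p) (?d j p) * S a j))"
      by (subst sum.swap) (simp add: sum_distrib_left)
    also have "\<dots> = (\<Sum>a\<in>UNIV. (s a * s a) * (N i a * S a k))" unfolding gdd by (simp add: mult_ac)
    also have "\<dots> = (if i = k then 1 else 0)" by (simp add: sign NS)
    finally show ?thesis .
  qed
  then have GH: "?G ** ?H = mat 1" by (simp add: vec_eq_iff matrix_matrix_mult_def mat_def)
  then have "?H ** ?G = mat 1" using matrix_left_right_inverse by blast
  \<comment> \<open>\<open>matrix_inv\<close> is a choice too, so a two-sided inverse is exhibited
    before it is identified with \<open>?H\<close>.\<close>
  with GH have "\<exists>M. ?G ** M = mat 1 \<and> M ** ?G = mat 1" by blast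
  from someI_ex[OF this] have "matrix_inv ?G ** ?G = mat 1" unfolding matrix_inv_def ..
  then have "matrix_inv ?G ** (?G ** ?H) = ?H" by (simp add: matrix_mul_assoc)
  then have inv: "matrix_inv ?G = ?H" by (simp add: GH)
  have collapse: "(\<Sum>i\<in>UNIV. S a i * (\<Sum>b\<in>UNIV. N i b * z b)) = z a" for a z
  proof -
    have "(\<Sum>i\<in>UNIV. S a i * (\<Sum>b\<in>UNIV. N i b * z b)) = (\<Sum>b\<in>UNIV. (\<Sum>i\<in>UNIV. S a i * N i b) * z b)"
      by (simp add: sum_distrib_left sum_distrib_right mult.assoc) (rule sum.swap)
    then show ?thesis by (simp add: SN if_distrib[of "\<lambda>z. z * _"] cong: if_cong)
  qed
  have "scalar_curvature A g p
      = (\<Sum>i\<in>UNIV. \<Sum>j\<in>UNIV. (\<Sum>a\<in>UNIV. s a * S a i * S a j) * ricci A g (?d i) (?d j) p)"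
    by (simp add: scalar_curvature_def Let_def Vc inv)
  also have "\<dots> = (\<Sum>i\<in>UNIV. \<Sum>j\<in>UNIV. \<Sum>a\<in>UNIV. s a * (S a j * (S a i * ricci A g (?d i) (?d j) p)))"
    by (simp add: sum_distrib_right mult_ac)
  also have "\<dots> = (\<Sum>j\<in>UNIV. \<Sum>i\<in>UNIV. \<Sum>a\<in>UNIV. s a * (S a j * (S a i * ricci A g (?d i) (?d j) p)))"
    by (rule sum.swap)
  also have "\<dots> = (\<Sum>j\<in>UNIV. \<Sum>a\<in>UNIV. \<Sum>i\<in>UNIV. s a * (S a j * (S a i * ricci A g (?d i) (?d j) p)))"
    by (intro sum.cong refl sum.swap)
  also have "\<dots> = (\<Sum>a\<in>UNIV. \<Sum>j\<in>UNIV. \<Sum>i\<in>UNIV. s a * (S a j * (S a i * ricci A g (?d i) (?d j) p)))"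
    by (rule sum.swap)
  also have "\<dots> = (\<Sum>a\<in>UNIV. s a * (\<Sum>j\<in>UNIV. S a j * (\<Sum>i\<in>UNIV. S a i * ricci A g (?d i) (?d j) p)))"
    by (simp only: sum_distrib_left)
  also have "\<dots> = (\<Sum>a\<in>UNIV. s a * r a a)"
    unfolding ric collapse ..
  finally show ?thesis by (simp add: r_def)
qed

end

context manifold
begin

section \<open>The Jacobi identity\<close>

lemma tangent_apply_minus:
  assumes "v \<in> tangent_space A p" "smooth_near A p f"
  shows "v (\<lambda>q. - f q) = - v f"
  using tangent_apply_mult[OF assms(1) _ assms(2), of "\<lambda>q. - 1"] tangent_apply_const[OF assms(1)]
    smooth_nearI[OF open_UNIV _ smooth_fun_const[OF open_UNIV], of p "- 1"]
  by simp

lemma tangent_apply_diff: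
  assumes v: "v \<in> tangent_space A p" and f: "smooth_near A p f" and h: "smooth_near A p h"
  shows "v (\<lambda>q. f q - h q) = v f - v h"
proof -
  obtain W where W: "open W" "p \<in> W" "smooth_fun A W h" using h unfolding smooth_near_def by blast
  have "smooth_near A p (\<lambda>q. - h q)" using W by (intro smooth_nearI[of W] smooth_fun_minus)
  from tangent_apply_add[OF v f this] show ?thesis using tangent_apply_minus[OF v h] by simp
qed

text \<open>Written as a Leibniz rule for the bracket with X, the form in which it is applied to
  \<xi>. On a function both sides expand into third-order words in X, Y, Z, which match.\<close>

lemma jacobi_identity:
  assumes X: "X \<in> vector_fields A U" and Y: "Y \<in> vector_fields A U" and Z: "Z \<in> vector_fields A U"
    and U: "open U" "p \<in> U"
  shows "lie_bracket A X (lie_bracket A Y Z) p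
    = lie_bracket A (lie_bracket A X Y) Z p + lie_bracket A Y (lie_bracket A X Z) p"
proof
  fix f
  show "lie_bracket A X (lie_bracket A Y Z) p f
    = (lie_bracket A (lie_bracket A X Y) Z p + lie_bracket A Y (lie_bracket A X Z) p) f"
  proof (cases "smooth_near A p f")
    case True
    obtain W where W: "open W" "p \<in> W" "W \<subseteq> U" "smooth_fun A W f" using smooth_nearE[OF True U] .
    have step: "P p (\<lambda>q. lie_bracket A Q S q f) = P p (\<lambda>q. Q q (\<lambda>r. S r f)) - P p (\<lambda>q. S q (\<lambda>r. Q r f))"
      "smooth_near A p (\<lambda>q. Q q f)"
      if P: "P \<in> vector_fields A U" and Q: "Q \<in> vector_fields A U" and S: "S \<in> vector_fields A U"
      for P Q S
    proof -
      note Pp = vf_tangent[OF P U(2)]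
      have s: "smooth_fun A W (\<lambda>q. Q q f)" "smooth_fun A W (\<lambda>q. S q f)"
        using vf_smooth[OF Q W(1,3,4)] vf_smooth[OF S W(1,3,4)] by auto
      have "P p (\<lambda>q. lie_bracket A Q S q f) = P p (\<lambda>q. Q q (\<lambda>r. S r f) - S q (\<lambda>r. Q r f))"
        by (rule tangent_cong[OF Pp W(1,2)]) (simp add: bracket_apply smooth_nearI[OF W(1) _ W(4)])
      also have "\<dots> = P p (\<lambda>q. Q q (\<lambda>r. S r f)) - P p (\<lambda>q. S q (\<lambda>r. Q r f))"
        by (intro tangent_apply_diff[OF Pp] smooth_nearI[OF W(1,2)] vf_smooth[OF Q W(1,3)]
            vf_smooth[OF S W(1,3)] s)
      finally show "P p (\<lambda>q. lie_bracket A Q S q f)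
        = P p (\<lambda>q. Q q (\<lambda>r. S r f)) - P p (\<lambda>q. S q (\<lambda>r. Q r f))" .
      show "smooth_near A p (\<lambda>q. Q q f)" by (rule smooth_nearI[OF W(1,2) s(1)])
    qed
    show ?thesis
      using step(1)[OF X Y Z] step(1)[OF Z X Y] step(1)[OF Y X Z]
      by (simp add: bracket_apply True step(2)[OF X X X] step(2)[OF Y Y Y] step(2)[OF Z Z Z])
  qed (simp add: lie_bracket_def)
qed

end

section \<open>Structure functions, connection coefficients and Ricci components\<close>

context framed_manifold
begin

text \<open>The coefficient of \<open>E k\<close> in the bracket of \<open>E i\<close> and
  \<open>E j\<close>; the sign raises the last index.\<close>

definition bcoef :: "(3 \<Rightarrow> 'a vfield) \<Rightarrow> 3 \<Rightarrow> 3 \<Rightarrow> 3 \<Rightarrow> 'a \<Rightarrow> real" where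
  "bcoef E i j k q = s k * g q (lie_bracket A (E i) (E j) q) (E k q)"

text \<open>The coefficient of \<open>E k\<close> in the covariant derivative of \<open>E j\<close>
  along \<open>E i\<close>.\<close>

definition ccoef :: "(3 \<Rightarrow> 'a vfield) \<Rightarrow> 3 \<Rightarrow> 3 \<Rightarrow> 3 \<Rightarrow> 'a \<Rightarrow> real" where
  "ccoef E i j k q = s k * koszul (E i) (E j) (E k) q"

context
  fixes U E
  assumes E: "orthonormal_frame A g s U E"
begin

private lemmas U = frame_open[OF E]
private lemmas e = frame_vf[OF E]
private lemmas et = frame_tangent[OF E]

lemma bcoef_smooth: "smooth_fun A U (bcoef E i j k)"
proof -
  have "smooth_fun A U (\<lambda>q. s k * g q (lie_bracket A (E i) (E j) q) (E k q))"
    by (intro smooth_fun_intros g_smooth vf_bracket U e)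
  then show ?thesis by (simp add: bcoef_def[abs_def])
qed

lemma ccoef_smooth: "smooth_fun A U (ccoef E i j k)"
proof -
  have "smooth_fun A U (\<lambda>q. s k * koszul (E i) (E j) (E k) q)"
    by (intro smooth_fun_mult smooth_fun_const U koszul_smooth e)
  then show ?thesis by (simp add: ccoef_def[abs_def])
qed

lemma bracket_frame:
  "p \<in> U \<Longrightarrow> lie_bracket A (E i) (E j) p = (\<Sum>k\<in>UNIV. bcoef E i j k p *\<^sub>T E k p)"
  unfolding bcoef_def by (rule frame_expand[OF E _ bracket_tangent[OF e e U]])

lemma lc_frame_fields: "p \<in> U \<Longrightarrow> LC (E i) (E j) p = (\<Sum>k\<in>UNIV. ccoef E i j k p *\<^sub>T E k p)"
  unfolding ccoef_def by (rule lc_frame[OF E _ e e])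

lemma frame_component: "p \<in> U \<Longrightarrow> s l * g p (\<Sum>k\<in>UNIV. x k *\<^sub>T E k p) (E l p) = x l"
  using sign[of l]
  by (simp add: g_sum_left g_scale_left tangent_scale et frame_g[OF E] if_distrib mult.commute
      mult.assoc cong: if_cong)

text \<open>Inner products of frame fields are constant, so the derivative terms of the Koszul
  expression vanish and the connection is algebraic in the brackets.\<close>

lemma ccoef_bcoef:
  assumes p: "p \<in> U"
  shows "ccoef E i j k p
    = (bcoef E i j k p - s j * s k * bcoef E i k j p - s i * s k * bcoef E j k i p) / 2"
proof -
  have 0: "v (\<lambda>q. g q (E a q) (E b q)) = 0" if v: "v \<in> tangent_space A p" for v a b
  proof -
    have "v (\<lambda>q. g q (E a q) (E b q)) = v (\<lambda>q. if a = b then s a else 0)"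
      by (rule tangent_cong[OF v U p]) (rule frame_g[OF E])
    also have "\<dots> = 0" by (rule tangent_apply_const[OF v])
    finally show ?thesis .
  qed
  have ss: "s a * (s a * x) = x" for a x using sign[of a] by (simp flip: mult.assoc)
  show ?thesis
    unfolding ccoef_def koszul_def bcoef_def 0[OF et[OF p]]
    by (simp add: field_simps ss)
qed

lemma lc_field_sum:
  assumes f: "\<And>l. smooth_fun A U (f l)" and p: "p \<in> U"
  shows "LC (E i) (\<lambda>q. \<Sum>l\<in>UNIV. f l q *\<^sub>T E l q) p
    = (\<Sum>k\<in>UNIV. (E i p (f k) + (\<Sum>l\<in>UNIV. f l p * ccoef E i l k p)) *\<^sub>T E k p)"
proof -
  note v = vf_scale[OF e f]
  show ?thesis
    unfolding sum_3 lc_add2[OF U e vf_add[OF v v] v p] lc_add2[OF U e v v p]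
      lc_scale2[OF U e e f p] lc_frame_fields[OF p]
    by (simp add: fun_eq_iff tv_scale_apply algebra_simps)
qed

lemma lc_bracket_frame:
  assumes p: "p \<in> U"
  shows "LC (lie_bracket A (E i) (E j)) (E d) p
    = (\<Sum>k\<in>UNIV. (\<Sum>m\<in>UNIV. bcoef E i j m p * ccoef E m d k p) *\<^sub>T E k p)"
proof -
  note v = vf_scale[OF e bcoef_smooth]
  have "LC (lie_bracket A (E i) (E j)) (E d) p
      = LC (\<lambda>q. bcoef E i j 1 q *\<^sub>T E 1 q + bcoef E i j 2 q *\<^sub>T E 2 q + bcoef E i j 3 q *\<^sub>T E 3 q) (E d) p"
    by (rule lc_cong[OF U p vf_add[OF vf_add[OF v v] v] e _ refl]) (simp only: bracket_frame sum_3)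
  also have "\<dots> = (\<Sum>k\<in>UNIV. (\<Sum>m\<in>UNIV. bcoef E i j m p * ccoef E m d k p) *\<^sub>T E k p)"
    unfolding lc_add1[OF U vf_add[OF v v] e v p] lc_add1[OF U v e v p]
      lc_scale1[OF U e e bcoef_smooth p] lc_frame_fields[OF p] sum_3
    by (simp add: fun_eq_iff tv_scale_apply algebra_simps)
  finally show ?thesis .
qed

lemma curvature_component:
  assumes p: "p \<in> U"
  shows "s k * g p (R (E i) (E j) (E d) p) (E k p)
    = E i p (ccoef E j d k) + (\<Sum>l\<in>UNIV. ccoef E j d l p * ccoef E i l k p)
      - E j p (ccoef E i d k) - (\<Sum>l\<in>UNIV. ccoef E i d l p * ccoef E j l k p)
      - (\<Sum>m\<in>UNIV. bcoef E i j m p * ccoef E m d k p)"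
proof -
  have 1: "LC (E i) (LC (E j) (E d)) p
      = (\<Sum>k\<in>UNIV. (E i p (ccoef E j d k) + (\<Sum>l\<in>UNIV. ccoef E j d l p * ccoef E i l k p)) *\<^sub>T E k p)"
    for i j
  proof -
    have "LC (E i) (LC (E j) (E d)) p = LC (E i) (\<lambda>q. \<Sum>l\<in>UNIV. ccoef E j d l q *\<^sub>T E l q) p"
      by (rule lc_cong[OF U p e vf_sum[OF vf_scale[OF e ccoef_smooth]] refl]) (rule lc_frame_fields)
    then show ?thesis by (simp only: lc_field_sum[OF ccoef_smooth p])
  qed
  have "R (E i) (E j) (E d) p = (\<Sum>k\<in>UNIV.
      (E i p (ccoef E j d k) + (\<Sum>l\<in>UNIV. ccoef E j d l p * ccoef E i l k p)
      - E j p (ccoef E i d k) - (\<Sum>l\<in>UNIV. ccoef E i d l p * ccoef E j l k p)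
      - (\<Sum>m\<in>UNIV. bcoef E i j m p * ccoef E m d k p)) *\<^sub>T E k p)"
    unfolding curvature_LC 1 lc_bracket_frame[OF p]
    by (simp add: sum_3 fun_eq_iff tv_scale_apply algebra_simps)
  then show ?thesis by (simp only: frame_component[OF p])
qed

lemma ricci_components:
  assumes p: "p \<in> U"
  shows "ricci A g (E b) (E d) p = (\<Sum>a\<in>UNIV.
      E a p (ccoef E b d a) + (\<Sum>l\<in>UNIV. ccoef E b d l p * ccoef E a l a p)
      - E b p (ccoef E a d a) - (\<Sum>l\<in>UNIV. ccoef E a d l p * ccoef E b l a p)
      - (\<Sum>m\<in>UNIV. bcoef E a b m p * ccoef E m d a p))"
  unfolding ricci_frame[OF E p e e] curvature_component[OF p] ..

end

end

section \<open>Paracontact metric structures\<close>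

locale paracontact = manifold A
  for A :: "('a::{t2_space,second_countable_topology}) atlas" +
  fixes \<phi> :: "'a \<Rightarrow> 'a tvec \<Rightarrow> 'a tvec" and \<xi> :: "'a vfield"
    and \<eta> :: "'a \<Rightarrow> 'a tvec \<Rightarrow> real" and g :: "'a metric_field"
  assumes paracontact: "paracontact_metric A \<phi> \<xi> \<eta> g"
begin

sublocale pseudo_riemannian A g
  by unfold_locales (use paracontact in \<open>simp add: paracontact_metric_def\<close>)

lemma almost: "almost_paracontact A \<phi> \<xi> \<eta>"
  using paracontact by (simp add: paracontact_metric_def)

lemma phi_tangent: "v \<in> tangent_space A p \<Longrightarrow> \<phi> p v \<in> tangent_space A p"
  using almost unfolding almost_paracontact_def endomorphism_field_def by (elim conjE) simp

lemma phi_vf: "X \<in> vector_fields A U \<Longrightarrow> open U \<Longrightarrow> (\<lambda>p. \<phi> p (X p)) \<in> vector_fields A U"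
  using almost unfolding almost_paracontact_def endomorphism_field_def by (elim conjE) simp

lemma
  assumes "v \<in> tangent_space A p"
  shows eta_scale: "\<eta> p (r *\<^sub>T v) = r * \<eta> p v"
    and eta_add: "w \<in> tangent_space A p \<Longrightarrow> \<eta> p (v + w) = \<eta> p v + \<eta> p w"
proof -
  have lin: "\<eta> p (r *\<^sub>T v + t *\<^sub>T w) = r * \<eta> p v + t * \<eta> p w"
    if "v \<in> tangent_space A p" "w \<in> tangent_space A p" for v w r t
    using almost that unfolding almost_paracontact_def one_form_def by (elim conjE) simp
  show "\<eta> p (v + w) = \<eta> p v + \<eta> p w" if "w \<in> tangent_space A p"
    using lin[OF assms that, of 1 1] by simp
  have "r *\<^sub>T v = r *\<^sub>T v + 0 *\<^sub>T v" by (simp add: tv_scale_def fun_eq_iff)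
  then show "\<eta> p (r *\<^sub>T v) = r * \<eta> p v" using lin[OF assms assms, of r 0] by simp
qed

lemma xi_vf: "\<xi> \<in> vector_fields A U"
  using almost vf_subset[of \<xi> UNIV U] unfolding almost_paracontact_def by (elim conjE) simp

lemma xi_tangent: "\<xi> p \<in> tangent_space A p"
  using vf_tangent[OF xi_vf[of UNIV]] by simp

lemma phi_xi: "\<phi> p (\<xi> p) = 0" and eta_xi: "\<eta> p (\<xi> p) = 1"
  using almost unfolding almost_paracontact_def by (elim conjE, simp)+

lemma
  assumes "v \<in> tangent_space A p"
  shows eta_phi: "\<eta> p (\<phi> p v) = 0" and phi_phi: "\<phi> p (\<phi> p v) = v - \<eta> p v *\<^sub>T \<xi> p"
  using almost assms unfolding almost_paracontact_def by (elim conjE, simp)+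

lemma g_phi_phi:
  "v \<in> tangent_space A p \<Longrightarrow> w \<in> tangent_space A p \<Longrightarrow>
    g p (\<phi> p v) (\<phi> p w) = - g p v w + \<eta> p v * \<eta> p w"
  using paracontact unfolding paracontact_metric_def by (elim conjE) simp

lemma d_eta:
  "open U \<Longrightarrow> X \<in> vector_fields A U \<Longrightarrow> Y \<in> vector_fields A U \<Longrightarrow> p \<in> U \<Longrightarrow>
    exterior_derivative A \<eta> X Y p = g p (X p) (\<phi> p (Y p))"
  using paracontact unfolding paracontact_metric_def by (elim conjE) simp

text \<open>Compatibility with \<xi> in one argument: its left-hand side vanishes because \<phi>
  annihilates \<xi>.\<close>

lemma g_xi: "v \<in> tangent_space A p \<Longrightarrow> g p (\<xi> p) v = \<eta> p v"
  using g_phi_phi[OF xi_tangent, of v p] by (simp add: phi_xi eta_xi g_zero_left phi_tangent)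

lemma g_xi': "v \<in> tangent_space A p \<Longrightarrow> g p v (\<xi> p) = \<eta> p v"
  using g_xi g_sym[OF _ xi_tangent] by simp

text \<open>Compatibility for the pair v, \<phi> v, where \<phi>^2 v differs from v by a multiple of
  \<xi>, yields g(v, \<phi> v) = - g(v, \<phi> v).\<close>

lemma g_phi_self: "v \<in> tangent_space A p \<Longrightarrow> g p v (\<phi> p v) = 0"
  using g_phi_phi[of v p "\<phi> p v"] phi_phi[of v p] g_sym[of v p "\<phi> p v"]
    g_diff_left[of v p "\<eta> p v *\<^sub>T \<xi> p" "\<phi> p v"] g_sym[of "\<phi> p v" p "v - \<eta> p v *\<^sub>T \<xi> p"]
  by (simp add: phi_tangent eta_phi g_scale_left xi_tangent g_xi tangent_intros)

text \<open>On ker \<eta> the map \<phi> reverses the sign of g(v, v). Without a spacelike vector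
  there, all of ker \<eta> would be null, polarisation would make g vanish on it, and nondegeneracy
  would leave a tangent space spanned by \<xi>.\<close>

lemma ex_spacelike: "\<exists>v\<in>tangent_space A p. \<eta> p v = 0 \<and> g p v v > 0"
proof (rule ccontr)
  assume no: "\<not> ?thesis"
  have neg: "g p v v \<le> 0" if "v \<in> tangent_space A p" "\<eta> p v = 0" for v
    using no that linorder_not_le by blast
  have null: "g p v v = 0" if v: "v \<in> tangent_space A p" "\<eta> p v = 0" for v
    using neg[OF v] neg[OF phi_tangent[OF v(1)] eta_phi[OF v(1)]] g_phi_phi[OF v(1) v(1)] v(2) by simp
  have orth: "g p v w = 0"
    if v: "v \<in> tangent_space A p" "\<eta> p v = 0" and w: "w \<in> tangent_space A p" "\<eta> p w = 0" for v w
    using null[OF tangent_add[OF v(1) w(1)]] null[OF v] null[OF w] v w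
    by (simp add: eta_add g_add_left g_add_right tangent_add g_sym[OF w(1) v(1)])
  have ker: "v = \<eta> p v *\<^sub>T \<xi> p" if v: "v \<in> tangent_space A p" for v
  proof -
    have pr: "u - \<eta> p u *\<^sub>T \<xi> p \<in> tangent_space A p" "\<eta> p (u - \<eta> p u *\<^sub>T \<xi> p) = 0"
      if "u \<in> tangent_space A p" for u
      using that eta_phi[OF phi_tangent[OF that]] phi_phi[OF that]
      by (simp_all add: tangent_intros xi_tangent)
    have "v - \<eta> p v *\<^sub>T \<xi> p = 0"
    proof (rule g_nondegenerate[OF pr(1)[OF v]])
      fix w assume w: "w \<in> tangent_space A p"
      have "g p (v - \<eta> p v *\<^sub>T \<xi> p) w
          = g p (v - \<eta> p v *\<^sub>T \<xi> p) ((w - \<eta> p w *\<^sub>T \<xi> p) + \<eta> p w *\<^sub>T \<xi> p)" by simp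
      also have "\<dots> = g p (v - \<eta> p v *\<^sub>T \<xi> p) (w - \<eta> p w *\<^sub>T \<xi> p)
          + \<eta> p w * g p (v - \<eta> p v *\<^sub>T \<xi> p) (\<xi> p)"
        by (simp only: g_add_right[OF pr(1)[OF v] pr(1)[OF w] tangent_scale[OF xi_tangent]]
            g_scale_right[OF pr(1)[OF v] xi_tangent])
      also have "\<dots> = 0"
        using orth[OF pr[OF v] pr[OF w]] g_xi'[OF pr(1)[OF v]] pr(2)[OF v] by simp
      finally show "g p (v - \<eta> p v *\<^sub>T \<xi> p) w = 0" .
    qed
    then show ?thesis by simp
  qed
  obtain V c where ch: "(V, c) \<in> A" "p \<in> V" by (rule ex_chart)
  have t: "coord_field A (V, c) i p \<in> tangent_space A p" for i
    by (rule vf_tangent[OF vf_coord ch(2)]) (rule ch)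
  \<comment> \<open>The identity matrix would be a product of a column and a row; its entries (1,1),
    (1,2), (2,2) already contradict this.\<close>
  have "coord_field A (V, c) i p (\<lambda>q. c q $ j)
      = \<eta> p (coord_field A (V, c) i p) * \<xi> p (\<lambda>q. c q $ j)" for i j
    using fun_cong[OF ker[OF t], of i "\<lambda>q. c q $ j"] by (simp only: tv_scale_apply)
  from this[of 1 1] this[of 1 2] this[of 2 2] show False
    by (auto simp: coord_field_coord[OF ch])
qed

lemma ex_phi_basis: "\<exists>U e. p \<in> U \<and> phi_basis A \<phi> \<xi> g U e"
proof -
  obtain v where v: "v \<in> tangent_space A p" "\<eta> p v = 0" "g p v v > 0" using ex_spacelike by blast
  obtain W Z where W: "open W" "p \<in> W" and Z: "Z \<in> vector_fields A W" "Z p = v"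
    using tangent_extend[OF v(1) open_UNIV UNIV_I] by blast
  \<comment> \<open>The projection to ker \<eta> equals \<phi>^2, which gives both its smoothness
    and \<eta>(X) = 0. It fixes \<open>v\<close> at \<open>p\<close>, so the square norm of X is
    positive near \<open>p\<close> and X can be normalised there.\<close>
  define X where "X q = Z q - \<eta> q (Z q) *\<^sub>T \<xi> q" for q
  have Xphi: "X q = \<phi> q (\<phi> q (Z q))" if "q \<in> W" for q
    using phi_phi[OF vf_tangent[OF Z(1) that]] by (simp add: X_def)
  have "0 *\<^sub>T \<xi> p = 0" by (simp add: fun_eq_iff tv_scale_apply)
  then have Xp: "X p = v" using v Z(2) by (simp add: X_def)
  have X: "X \<in> vector_fields A W"
    by (rule vf_cong[OF phi_vf[OF phi_vf[OF Z(1) W(1)] W(1)]]) (rule Xphi)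
  define N where "N q = g q (X q) (X q)" for q
  have N: "smooth_fun A W N" using g_smooth[OF X X W(1)] by (simp add: N_def[abs_def])
  define U where "U = {q\<in>W. N q > 0}"
  have "open (N -` {0<..} \<inter> W)"
    using continuous_on_open_vimage[OF W(1)] continuous_on_smooth_fun[OF W(1) N]
    by (metis open_greaterThan)
  moreover have "N -` {0<..} \<inter> W = U" by (auto simp: U_def)
  ultimately have U: "open U" by simp
  have UW: "U \<subseteq> W" by (auto simp: U_def)
  have pU: "p \<in> U" using v(3) W(2) by (simp add: U_def N_def Xp)
  define e where "e q = inverse (sqrt (N q)) *\<^sub>T X q" for q
  have "smooth_fun A U (\<lambda>q. inverse (sqrt (N q)))"
    by (intro smooth_fun_inverse smooth_fun_sqrt U smooth_fun_subset[OF N UW]) (auto simp: U_def)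
  then have e: "e \<in> vector_fields A U"
    unfolding e_def[abs_def] by (rule vf_scale[OF vf_subset[OF X UW]])
  have "phi_basis A \<phi> \<xi> g U e"
    unfolding phi_basis_def
  proof (intro conjI ballI)
    fix q assume q: "q \<in> U"
    have Xt: "X q \<in> tangent_space A q" using vf_tangent[OF X] q UW by blast
    have eX: "\<eta> q (X q) = 0" using Xphi eta_phi phi_tangent vf_tangent[OF Z(1)] q UW by auto
    have et: "e q \<in> tangent_space A q" using vf_tangent[OF e q] .
    have ee: "\<eta> q (e q) = 0" by (simp add: e_def eta_scale[OF Xt] eX)
    have Nq: "N q > 0" using q by (simp add: U_def)
    have "g q (e q) (e q) = inverse (sqrt (N q)) * (inverse (sqrt (N q)) * N q)"
      by (simp add: e_def g_scale_left g_scale_right Xt tangent_scale N_def)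
    also have "\<dots> = N q / (sqrt (N q) * sqrt (N q))" by (simp add: field_simps)
    also have "\<dots> = 1" using Nq by simp
    finally show gee: "g q (e q) (e q) = 1" .
    show "g q (\<xi> q) (\<xi> q) = 1" by (simp add: g_xi xi_tangent eta_xi)
    show "g q (\<phi> q (e q)) (\<phi> q (e q)) = - 1" by (simp add: g_phi_phi et gee ee)
    show "g q (\<xi> q) (e q) = 0" by (simp add: g_xi et ee)
    show "g q (\<xi> q) (\<phi> q (e q)) = 0" by (simp add: g_xi et phi_tangent eta_phi)
    show "g q (e q) (\<phi> q (e q)) = 0" by (rule g_phi_self[OF et])
  qed (use U e in auto)
  with pU show ?thesis by blast
qed

section \<open>\<phi>-bases as frames, and brackets under the contact form\<close>

definition frame :: "'a vfield \<Rightarrow> 3 \<Rightarrow> 'a vfield" where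
  "frame e i = (if i = 1 then \<xi> else if i = 2 then e else (\<lambda>q. \<phi> q (e q)))"

definition sign3 :: "3 \<Rightarrow> real" where
  "sign3 i = (if i = 3 then - 1 else 1)"

lemma frame_simps [simp]: "frame e 1 = \<xi>" "frame e 2 = e" "frame e 3 = (\<lambda>q. \<phi> q (e q))"
  by (simp_all add: frame_def)

lemma sign3_simps [simp]: "sign3 1 = 1" "sign3 2 = 1" "sign3 3 = - 1"
  by (simp_all add: sign3_def)

lemma phi_basis_frame:
  assumes "phi_basis A \<phi> \<xi> g U e"
  shows "orthonormal_frame A g sign3 U (frame e)"
proof -
  have U: "open U" and e: "e \<in> vector_fields A U" using assms by (auto simp: phi_basis_def)
  have "frame e i \<in> vector_fields A U" for i
    using xi_vf e phi_vf[OF e U] by (simp add: frame_def)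
  moreover have "g p (frame e i p) (frame e j p) = (if i = j then sign3 i else 0)" if p: "p \<in> U" for p i j
  proof -
    have "g p (\<xi> p) (\<xi> p) = 1 \<and> g p (e p) (e p) = 1 \<and> g p (\<phi> p (e p)) (\<phi> p (e p)) = - 1 \<and>
        g p (\<xi> p) (e p) = 0 \<and> g p (\<xi> p) (\<phi> p (e p)) = 0 \<and> g p (e p) (\<phi> p (e p)) = 0"
      using assms p by (simp add: phi_basis_def)
    moreover have "e p \<in> tangent_space A p" by (rule vf_tangent[OF e p])
    ultimately show ?thesis
      using exhaust_3[of i] exhaust_3[of j]
      by (auto simp: g_sym[of "e p" p "\<xi> p"] g_sym[of "\<phi> p (e p)" p "\<xi> p"] g_sym[of "\<phi> p (e p)" p "e p"]
          xi_tangent phi_tangent)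
  qed
  ultimately show ?thesis using U by (simp add: orthonormal_frame_def)
qed

sublocale framed_manifold A g sign3
proof unfold_locales
  show "sign3 i * sign3 i = 1" for i by (simp add: sign3_def)
  show "\<exists>U E. p \<in> U \<and> orthonormal_frame A g sign3 U E" for p
    using ex_phi_basis[of p] phi_basis_frame by blast
qed

text \<open>Here d\<eta>(\<xi>, X) = g(\<xi>, \<phi> X) = \<eta>(\<phi> X) = 0, and the derivative
  terms vanish for constant \<eta>(X), so the bracket term is 0 as well. The case of a nonzero
  constant serves X = [e, \<phi>e].\<close>

lemma eta_bracket_xi:
  assumes U: "open U" "p \<in> U" and X: "X \<in> vector_fields A U" and h: "\<And>q. q \<in> U \<Longrightarrow> \<eta> q (X q) = h"
  shows "\<eta> p (lie_bracket A \<xi> X p) = 0"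
proof -
  have "exterior_derivative A \<eta> \<xi> X p = 0"
    by (simp add: d_eta[OF U(1) xi_vf X U(2)] g_xi phi_tangent eta_phi vf_tangent[OF X U(2)])
  moreover have "\<xi> p (\<lambda>q. \<eta> q (X q)) = \<xi> p (\<lambda>q. h)"
    by (rule tangent_cong[OF xi_tangent U h])
  ultimately show ?thesis
    by (simp add: exterior_derivative_def eta_xi tangent_apply_const[OF xi_tangent]
        tangent_apply_const[OF vf_tangent[OF X U(2)]])
qed

text \<open>The factor -2 undoes the 1/2 in the convention for d\<eta>.\<close>

lemma eta_bracket_horizontal:
  assumes U: "open U" "p \<in> U" and X: "X \<in> vector_fields A U" and Y: "Y \<in> vector_fields A U"
    and 0: "\<And>q. q \<in> U \<Longrightarrow> \<eta> q (X q) = 0" "\<And>q. q \<in> U \<Longrightarrow> \<eta> q (Y q) = 0"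
  shows "\<eta> p (lie_bracket A X Y p) = - 2 * g p (X p) (\<phi> p (Y p))"
proof -
  note t = vf_tangent[OF X U(2)] vf_tangent[OF Y U(2)]
  have "X p (\<lambda>q. \<eta> q (Y q)) = X p (\<lambda>q. 0)" by (rule tangent_cong[OF t(1) U 0(2)])
  moreover have "Y p (\<lambda>q. \<eta> q (X q)) = Y p (\<lambda>q. 0)" by (rule tangent_cong[OF t(2) U 0(1)])
  ultimately show ?thesis
    using d_eta[OF U(1) X Y U(2)] tangent_apply_const[OF t(1)] tangent_apply_const[OF t(2)]
    by (simp add: exterior_derivative_def)
qed

lemma g_phi_skew:
  assumes v: "v \<in> tangent_space A p" and w: "w \<in> tangent_space A p"
  shows "g p v (\<phi> p w) = - g p (\<phi> p v) w"
proof -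
  have "g p (\<phi> p v) (\<phi> p (\<phi> p w)) = g p (\<phi> p v) w"
    using phi_phi[OF w] v w
      g_add_right[of "\<phi> p v" p "w - \<eta> p w *\<^sub>T \<xi> p" "\<eta> p w *\<^sub>T \<xi> p"]
    by (simp add: phi_tangent tangent_intros xi_tangent g_scale_right g_xi' eta_phi)
  then show ?thesis using g_phi_phi[OF v phi_tangent[OF w]] eta_phi[OF w] by simp
qed

end

locale phi_frame = paracontact A \<phi> \<xi> \<eta> g
  for A :: "('a::{t2_space,second_countable_topology}) atlas" and \<phi> \<xi> \<eta> g +
  fixes U :: "'a set" and e :: "'a vfield"
  assumes basis: "phi_basis A \<phi> \<xi> g U e"
begin

abbreviation \<phi>e :: "'a vfield" where "\<phi>e \<equiv> \<lambda>q. \<phi> q (e q)"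

lemmas basis_frame = phi_basis_frame[OF basis]
lemmas basis_open = frame_open[OF basis_frame]

lemma e_vf: "e \<in> vector_fields A U"
  using basis by (simp add: phi_basis_def)

lemma phie_vf: "\<phi>e \<in> vector_fields A U"
  by (rule phi_vf[OF e_vf basis_open])

lemma basis_tangent:
  assumes "p \<in> U" shows "e p \<in> tangent_space A p" "\<phi> p (e p) \<in> tangent_space A p"
  using vf_tangent[OF e_vf assms] phi_tangent by auto

lemma eta_basis: assumes "p \<in> U" shows "\<eta> p (e p) = 0" "\<eta> p (\<phi> p (e p)) = 0"
  using g_xi[OF basis_tangent(1)[OF assms]] basis assms eta_phi[OF basis_tangent(1)[OF assms]]
  by (auto simp: phi_basis_def)

lemma eta_bracket:
  assumes p: "p \<in> U"
  shows "\<eta> p (lie_bracket A \<xi> e p) = 0" "\<eta> p (lie_bracket A \<xi> \<phi>e p) = 0"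
    "\<eta> p (lie_bracket A e \<phi>e p) = - 2"
proof -
  show "\<eta> p (lie_bracket A \<xi> e p) = 0" "\<eta> p (lie_bracket A \<xi> \<phi>e p) = 0"
    using eta_bracket_xi[OF basis_open p] e_vf phie_vf eta_basis by auto
  have "0 *\<^sub>T \<xi> p = 0" by (simp add: fun_eq_iff tv_scale_apply)
  then show "\<eta> p (lie_bracket A e \<phi>e p) = - 2"
    using eta_bracket_horizontal[OF basis_open p e_vf phie_vf] basis p eta_basis
      phi_phi[OF basis_tangent(1)[OF p]]
    by (simp add: phi_basis_def)
qed

text \<open>The \<open>\<xi>\<close>-component of the Jacobi identity: the Lie derivative of \<open>\<phi>\<close> along \<open>\<xi>\<close> is trace-free.\<close>

lemma bracket_trace_free:
  assumes p: "p \<in> U"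
  shows "g p (lie_bracket A \<xi> e p) (e p) = g p (lie_bracket A \<xi> \<phi>e p) (\<phi> p (e p))"
proof -
  have vf: "lie_bracket A \<xi> e \<in> vector_fields A U" "lie_bracket A \<xi> \<phi>e \<in> vector_fields A U"
    "lie_bracket A e \<phi>e \<in> vector_fields A U"
    by (intro vf_bracket xi_vf e_vf phie_vf basis_open)+
  note t = vf_tangent[OF vf(1) p] vf_tangent[OF vf(2) p] basis_tangent[OF p]
  have "0 *\<^sub>T \<xi> p = 0" by (simp add: fun_eq_iff tv_scale_apply)
  then have ppe: "\<phi> p (\<phi> p (e p)) = e p"
    using phi_phi[OF t(3)] eta_basis[OF p] by simp
  \<comment> \<open>\<eta>([e, \<phi>e]) is the constant -2, so the bracket of \<xi> with this field
    is horizontal.\<close>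
  have "0 = \<eta> p (lie_bracket A \<xi> (lie_bracket A e \<phi>e) p)"
    by (rule eta_bracket_xi[OF basis_open p vf(3) eta_bracket(3), symmetric])
  also have "\<dots> = \<eta> p (lie_bracket A (lie_bracket A \<xi> e) \<phi>e p)
      + \<eta> p (lie_bracket A e (lie_bracket A \<xi> \<phi>e) p)"
    unfolding jacobi_identity[OF xi_vf e_vf phie_vf basis_open p]
    by (intro eta_add bracket_tangent[OF _ _ basis_open p] vf e_vf phie_vf)
  also have "\<dots> = - 2 * g p (lie_bracket A \<xi> e p) (\<phi> p (\<phi> p (e p)))
      - 2 * g p (e p) (\<phi> p (lie_bracket A \<xi> \<phi>e p))"
    using eta_bracket_horizontal[OF basis_open p vf(1) phie_vf]
      eta_bracket_horizontal[OF basis_open p e_vf vf(2)] eta_basis eta_bracket by simp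
  finally show ?thesis
    using g_phi_skew[OF t(3,2)] g_sym[OF t(2,4)] by (simp add: ppe)
qed

end

section \<open>Structure functions and Ricci tensor of a \<phi>-basis\<close>

context phi_frame
begin

text \<open>The structure functions: on \<open>U\<close>, \<open>[\<xi>, e] = - c e + (a\<^sub>3
    - a\<^sub>1 + 1) \<phi>e\<close> and
  \<open>[\<xi>, \<phi>e] = (a\<^sub>3 + a\<^sub>1 + 1) e + c \<phi>e\<close> and \<open>[e,
      \<phi>e] = - 2 \<xi> + a\<^sub>4 e - a\<^sub>5 \<phi>e\<close>.\<close>

definition cc :: "'a \<Rightarrow> real" where "cc q = - bcoef (frame e) 1 2 2 q"

definition a1 :: "'a \<Rightarrow> real" where
  "a1 q = (bcoef (frame e) 1 3 2 q - bcoef (frame e) 1 2 3 q) / 2"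

definition a3 :: "'a \<Rightarrow> real" where
  "a3 q = (bcoef (frame e) 1 3 2 q + bcoef (frame e) 1 2 3 q) / 2 - 1"

definition a4 :: "'a \<Rightarrow> real" where "a4 q = bcoef (frame e) 2 3 2 q"

definition a5 :: "'a \<Rightarrow> real" where "a5 q = - bcoef (frame e) 2 3 3 q"

lemma structure_smooth:
  "smooth_fun A U cc" "smooth_fun A U a1" "smooth_fun A U a3" "smooth_fun A U a4" "smooth_fun A
      U a5"
  unfolding cc_def[abs_def] a1_def[abs_def] a3_def[abs_def] a4_def[abs_def] a5_def[abs_def]
  by (intro smooth_fun_intros bcoef_smooth[OF basis_frame] basis_open)+

lemma bcoef_self: "q \<in> U \<Longrightarrow> bcoef (frame e) i i k q = 0"
proof -
  assume q: "q \<in> U"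
  have "lie_bracket A (frame e i) (frame e i) q = 0" by (auto simp: lie_bracket_def)
  then show ?thesis using g_zero_left[OF frame_tangent[OF basis_frame q]] by (simp add: bcoef_def)
qed

lemma bcoef_anti: "q \<in> U \<Longrightarrow> bcoef (frame e) i j k q = - bcoef (frame e) j i k
    q"
  unfolding bcoef_def bracket_anti[of "frame e i"]
  by (simp add: g_minus_left bracket_tangent[OF frame_vf[OF basis_frame] frame_vf[OF
      basis_frame] basis_open] frame_tangent[OF basis_frame])

lemma bcoef_eta: "q \<in> U \<Longrightarrow> bcoef (frame e) i j 1 q = \<eta> q (lie_bracket A
    (frame e i) (frame e j) q)"
  by (simp add: bcoef_def g_xi' bracket_tangent[OF frame_vf[OF basis_frame] frame_vf[OF
      basis_frame] basis_open])

lemma bcoef_eta_values: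
  assumes q: "q \<in> U"
  shows "bcoef (frame e) 1 2 1 q = 0" "bcoef (frame e) 1 3 1 q = 0" "bcoef (frame e) 2 3 1 q = -
      2"
  using eta_bracket[OF q] by (simp_all add: bcoef_eta q)

lemma bcoef_trace_free: "q \<in> U \<Longrightarrow> bcoef (frame e) 1 3 3 q = cc q"
  using bracket_trace_free by (simp add: bcoef_def cc_def)

text \<open>Four facts leave five free functions out of 27: vanishing diagonal brackets,
  antisymmetry, the \<xi>-components dictated by d\<eta>, and the trace-free relation.\<close>

lemma bcoef_table:
  assumes q: "q \<in> U"
  shows "bcoef (frame e) 1 1 1 q = 0"
    and "bcoef (frame e) 1 1 2 q = 0"
    and "bcoef (frame e) 1 1 3 q = 0"
    and "bcoef (frame e) 1 2 1 q = 0"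
    and "bcoef (frame e) 1 2 2 q = - cc q"
    and "bcoef (frame e) 1 2 3 q = 1 - a1 q + a3 q"
    and "bcoef (frame e) 1 3 1 q = 0"
    and "bcoef (frame e) 1 3 2 q = 1 + a1 q + a3 q"
    and "bcoef (frame e) 1 3 3 q = cc q"
    and "bcoef (frame e) 2 1 1 q = 0"
    and "bcoef (frame e) 2 1 2 q = cc q"
    and "bcoef (frame e) 2 1 3 q = - 1 + a1 q - a3 q"
    and "bcoef (frame e) 2 2 1 q = 0"
    and "bcoef (frame e) 2 2 2 q = 0"
    and "bcoef (frame e) 2 2 3 q = 0"
    and "bcoef (frame e) 2 3 1 q = - 2"
    and "bcoef (frame e) 2 3 2 q = a4 q"
    and "bcoef (frame e) 2 3 3 q = - a5 q"
    and "bcoef (frame e) 3 1 1 q = 0"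
    and "bcoef (frame e) 3 1 2 q = - 1 - a1 q - a3 q"
    and "bcoef (frame e) 3 1 3 q = - cc q"
    and "bcoef (frame e) 3 2 1 q = 2"
    and "bcoef (frame e) 3 2 2 q = - a4 q"
    and "bcoef (frame e) 3 2 3 q = a5 q"
    and "bcoef (frame e) 3 3 1 q = 0"
    and "bcoef (frame e) 3 3 2 q = 0"
    and "bcoef (frame e) 3 3 3 q = 0"
  using bcoef_eta_values[OF q] bcoef_trace_free[OF q]
  by (simp_all add: bcoef_self[OF q] bcoef_anti[OF q, of 2 1] bcoef_anti[OF q, of 3 1]
      bcoef_anti[OF q, of 3 2])
     (simp_all add: cc_def a1_def a3_def a4_def a5_def field_simps)

lemma ccoef_table:
  assumes q: "q \<in> U"
  shows "ccoef (frame e) 1 1 1 q = 0"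
    and "ccoef (frame e) 1 1 2 q = 0"
    and "ccoef (frame e) 1 1 3 q = 0"
    and "ccoef (frame e) 1 2 1 q = 0"
    and "ccoef (frame e) 1 2 2 q = 0"
    and "ccoef (frame e) 1 2 3 q = a3 q"
    and "ccoef (frame e) 1 3 1 q = 0"
    and "ccoef (frame e) 1 3 2 q = a3 q"
    and "ccoef (frame e) 1 3 3 q = 0"
    and "ccoef (frame e) 2 1 1 q = 0"
    and "ccoef (frame e) 2 1 2 q = cc q"
    and "ccoef (frame e) 2 1 3 q = - 1 + a1 q"
    and "ccoef (frame e) 2 2 1 q = - cc q"
    and "ccoef (frame e) 2 2 2 q = 0"
    and "ccoef (frame e) 2 2 3 q = a4 q"
    and "ccoef (frame e) 2 3 1 q = - 1 + a1 q"
    and "ccoef (frame e) 2 3 2 q = a4 q"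
    and "ccoef (frame e) 2 3 3 q = 0"
    and "ccoef (frame e) 3 1 1 q = 0"
    and "ccoef (frame e) 3 1 2 q = - 1 - a1 q"
    and "ccoef (frame e) 3 1 3 q = - cc q"
    and "ccoef (frame e) 3 2 1 q = 1 + a1 q"
    and "ccoef (frame e) 3 2 2 q = 0"
    and "ccoef (frame e) 3 2 3 q = a5 q"
    and "ccoef (frame e) 3 3 1 q = - cc q"
    and "ccoef (frame e) 3 3 2 q = a5 q"
    and "ccoef (frame e) 3 3 3 q = 0"
  by (simp_all add: ccoef_bcoef[OF basis_frame q] bcoef_table[OF q] field_simps)

lemma deriv_affine:
  assumes v: "v \<in> tangent_space A p" and p: "p \<in> U"
  shows "v (\<lambda>q. 0) = 0" "v (\<lambda>q. - cc q) = - v cc" "v (\<lambda>q. - 1 + a1 q) =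
      v a1"
    "v (\<lambda>q. 1 + a1 q) = v a1" "v (\<lambda>q. - 1 - a1 q) = - v a1"
proof -
  note n = smooth_nearI[OF basis_open p]
  note s = n[OF structure_smooth(1)] n[OF structure_smooth(2)] n[OF smooth_fun_const[OF
      basis_open]]
  show "v (\<lambda>q. 0) = 0" "v (\<lambda>q. - cc q) = - v cc" "v (\<lambda>q. - 1 + a1 q) = v
      a1"
    "v (\<lambda>q. 1 + a1 q) = v a1" "v (\<lambda>q. - 1 - a1 q) = - v a1"
    using tangent_apply_const[OF v] tangent_apply_minus[OF v s(1)]
      tangent_apply_add[OF v s(3) s(2), of "- 1"] tangent_apply_add[OF v s(3) s(2), of 1]
      tangent_apply_diff[OF v s(3) s(2), of "- 1"] by simp_all
qed

lemma deriv_ccoef: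
  assumes v: "v \<in> tangent_space A p" and p: "p \<in> U"
  shows "v (ccoef (frame e) 1 1 1) = 0"
    and "v (ccoef (frame e) 1 1 2) = 0"
    and "v (ccoef (frame e) 1 1 3) = 0"
    and "v (ccoef (frame e) 1 2 1) = 0"
    and "v (ccoef (frame e) 1 2 2) = 0"
    and "v (ccoef (frame e) 1 2 3) = v a3"
    and "v (ccoef (frame e) 1 3 1) = 0"
    and "v (ccoef (frame e) 1 3 2) = v a3"
    and "v (ccoef (frame e) 1 3 3) = 0"
    and "v (ccoef (frame e) 2 1 1) = 0"
    and "v (ccoef (frame e) 2 1 2) = v cc"
    and "v (ccoef (frame e) 2 1 3) = v a1"
    and "v (ccoef (frame e) 2 2 1) = - v cc"
    and "v (ccoef (frame e) 2 2 2) = 0"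
    and "v (ccoef (frame e) 2 2 3) = v a4"
    and "v (ccoef (frame e) 2 3 1) = v a1"
    and "v (ccoef (frame e) 2 3 2) = v a4"
    and "v (ccoef (frame e) 2 3 3) = 0"
    and "v (ccoef (frame e) 3 1 1) = 0"
    and "v (ccoef (frame e) 3 1 2) = - v a1"
    and "v (ccoef (frame e) 3 1 3) = - v cc"
    and "v (ccoef (frame e) 3 2 1) = v a1"
    and "v (ccoef (frame e) 3 2 2) = 0"
    and "v (ccoef (frame e) 3 2 3) = v a5"
    and "v (ccoef (frame e) 3 3 1) = - v cc"
    and "v (ccoef (frame e) 3 3 2) = v a5"
    and "v (ccoef (frame e) 3 3 3) = 0"
  by (rule trans, rule tangent_cong[OF v basis_open p], erule ccoef_table,
      (simp only: deriv_affine[OF v p])?)+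

text \<open>The mixed entries are computed in both orders because the symmetry of the Ricci tensor
  is not visible in these formulas. With \<xi> first they hold the derivatives of \<open>a3\<close>,
  \<open>a4\<close>, \<open>a5\<close> from the first two equations of the theorem, with \<xi>
  second those of \<open>a1\<close> and \<open>cc\<close> from the third.\<close>

lemma ricci_table:
  assumes p: "p \<in> U"
  shows "ricci A g \<xi> \<xi> p = - 2 + 2 * a1 p * a1 p - 2 * cc p * cc p"
    and "ricci A g \<xi> e p = - \<xi> p a5 + \<phi>e p a3 + a4 p + a1 p * a4 p + a3 p * a4 p +
        a5 p * cc p"
    and "ricci A g \<xi> \<phi>e p = - \<xi> p a4 + e p a3 + a5 p - a1 p * a5 p + a3 p * a5 p -
        a4 p * cc p"
    and "ricci A g e \<xi> p = e p cc + \<phi>e p a1 + 2 * a1 p * a4 p + 2 * a5 p * cc p"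
    and "ricci A g e e p = - \<xi> p cc - e p a5 + \<phi>e p a4 - 2 * a3 p - 2 * a1 p * a3 p +
        a4 p * a4 p - a5 p * a5 p"
    and "ricci A g e \<phi>e p = \<xi> p a1 + 2 * a3 p * cc p"
    and "ricci A g \<phi>e \<xi> p = - e p a1 - \<phi>e p cc - 2 * a1 p * a5 p - 2 * a4 p * cc p"
    and "ricci A g \<phi>e e p = \<xi> p a1 + 2 * a3 p * cc p"
    and "ricci A g \<phi>e \<phi>e p = - \<xi> p cc + e p a5 - \<phi>e p a4 + 2 * a3 p -
        2 * a1 p * a3 p - a4 p * a4 p + a5 p * a5 p"
proof -
  note D = deriv_ccoef[OF xi_tangent p] deriv_ccoef[OF basis_tangent(1)[OF p] p]
    deriv_ccoef[OF basis_tangent(2)[OF p] p]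
  show "ricci A g \<xi> \<xi> p = - 2 + 2 * a1 p * a1 p - 2 * cc p * cc p"
    using ricci_components[OF basis_frame p, of 1 1] by (simp add: sum_3 D bcoef_table[OF p]
        ccoef_table[OF p]) (simp add: algebra_simps)
  show "ricci A g \<xi> e p = - \<xi> p a5 + \<phi>e p a3 + a4 p + a1 p * a4 p + a3 p * a4 p +
      a5 p * cc p"
    using ricci_components[OF basis_frame p, of 1 2] by (simp add: sum_3 D bcoef_table[OF p]
        ccoef_table[OF p]) (simp add: algebra_simps)
  show "ricci A g \<xi> \<phi>e p = - \<xi> p a4 + e p a3 + a5 p - a1 p * a5 p + a3 p * a5 p -
      a4 p * cc p"
    using ricci_components[OF basis_frame p, of 1 3] by (simp add: sum_3 D bcoef_table[OF p]
        ccoef_table[OF p]) (simp add: algebra_simps)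
  show "ricci A g e \<xi> p = e p cc + \<phi>e p a1 + 2 * a1 p * a4 p + 2 * a5 p * cc p"
    using ricci_components[OF basis_frame p, of 2 1] by (simp add: sum_3 D bcoef_table[OF p]
        ccoef_table[OF p]) (simp add: algebra_simps)
  show "ricci A g e e p = - \<xi> p cc - e p a5 + \<phi>e p a4 - 2 * a3 p - 2 * a1 p * a3 p + a4
      p * a4 p - a5 p * a5 p"
    using ricci_components[OF basis_frame p, of 2 2] by (simp add: sum_3 D bcoef_table[OF p]
        ccoef_table[OF p]) (simp add: algebra_simps)
  show "ricci A g e \<phi>e p = \<xi> p a1 + 2 * a3 p * cc p"
    using ricci_components[OF basis_frame p, of 2 3] by (simp add: sum_3 D bcoef_table[OF p]
        ccoef_table[OF p]) (simp add: algebra_simps)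
  show "ricci A g \<phi>e \<xi> p = - e p a1 - \<phi>e p cc - 2 * a1 p * a5 p - 2 * a4 p * cc p"
    using ricci_components[OF basis_frame p, of 3 1] by (simp add: sum_3 D bcoef_table[OF p]
        ccoef_table[OF p]) (simp add: algebra_simps)
  show "ricci A g \<phi>e e p = \<xi> p a1 + 2 * a3 p * cc p"
    using ricci_components[OF basis_frame p, of 3 2] by (simp add: sum_3 D bcoef_table[OF p]
        ccoef_table[OF p]) (simp add: algebra_simps)
  show "ricci A g \<phi>e \<phi>e p = - \<xi> p cc + e p a5 - \<phi>e p a4 + 2 * a3 p - 2 * a1 p
      * a3 p - a4 p * a4 p + a5 p * a5 p"
    using ricci_components[OF basis_frame p, of 3 3] by (simp add: sum_3 D bcoef_table[OF p]
        ccoef_table[OF p]) (simp add: algebra_simps)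
qed

end

section \<open>Paracontact Ricci solitons\<close>

context manifold
begin

lemma tangent_apply_chart:
  assumes ch: "(V, c) \<in> A" "p \<in> V" and v: "v \<in> tangent_space A p" and f: "smooth_near A p f"
  shows "v f = frechet_derivative (\<lambda>x. f (inv_into V c x)) (at (c p)) (\<chi> i. v (\<lambda>q. c q $ i))"
proof -
  obtain w where w: "v = dir_deriv A (V, c) w p" using tangent_space_chart[OF ch v] .
  have "v (\<lambda>q. c q $ i) = w $ i" for i
    by (simp add: w dir_deriv_sum[OF ch] coord_field_coord[OF ch] if_distrib cong: if_cong)
  then have "(\<chi> i. v (\<lambda>q. c q $ i)) = w" by (simp add: vec_eq_iff)
  then show ?thesis using dir_deriv_eq[OF ch f chart_has_derivative[OF ch f]] by (simp add: w)
qed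

text \<open>The Euclidean dichotomy seen through a chart: a field becomes the vector of its
  coordinate components, and the derivative of a coordinate expression in that direction is the
  action of the field.\<close>

lemma smooth_zero_dichotomy:
  assumes U: "open U" "p \<in> U" and X: "X \<in> vector_fields A U" and Y: "Y \<in> vector_fields A U"
    and Z: "Z \<in> vector_fields A U"
    and indep: "\<And>a b c. a *\<^sub>T X p + b *\<^sub>T Y p + c *\<^sub>T Z p = 0 \<Longrightarrow> a = 0 \<and> b = 0 \<and> c = 0"
    and s: "smooth_fun A U f" "smooth_fun A U k" "smooth_fun A U \<alpha>" "smooth_fun A U \<beta>" "smooth_fun A U \<gamma>"
    and Xf: "\<And>q. q \<in> U \<Longrightarrow> X q f = \<alpha> q * f q" and Yf: "\<And>q. q \<in> U \<Longrightarrow> Y q f = \<beta> q * f q"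
    and Zk: "\<And>q. q \<in> U \<Longrightarrow> Z q k = \<gamma> q * k q" and fk: "\<And>q. q \<in> U \<Longrightarrow> f q * k q = 0"
  obtains W where "open W" "p \<in> W" "W \<subseteq> U" "(\<forall>q\<in>W. f q = 0) \<or> (\<forall>q\<in>W. k q = 0)"
proof -
  obtain V c where ch: "(V, c) \<in> A" "p \<in> V" by (rule ex_chart)
  let ?S = "c ` (V \<inter> U)" and ?i = "inv_into V c"
  let ?v = "\<lambda>X x. (\<chi> j. X (?i x) (\<lambda>q. c q $ j)) :: real ^ 3"
  have S: "open ?S" "c p \<in> ?S" using chart_open_map[OF ch(1) U(1)] ch U by auto
  have pt: "\<exists>q. q \<in> V \<and> q \<in> U \<and> x = c q \<and> ?i x = q" if "x \<in> ?S" for x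
    using that chart_inv[OF ch(1)] by auto
  have cont: "continuous_on ?S (?v X)" if X: "X \<in> vector_fields A U" for X
  proof (intro continuous_on_vec_lambda)
    fix j
    have "smooth_fun A (U \<inter> V) (\<lambda>q. X q (\<lambda>q. c q $ j))"
      using U chart_open[OF ch(1)]
      by (intro vf_smooth[OF X] smooth_fun_subset[OF smooth_fun_coord[OF ch(1)]]) auto
    note smooth_on_imp_continuous_on[OF smooth_funD[OF this ch(1)]]
    moreover have "V \<inter> (U \<inter> V) = V \<inter> U" by auto
    ultimately show "continuous_on ?S (\<lambda>x. X (?i x) (\<lambda>q. c q $ j))" by simp
  qed
  have contf: "continuous_on ?S (\<lambda>x. h (?i x))" if "smooth_fun A U h" for h
    by (rule smooth_on_imp_continuous_on[OF smooth_funD[OF that ch(1)]])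
  have D: "frechet_derivative (\<lambda>x. h (?i x)) (at x) (?v X x) = X (?i x) h"
    if X: "X \<in> vector_fields A U" and h: "smooth_fun A U h" and x: "x \<in> ?S" for X h x
  proof -
    obtain q where q: "q \<in> V" "q \<in> U" "x = c q" "?i x = q" using pt[OF x] by blast
    from tangent_apply_chart[OF ch(1) q(1) vf_tangent[OF X q(2)] smooth_nearI[OF U(1) q(2) h]]
    show ?thesis by (simp only: q(3,4) q(4)[unfolded q(3)])
  qed
  have ip: "?i (c p) = p" using chart_inv[OF ch(1)] ch(2) by simp
  have ind: "a = 0 \<and> b = 0 \<and> d = 0"
    if "a *\<^sub>R ?v X (c p) + b *\<^sub>R ?v Y (c p) + d *\<^sub>R ?v Z (c p) = 0" for a b d
  proof (rule indep)
    note t = vf_tangent[OF X U(2)] vf_tangent[OF Y U(2)] vf_tangent[OF Z U(2)]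
    let ?w = "a *\<^sub>T X p + b *\<^sub>T Y p + d *\<^sub>T Z p"
    have w: "?w \<in> tangent_space A p" by (intro tangent_intros t)
    have "?w (\<lambda>q. c q $ j) = 0" for j
      using arg_cong[OF that, of "\<lambda>x. x $ j"] by (simp add: ip tv_scale_apply)
    then show "?w = 0" by (subst tangent_expand_sum[OF ch w]) (simp add: tv_scale_def fun_eq_iff sum_tvec_apply)
  qed
  obtain r where r: "r > 0" "ball (c p) r \<subseteq> ?S"
    "(\<forall>x\<in>ball (c p) r. f (?i x) = 0) \<or> (\<forall>x\<in>ball (c p) r. k (?i x) = 0)"
  proof (rule zero_dichotomy[OF S smooth_funD[OF s(1) ch(1)] smooth_funD[OF s(2) ch(1)]
        cont[OF X] cont[OF Y] cont[OF Z] contf[OF s(3)] contf[OF s(4)] contf[OF s(5)] ind])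
    fix x assume x: "x \<in> ?S"
    then have iU: "?i x \<in> U" using pt by blast
    show "frechet_derivative (\<lambda>x. f (?i x)) (at x) (?v X x) = \<alpha> (?i x) * f (?i x)"
      using D[OF X s(1) x] Xf[OF iU] by simp
    show "frechet_derivative (\<lambda>x. f (?i x)) (at x) (?v Y x) = \<beta> (?i x) * f (?i x)"
      using D[OF Y s(1) x] Yf[OF iU] by simp
    show "frechet_derivative (\<lambda>x. k (?i x)) (at x) (?v Z x) = \<gamma> (?i x) * k (?i x)"
      using D[OF Z s(2) x] Zk[OF iU] by simp
    show "f (?i x) * k (?i x) = 0" using fk[OF iU] .
  qed auto
  \<comment> \<open>The coordinate ball is pulled back inside the chart domain, where
    \<open>inv_into V c\<close> undoes \<open>c\<close>.\<close>
  define W where "W = (c -` ball (c p) r \<inter> V) \<inter> U"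
  have "open (c -` ball (c p) r \<inter> V)"
    using continuous_on_open_vimage[OF chart_open[OF ch(1)], of c] chart_cont[OF ch(1)] by auto
  then have "open W" using U(1) by (simp add: W_def open_Int)
  moreover have "p \<in> W" using r(1) ch(2) U(2) by (simp add: W_def)
  moreover have "h q = 0" if "\<forall>x\<in>ball (c p) r. h (?i x) = 0" "q \<in> W" for h :: "'a \<Rightarrow> real" and q
    using bspec[OF that(1), of "c q"] that(2) chart_inv[OF ch(1), of q] by (auto simp: W_def)
  then have "(\<forall>q\<in>W. f q = 0) \<or> (\<forall>q\<in>W. k q = 0)" using r(3) by blast
  ultimately show ?thesis using that[of W] by (auto simp: W_def)
qed

end

section \<open>The soliton equation in a frame\<close>

context framed_manifold
begin

text \<open>The terms D_V X and D_V Y cancel between metric compatibility and vanishing torsion. In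
  the result X and Y are no longer differentiated, which makes the Lie derivative tensorial in
  them.\<close>

lemma lie_metric_lc:
  assumes U: "open U" "p \<in> U" and V: "V \<in> vector_fields A U" and X: "X \<in> vector_fields A U"
    and Y: "Y \<in> vector_fields A U"
  shows "lie_derivative_metric A V g X Y p = g p (LC X V p) (Y p) + g p (X p) (LC Y V p)"
proof -
  have l: "LC P Q p \<in> tangent_space A p" if "P \<in> vector_fields A U" "Q \<in> vector_fields A U" for P Q
    using vf_tangent[OF lc_vf[OF U(1) that] U(2)] .
  note t = vf_tangent[OF X U(2)] vf_tangent[OF Y U(2)] l[OF V X] l[OF X V] l[OF V Y] l[OF Y V]
  show ?thesis
    unfolding lie_derivative_metric_def lc_metric[OF U(1) V X Y U(2)]
      lc_torsion[OF U(1) V X U(2), symmetric] lc_torsion[OF U(1) V Y U(2), symmetric]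
    using t g_sym[OF t(1) tangent_diff[OF t(5,6)]] g_sym[OF t(1,5)] g_sym[OF t(1,6)]
    by (simp add: g_diff_left)
qed

lemma lc_frame1:
  assumes E: "orthonormal_frame A g s U E" "p \<in> U" and X: "X \<in> vector_fields A U"
    and Y: "Y \<in> vector_fields A U"
  shows "LC X Y p = (\<Sum>i\<in>UNIV. (s i * g p (X p) (E i p)) *\<^sub>T LC (E i) Y p)"
proof -
  note U = frame_open[OF E(1)] E(2) and e = frame_vf[OF E(1)]
  let ?y = "\<lambda>i q. s i * g q (X q) (E i q)"
  note y = frame_field_expand[OF E(1) X]
  have "LC (\<lambda>q. ?y 1 q *\<^sub>T E 1 q + ?y 2 q *\<^sub>T E 2 q + ?y 3 q *\<^sub>T E 3 q) Y p = LC X Y p"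
    by (rule lc_cong[OF U X Y y(4) refl])
  then show ?thesis
    unfolding lc_add1[OF U(1) y(3) Y y(2) U(2)] lc_add1[OF U(1) y(2) Y y(2) U(2)]
      lc_scale1[OF U(1) e Y y(1) U(2)]
    by (simp add: sum_3)
qed

lemma g_expand:
  assumes E: "orthonormal_frame A g s U E" "p \<in> U"
    and v: "v \<in> tangent_space A p" and w: "w \<in> tangent_space A p"
  shows "g p v w = (\<Sum>i\<in>UNIV. s i * g p v (E i p) * g p (E i p) w)"
proof -
  note t = frame_tangent[OF E]
  have "g p v w = g p (\<Sum>i\<in>UNIV. (s i * g p v (E i p)) *\<^sub>T E i p) w"
    using frame_expand[OF E v] by simp
  then show ?thesis by (simp add: g_sum_left g_scale_left tangent_scale t w)
qed

lemma lie_metric_expand: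
  assumes E: "orthonormal_frame A g s U E" "p \<in> U" and V: "V \<in> vector_fields A U"
    and X: "X \<in> vector_fields A U" and Y: "Y \<in> vector_fields A U"
  shows "lie_derivative_metric A V g X Y p = (\<Sum>b\<in>UNIV. s b * g p (X p) (E b p) *
    (\<Sum>c\<in>UNIV. s c * g p (Y p) (E c p) * lie_derivative_metric A V g (E b) (E c) p))"
proof -
  note U = frame_open[OF E(1)] E(2) and e = frame_vf[OF E(1)] and t = frame_tangent[OF E]
  note Xt = vf_tangent[OF X U(2)] and Yt = vf_tangent[OF Y U(2)]
  let ?D = "\<lambda>i. LC (E i) V p"
  have D: "?D i \<in> tangent_space A p" for i by (rule vf_tangent[OF lc_vf[OF U(1) e V] U(2)])
  have 1: "g p (LC X V p) w = (\<Sum>b\<in>UNIV. s b * g p (X p) (E b p) * g p (?D b) w)"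
    if "w \<in> tangent_space A p" for w
    unfolding lc_frame1[OF E X V] using that by (simp add: g_sum_left g_scale_left tangent_scale D)
  have 2: "g p v (LC Y V p) = (\<Sum>c\<in>UNIV. s c * g p (Y p) (E c p) * g p v (?D c))"
    if v: "v \<in> tangent_space A p" for v
    unfolding lc_frame1[OF E Y V] using v
    by (subst g_sym[OF v]) (simp_all add: tangent_sum g_sum_left g_scale_left tangent_scale D g_sym[OF D v])
  have 3: "g p v (Y p) = (\<Sum>c\<in>UNIV. s c * g p (Y p) (E c p) * g p v (E c p))"
    if v: "v \<in> tangent_space A p" for v
    using g_expand[OF E Yt v] g_sym[OF v Yt] g_sym[OF t v] by simp
  have 4: "g p (X p) v = (\<Sum>b\<in>UNIV. s b * g p (X p) (E b p) * g p (E b p) v)"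
    if v: "v \<in> tangent_space A p" for v
    by (rule g_expand[OF E Xt v])
  have "g p (X p) (LC Y V p) = (\<Sum>b\<in>UNIV. s b * g p (X p) (E b p) *
      (\<Sum>c\<in>UNIV. s c * g p (Y p) (E c p) * g p (E b p) (?D c)))"
    by (subst 4[OF vf_tangent[OF lc_vf[OF U(1) Y V] U(2)]]) (simp only: 2[OF t])
  moreover have "g p (LC X V p) (Y p) = (\<Sum>b\<in>UNIV. s b * g p (X p) (E b p) *
      (\<Sum>c\<in>UNIV. s c * g p (Y p) (E c p) * g p (?D b) (E c p)))"
    by (subst 1[OF Yt]) (simp only: 3[OF D])
  ultimately show ?thesis
    unfolding lie_metric_lc[OF U V X Y] lie_metric_lc[OF U V e e]
    by (simp add: sum.distrib distrib_left)
qed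

text \<open>Both sides of the soliton equation are bilinear over functions, so their components in
  one frame at each point decide, and the frame may vary with the point.\<close>

lemma ricci_soliton_frameI:
  assumes V: "V \<in> vector_fields A UNIV"
    and sol: "\<And>p. \<exists>U E. p \<in> U \<and> orthonormal_frame A g s U E \<and>
      (\<forall>b c. lie_derivative_metric A V g (E b) (E c) p + ricci A g (E b) (E c) p
        = l * (if b = c then s b else 0))"
  shows "ricci_soliton A g V l"
  unfolding ricci_soliton_def
proof (intro allI impI ballI)
  fix U X Y p assume U: "open U" and X: "X \<in> vector_fields A U" and Y: "Y \<in> vector_fields A U"
    and p: "p \<in> U"
  obtain W E where W: "p \<in> W" "orthonormal_frame A g s W E"
    and eq: "\<And>b c. lie_derivative_metric A V g (E b) (E c) p + ricci A g (E b) (E c) p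
        = l * (if b = c then s b else 0)"
    using sol[of p] by blast
  have E: "orthonormal_frame A g s (U \<inter> W) E" "p \<in> U \<inter> W"
    using frame_subset[OF W(2)] U frame_open[OF W(2)] W(1) p by auto
  have vf: "V \<in> vector_fields A (U \<inter> W)" "X \<in> vector_fields A (U \<inter> W)" "Y \<in> vector_fields A (U \<inter> W)"
    using vf_subset[OF V] vf_subset[OF X] vf_subset[OF Y] by auto
  note t = vf_tangent[OF X p] vf_tangent[OF Y p]
  let ?x = "\<lambda>i. s i * g p (X p) (E i p)" and ?y = "\<lambda>i. s i * g p (Y p) (E i p)"
  have "lie_derivative_metric A V g X Y p + ricci A g X Y p
      = (\<Sum>b\<in>UNIV. ?x b * (\<Sum>c\<in>UNIV. ?y c *
          (lie_derivative_metric A V g (E b) (E c) p + ricci A g (E b) (E c) p)))"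
    unfolding lie_metric_expand[OF E vf] ricci_expand[OF E vf(2,3)]
    by (simp add: sum.distrib distrib_left)
  also have "\<dots> = (\<Sum>b\<in>UNIV. ?x b * (l * g p (E b p) (Y p)))"
  proof (intro sum.cong refl arg_cong2[of _ _ _ _ "(*)"])
    fix b
    have "(\<Sum>c\<in>UNIV. ?y c * (lie_derivative_metric A V g (E b) (E c) p + ricci A g (E b) (E c) p))
        = ?y b * (l * s b)"
      unfolding eq by (simp add: if_distrib cong: if_cong)
    also have "\<dots> = l * g p (E b p) (Y p)"
      using sign[of b] g_sym[OF t(2) frame_tangent[OF E]] by (simp add: mult_ac)
    finally show "(\<Sum>c\<in>UNIV. ?y c * (lie_derivative_metric A V g (E b) (E c) p + ricci A g (E b) (E c) p))
        = l * g p (E b p) (Y p)" .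
  qed
  also have "\<dots> = l * g p (X p) (Y p)"
    unfolding g_expand[OF E t] by (simp add: sum_distrib_left mult_ac)
  finally show "lie_derivative_metric A V g X Y p + ricci A g X Y p = l * g p (X p) (Y p)" .
qed

end

context phi_frame
begin

lemma lie_metric_bcoef:
  assumes p: "p \<in> U"
  shows "lie_derivative_metric A \<xi> g (frame e b) (frame e d) p
    = - sign3 d * bcoef (frame e) 1 b d p - sign3 b * bcoef (frame e) 1 d b p"
proof -
  note t = frame_tangent[OF basis_frame p]
  have ss: "sign3 i * (sign3 i * x) = x" for i x by (simp add: sign3_def)
  have "\<xi> p (\<lambda>q. g q (frame e b q) (frame e d q)) = \<xi> p (\<lambda>q. if b = d then sign3 b else 0)"
    by (rule tangent_cong[OF xi_tangent basis_open p]) (rule frame_g[OF basis_frame])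
  also have "\<dots> = 0" by (rule tangent_apply_const[OF xi_tangent])
  finally show ?thesis
    using g_sym[OF t bracket_tangent[OF xi_vf frame_vf[OF basis_frame] basis_open p]]
    by (simp add: lie_derivative_metric_def bcoef_def ss)
qed

text \<open>The Lie derivative vanishes when \<xi> is an argument; on e, \<phi>e its diagonal
  entries are both 2 \<open>cc\<close> and its off-diagonal entry is -2 \<open>a1\<close>. Nine
  equations become eight since the Ricci table is symmetric in e and \<phi>e.\<close>

lemma soliton_at_iff:
  assumes p: "p \<in> U"
  shows "(\<forall>b d. lie_derivative_metric A \<xi> g (frame e b) (frame e d) p
        + ricci A g (frame e b) (frame e d) p = l * (if b = d then sign3 b else 0)) \<longleftrightarrow>
    ricci A g \<xi> \<xi> p = l \<and> ricci A g \<xi> e p = 0 \<and> ricci A g \<xi> \<phi>e p = 0 \<and>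
    ricci A g e \<xi> p = 0 \<and> ricci A g \<phi>e \<xi> p = 0 \<and>
    2 * cc p + ricci A g e e p = l \<and> 2 * cc p + ricci A g \<phi>e \<phi>e p = - l \<and>
    ricci A g e \<phi>e p = 2 * a1 p"
proof -
  have "ricci A g \<phi>e e p = ricci A g e \<phi>e p" by (simp add: ricci_table[OF p])
  then show ?thesis
    by (auto simp: forall_3 lie_metric_bcoef[OF p] bcoef_table[OF p])
qed

lemma scalar_curvature_ricci:
  assumes p: "p \<in> U"
  shows "scalar_curvature A g p = ricci A g \<xi> \<xi> p + ricci A g e e p - ricci A g \<phi>e \<phi>e p"
  by (simp add: scalar_curvature_frame[OF basis_frame p] sum_3)

lemma brackets:
  assumes p: "p \<in> U"
  shows "lie_bracket A \<xi> e p = (- cc p) *\<^sub>T e p + (a3 p - a1 p + 1) *\<^sub>T \<phi>e p"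
    and "lie_bracket A \<xi> \<phi>e p = (a3 p + a1 p + 1) *\<^sub>T e p + cc p *\<^sub>T \<phi>e p"
    and "lie_bracket A e \<phi>e p = (- 2) *\<^sub>T \<xi> p + a4 p *\<^sub>T e p - a5 p *\<^sub>T \<phi>e p"
  using bracket_frame[OF basis_frame p, of 1 2] bracket_frame[OF basis_frame p, of 1 3] bracket_frame[OF basis_frame p, of 2 3]
  by (simp_all add: sum_3 bcoef_table[OF p] fun_eq_iff tv_scale_apply)

text \<open>The trace and trace-free parts of the soliton equation: \<open>f = a\<^sub>1 + c\<close> and \<open>k = c - a\<^sub>1\<close>
  satisfy \<open>\<xi>(f k) = 4 f k\<close>, while \<open>f k\<close> is constant by the equation for \<open>\<rho>(\<xi>, \<xi>)\<close>.\<close>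

lemma soliton_consequences:
  assumes sol: "\<And>p. p \<in> U \<Longrightarrow>
      ricci A g \<xi> \<xi> p = l \<and> ricci A g \<xi> e p = 0 \<and> ricci A g \<xi> \<phi>e p = 0 \<and>
      ricci A g e \<xi> p = 0 \<and> ricci A g \<phi>e \<xi> p = 0 \<and>
      2 * cc p + ricci A g e e p = l \<and> 2 * cc p + ricci A g \<phi>e \<phi>e p = - l \<and>
      ricci A g e \<phi>e p = 2 * a1 p"
    and p: "p \<in> U"
  shows "l = - 2" and "(a1 p + cc p) * (cc p - a1 p) = 0"
    and "\<xi> p (\<lambda>q. a1 q + cc q) = (2 - 2 * a3 p) * (a1 p + cc p)"
    and "(e p + \<phi>e p) (\<lambda>q. a1 q + cc q) = (- 2 * (a4 p + a5 p)) * (a1 p + cc p)"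
    and "(e p - \<phi>e p) (\<lambda>q. cc q - a1 q) = (2 * (a4 p - a5 p)) * (cc p - a1 p)"
proof -
  note n = smooth_nearI[OF basis_open p] and S = structure_smooth
  note s = n[OF S(1)] n[OF S(2)]
  have add: "v (\<lambda>q. a1 q + cc q) = v a1 + v cc" "v (\<lambda>q. cc q - a1 q) = v cc - v a1"
    if "v \<in> tangent_space A p" for v
    using tangent_apply_add[OF that s(2,1)] tangent_apply_diff[OF that s] by auto
  note add' = add[OF xi_tangent] add[OF basis_tangent(1)[OF p]] add[OF basis_tangent(2)[OF p]]
  note eqs = sol[OF p, unfolded ricci_table[OF p]]
  \<comment> \<open>Adding the two diagonal equations eliminates the derivatives of
    \<open>a4\<close> and \<open>a5\<close> and leaves the derivative of \<open>cc\<close> along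
    \<xi>.\<close>
  have xi: "\<xi> p a1 = 2 * a1 p - 2 * a3 p * cc p" "\<xi> p cc = 2 * cc p - 2 * a1 p * a3 p"
    using eqs by linarith+
  have "\<xi> p (\<lambda>q. a1 q * a1 q - cc q * cc q) = \<xi> p (\<lambda>q. (l + 2) / 2)"
  proof (rule tangent_cong[OF xi_tangent basis_open p])
    fix q assume q: "q \<in> U"
    show "a1 q * a1 q - cc q * cc q = (l + 2) / 2"
      using conjunct1[OF sol[OF q, unfolded ricci_table[OF q]]] by (simp add: field_simps)
  qed
  also have "\<dots> = 0" by (rule tangent_apply_const[OF xi_tangent])
  finally have "\<xi> p (\<lambda>q. a1 q * a1 q - cc q * cc q) = 0" .
  moreover have "\<xi> p (\<lambda>q. a1 q * a1 q - cc q * cc q) = \<xi> p (\<lambda>q. a1 q * a1 q) - \<xi> p (\<lambda>q. cc q * cc q)"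
    by (intro tangent_apply_diff[OF xi_tangent] n smooth_fun_mult basis_open S)
  moreover have "\<xi> p (\<lambda>q. a1 q * a1 q) = a1 p * \<xi> p a1 + \<xi> p a1 * a1 p"
    "\<xi> p (\<lambda>q. cc q * cc q) = cc p * \<xi> p cc + \<xi> p cc * cc p"
    by (rule tangent_apply_mult[OF xi_tangent s(2,2)], rule tangent_apply_mult[OF xi_tangent s(1,1)])
  ultimately have "a1 p * \<xi> p a1 + \<xi> p a1 * a1 p - (cc p * \<xi> p cc + \<xi> p cc * cc p) = 0" by linarith
  then have z: "a1 p * a1 p - cc p * cc p = 0" unfolding xi by (simp add: algebra_simps)
  then show "l = - 2" using eqs by linarith
  show "(a1 p + cc p) * (cc p - a1 p) = 0" using z by (simp add: algebra_simps)
  show "\<xi> p (\<lambda>q. a1 q + cc q) = (2 - 2 * a3 p) * (a1 p + cc p)"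
    unfolding add'(1) xi by (simp add: algebra_simps)
  show "(e p + \<phi>e p) (\<lambda>q. a1 q + cc q) = (- 2 * (a4 p + a5 p)) * (a1 p + cc p)"
    using eqs add' by (simp add: algebra_simps)
  show "(e p - \<phi>e p) (\<lambda>q. cc q - a1 q) = (2 * (a4 p - a5 p)) * (cc p - a1 p)"
    using eqs add' by (simp add: algebra_simps)
qed

text \<open>e + \<phi>e and e - \<phi>e are the null directions of the contact plane; with \<xi>
  they form the transversal triple for the dichotomy.\<close>

lemma basis_independent:
  assumes p: "p \<in> U" and 0: "a *\<^sub>T \<xi> p + b *\<^sub>T (e p + \<phi>e p) + d *\<^sub>T (e p - \<phi>e p) = 0"
  shows "a = 0 \<and> b = 0 \<and> d = 0"
proof -
  let ?x = "\<lambda>i::3. if i = 1 then a else if i = 2 then b + d else b - d"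
  have "(\<Sum>i\<in>UNIV. ?x i *\<^sub>T frame e i p) = 0"
    using 0 by (simp add: sum_3 fun_eq_iff tv_scale_apply algebra_simps)
  then have "?x i = 0" for i
    using frame_component[OF basis_frame p, of i ?x] g_zero_left[OF frame_tangent[OF basis_frame p]] by simp
  from this[of 1] this[of 2] this[of 3] show ?thesis by simp
qed

end

section \<open>The two implications\<close>

context paracontact
begin

text \<open>Phrased exactly like the condition in the theorem, so that unfolding it closes the final
  goal.\<close>

definition local_form :: "'a \<Rightarrow> bool" where
  "local_form p0 \<longleftrightarrow> (\<exists>U e. \<exists>\<epsilon>\<in>{1, - 1 :: real}. \<exists>a1 a3 a4 a5.
       p0 \<in> U \<and> phi_basis A \<phi> \<xi> g U e \<and>
       smooth_fun A U a1 \<and> smooth_fun A U a3 \<and> smooth_fun A U a4 \<and> smooth_fun A U a5 \<and>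
       (\<forall>p\<in>U. let \<phi>e = (\<lambda>q. \<phi> q (e q)) in
          lie_bracket A \<xi> e p
            = (- \<epsilon> * a1 p) *\<^sub>T e p + (a3 p - a1 p + 1) *\<^sub>T \<phi>e p \<and>
          lie_bracket A \<xi> \<phi>e p
            = (a3 p + a1 p + 1) *\<^sub>T e p + (\<epsilon> * a1 p) *\<^sub>T \<phi>e p \<and>
          lie_bracket A e \<phi>e p
            = (- 2) *\<^sub>T \<xi> p + a4 p *\<^sub>T e p - a5 p *\<^sub>T \<phi>e p \<and>
          \<xi> p a4 - e p a3 + \<epsilon> * a1 p * a4 p - a5 p * (a3 p - a1 p + 1) = 0 \<and>
          \<xi> p a5 - \<phi>e p a3 - \<epsilon> * a1 p * a5 p - a4 p * (a3 p + a1 p + 1) = 0 \<and>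
          (e p + \<epsilon> *\<^sub>T \<phi>e p) a1 + 2 * \<epsilon> * a1 p * a4 p + 2 * a1 p * a5 p = 0 \<and>
          \<xi> p a1 + 2 * \<epsilon> * a1 p * a3 p = 2 * a1 p \<and>
          scalar_curvature A g p = - 6))"

lemma soliton_imp_local_form:
  assumes sol: "ricci_soliton A g \<xi> l"
  shows "l = - 2 \<and> local_form p0"
proof -
  obtain U e where p0: "p0 \<in> U" and basis: "phi_basis A \<phi> \<xi> g U e" using ex_phi_basis by blast
  interpret F: phi_frame A \<phi> \<xi> \<eta> g U e
    by unfold_locales (rule basis)
  have eqs: "ricci A g \<xi> \<xi> p = l \<and> ricci A g \<xi> e p = 0 \<and> ricci A g \<xi> F.\<phi>e p = 0 \<and>
      ricci A g e \<xi> p = 0 \<and> ricci A g F.\<phi>e \<xi> p = 0 \<and>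
      2 * F.cc p + ricci A g e e p = l \<and> 2 * F.cc p + ricci A g F.\<phi>e F.\<phi>e p = - l \<and>
      ricci A g e F.\<phi>e p = 2 * F.a1 p" if p: "p \<in> U" for p
  proof (rule iffD1[OF F.soliton_at_iff[OF p]], intro allI)
    fix b d
    show "lie_derivative_metric A \<xi> g (frame e b) (frame e d) p
        + ricci A g (frame e b) (frame e d) p = l * (if b = d then sign3 b else 0)"
      using sol F.basis_open frame_vf[OF F.basis_frame] p frame_g[OF F.basis_frame p]
      unfolding ricci_soliton_def by simp
  qed
  note C = F.soliton_consequences[OF eqs]
  have l: "l = - 2" using C(1)[OF _ p0] by simp
  note S = F.structure_smooth and op = F.basis_open
  obtain W where W: "open W" "p0 \<in> W" "W \<subseteq> U"
    "(\<forall>q\<in>W. F.a1 q + F.cc q = 0) \<or> (\<forall>q\<in>W. F.cc q - F.a1 q = 0)"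
  proof (rule smooth_zero_dichotomy[OF op p0 xi_vf vf_add[OF F.e_vf F.phie_vf] vf_diff[OF F.e_vf F.phie_vf]
        F.basis_independent[OF p0]])
    show "smooth_fun A U (\<lambda>q. F.a1 q + F.cc q)" "smooth_fun A U (\<lambda>q. F.cc q - F.a1 q)"
      "smooth_fun A U (\<lambda>q. 2 - 2 * F.a3 q)" "smooth_fun A U (\<lambda>q. - 2 * (F.a4 q + F.a5 q))"
      "smooth_fun A U (\<lambda>q. 2 * (F.a4 q - F.a5 q))"
      by (intro smooth_fun_intros op S)+
  qed (use C(2-5) in auto)
  \<comment> \<open>If both alternatives hold, then \<open>a1\<close> and \<open>cc\<close> vanish
    on \<open>W\<close> and the sign 1 is taken.\<close>
  define \<epsilon> :: real where "\<epsilon> = (if \<forall>q\<in>W. F.cc q - F.a1 q = 0 then 1 else - 1)"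
  have \<epsilon>: "\<epsilon> \<in> {1, - 1}" "\<epsilon> * \<epsilon> = 1" by (auto simp: \<epsilon>_def)
  have cc: "F.cc q = \<epsilon> * F.a1 q" if "q \<in> W" for q
    using W(4) that by (auto simp: \<epsilon>_def algebra_simps add_eq_0_iff)
  \<comment> \<open>The relation between \<open>cc\<close> and \<open>a1\<close> can be
    differentiated because \<epsilon> is constant on the open set \<open>W\<close>; this is what the
    dichotomy was for.\<close>
  have dcc: "v F.cc = \<epsilon> * v F.a1" if v: "v \<in> tangent_space A q" and q: "q \<in> W" for v q
  proof -
    have qU: "q \<in> U" using q W(3) by auto
    have "v F.cc = v (\<lambda>q. \<epsilon> * F.a1 q)" by (rule tangent_cong[OF v W(1) q cc])
    also have "\<dots> = \<epsilon> * v F.a1 + v (\<lambda>q. \<epsilon>) * F.a1 q"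
      by (intro tangent_apply_mult[OF v] smooth_nearI[OF op qU] S smooth_fun_const op)
    finally show ?thesis by (simp add: tangent_apply_const[OF v])
  qed
  have "phi_basis A \<phi> \<xi> g W e"
    using basis W vf_subset[OF F.e_vf W(3)] by (auto simp: phi_basis_def)
  moreover have "let \<phi>e = (\<lambda>q. \<phi> q (e q)) in
      lie_bracket A \<xi> e p = (- \<epsilon> * F.a1 p) *\<^sub>T e p + (F.a3 p - F.a1 p + 1) *\<^sub>T \<phi>e p \<and>
      lie_bracket A \<xi> \<phi>e p = (F.a3 p + F.a1 p + 1) *\<^sub>T e p + (\<epsilon> * F.a1 p) *\<^sub>T \<phi>e p \<and>
      lie_bracket A e \<phi>e p = (- 2) *\<^sub>T \<xi> p + F.a4 p *\<^sub>T e p - F.a5 p *\<^sub>T \<phi>e p \<and>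
      \<xi> p F.a4 - e p F.a3 + \<epsilon> * F.a1 p * F.a4 p - F.a5 p * (F.a3 p - F.a1 p + 1) = 0 \<and>
      \<xi> p F.a5 - \<phi>e p F.a3 - \<epsilon> * F.a1 p * F.a5 p - F.a4 p * (F.a3 p + F.a1 p + 1) = 0 \<and>
      (e p + \<epsilon> *\<^sub>T \<phi>e p) F.a1 + 2 * \<epsilon> * F.a1 p * F.a4 p + 2 * F.a1 p * F.a5 p = 0 \<and>
      \<xi> p F.a1 + 2 * \<epsilon> * F.a1 p * F.a3 p = 2 * F.a1 p \<and>
      scalar_curvature A g p = - 6" if p: "p \<in> W" for p
  proof -
    have pU: "p \<in> U" using p W(3) by auto
    note E = eqs[OF pU]
    note E' = E[unfolded F.ricci_table[OF pU] dcc[OF xi_tangent p] dcc[OF F.basis_tangent(1)[OF pU] p]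
        dcc[OF F.basis_tangent(2)[OF pU] p] cc[OF p]]
    \<comment> \<open>The third equation is \<rho>(e, \<xi>) = 0 multiplied by \<epsilon>, using
      \<epsilon>^2 = 1.\<close>
    have "\<epsilon> * (\<epsilon> * e p F.a1 + \<phi> p (e p) F.a1 + 2 * F.a1 p * F.a4 p + 2 * F.a5 p * (\<epsilon> * F.a1 p)) = 0"
      using E' by simp
    moreover have "\<epsilon> * (\<epsilon> * x) = x" for x using \<epsilon>(2) by (simp flip: mult.assoc)
    ultimately have "(e p + \<epsilon> *\<^sub>T \<phi> p (e p)) F.a1 + 2 * \<epsilon> * F.a1 p * F.a4 p + 2 * F.a1 p * F.a5 p = 0"
      by (simp add: tv_scale_apply algebra_simps)
    \<comment> \<open>The contributions 2 \<open>cc\<close> of the Lie derivative cancel in the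
      trace because e and \<phi>e have opposite signs, so r = 3 l.\<close>
    moreover have "scalar_curvature A g p = - 6"
      using F.scalar_curvature_ricci[OF pU] E l by linarith
    ultimately show ?thesis
      using F.brackets[OF pU] E' by (simp add: Let_def cc[OF p] algebra_simps)
  qed
  ultimately have "local_form p0"
    unfolding local_form_def using W(2) \<epsilon>(1) smooth_fun_subset[OF S(2) W(3)]
      smooth_fun_subset[OF S(3) W(3)] smooth_fun_subset[OF S(4) W(3)] smooth_fun_subset[OF S(5) W(3)]
    by (intro exI[of _ W] exI[of _ e] bexI[of _ \<epsilon>] exI[of _ F.a1] exI[of _ F.a3] exI[of _ F.a4]
        exI[of _ F.a5] conjI ballI) auto
  with l show ?thesis by simp
qed

lemma local_form_imp_soliton:
  assumes loc: "\<And>p0. local_form p0"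
  shows "ricci_soliton A g \<xi> (- 2)"
proof (rule ricci_soliton_frameI[OF xi_vf])
  fix p
  obtain U e \<epsilon> b1 b3 b4 b5 where p: "p \<in> U" and \<epsilon>: "\<epsilon> \<in> {1, - 1 :: real}"
    and basis: "phi_basis A \<phi> \<xi> g U e"
    and eqs: "\<And>p. p \<in> U \<Longrightarrow>
      lie_bracket A \<xi> e p = (- \<epsilon> * b1 p) *\<^sub>T e p + (b3 p - b1 p + 1) *\<^sub>T \<phi> p (e p) \<and>
      lie_bracket A \<xi> (\<lambda>q. \<phi> q (e q)) p = (b3 p + b1 p + 1) *\<^sub>T e p + (\<epsilon> * b1 p) *\<^sub>T \<phi> p (e p) \<and>
      lie_bracket A e (\<lambda>q. \<phi> q (e q)) p = (- 2) *\<^sub>T \<xi> p + b4 p *\<^sub>T e p - b5 p *\<^sub>T \<phi> p (e p) \<and>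
      \<xi> p b4 - e p b3 + \<epsilon> * b1 p * b4 p - b5 p * (b3 p - b1 p + 1) = 0 \<and>
      \<xi> p b5 - \<phi> p (e p) b3 - \<epsilon> * b1 p * b5 p - b4 p * (b3 p + b1 p + 1) = 0 \<and>
      (e p + \<epsilon> *\<^sub>T \<phi> p (e p)) b1 + 2 * \<epsilon> * b1 p * b4 p + 2 * b1 p * b5 p = 0 \<and>
      \<xi> p b1 + 2 * \<epsilon> * b1 p * b3 p = 2 * b1 p \<and>
      scalar_curvature A g p = - 6"
    using loc[of p] unfolding local_form_def Let_def by blast
  interpret F: phi_frame A \<phi> \<xi> \<eta> g U e
    by unfold_locales (rule basis)
  \<comment> \<open>The given functions are coefficients of brackets in a frame, and such
    coefficients are unique; hence they agree on \<open>U\<close> with the structure functions of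
    the \<phi>-basis.\<close>
  have coef: "bcoef (frame e) 1 2 i q = (if i = 1 then 0 else if i = 2 then - \<epsilon> * b1 q else b3 q - b1 q + 1)"
    "bcoef (frame e) 1 3 i q = (if i = 1 then 0 else if i = 2 then b3 q + b1 q + 1 else \<epsilon> * b1 q)"
    "bcoef (frame e) 2 3 i q = (if i = 1 then - 2 else if i = 2 then b4 q else - b5 q)"
    if q: "q \<in> U" for q i
  proof -
    let ?x = "\<lambda>i::3. if i = 1 then 0 else if i = 2 then - \<epsilon> * b1 q else b3 q - b1 q + 1"
    let ?y = "\<lambda>i::3. if i = 1 then 0 else if i = 2 then b3 q + b1 q + 1 else \<epsilon> * b1 q"
    let ?z = "\<lambda>i::3. if i = 1 then - 2 else if i = 2 then b4 q else - b5 q"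
    have "lie_bracket A (frame e 1) (frame e 2) q = (\<Sum>i\<in>UNIV. ?x i *\<^sub>T frame e i q)"
      "lie_bracket A (frame e 1) (frame e 3) q = (\<Sum>i\<in>UNIV. ?y i *\<^sub>T frame e i q)"
      "lie_bracket A (frame e 2) (frame e 3) q = (\<Sum>i\<in>UNIV. ?z i *\<^sub>T frame e i q)"
      using eqs[OF q] by (simp_all add: sum_3 fun_eq_iff tv_scale_apply)
    then show "bcoef (frame e) 1 2 i q = ?x i" "bcoef (frame e) 1 3 i q = ?y i"
      "bcoef (frame e) 2 3 i q = ?z i"
      unfolding bcoef_def by (simp_all only: frame_component[OF F.basis_frame q])
  qed
  have val: "F.cc q = \<epsilon> * F.a1 q" "F.a1 q = b1 q" "F.a3 q = b3 q" "F.a4 q = b4 q" "F.a5 q = b5 q"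
    if "q \<in> U" for q
    using coef[OF that]
    by (simp_all add: F.cc_def F.a1_def F.a3_def F.a4_def F.a5_def field_simps)
  \<comment> \<open>Agreement on the open set \<open>U\<close> carries over to derivatives at
    \<open>p\<close>.\<close>
  have der: "v F.cc = \<epsilon> * v b1" "v F.a1 = v b1" "v F.a3 = v b3" "v F.a4 = v b4" "v F.a5 = v b5"
    if v: "v \<in> tangent_space A p" for v
  proof -
    show "v F.a1 = v b1" "v F.a3 = v b3" "v F.a4 = v b4" "v F.a5 = v b5"
      by (rule tangent_cong[OF v F.basis_open p], erule val)+
    have "v F.cc = v (\<lambda>q. \<epsilon> * F.a1 q)" by (rule tangent_cong[OF v F.basis_open p], erule val)
    also have "\<dots> = \<epsilon> * v F.a1 + v (\<lambda>q. \<epsilon>) * F.a1 p"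
      by (intro tangent_apply_mult[OF v] smooth_nearI[OF F.basis_open p] F.structure_smooth
          smooth_fun_const F.basis_open)
    finally show "v F.cc = \<epsilon> * v b1"
      using \<open>v F.a1 = v b1\<close> by (simp add: tangent_apply_const[OF v])
  qed
  note tab = F.ricci_table[OF p, unfolded val[OF p] der[OF xi_tangent]
      der[OF F.basis_tangent(1)[OF p]] der[OF F.basis_tangent(2)[OF p]]]
  \<comment> \<open>As c^2 = \<open>a1\<close>^2 gives \<rho>(\<xi>, \<xi>) = -2, the value r = -6
    fixes \<rho>(e, e) - \<rho>(\<phi>e, \<phi>e) = -4; the equation for \<xi>(\<open>a1\<close>)
    fixes the sum of these two entries.\<close>
  have "ricci A g \<xi> \<xi> p + ricci A g e e p - ricci A g F.\<phi>e F.\<phi>e p = - 6"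
    using F.scalar_curvature_ricci[OF p] eqs[OF p] by simp
  note r = this[unfolded tab]
  have "ricci A g \<xi> \<xi> p = - 2 \<and> ricci A g \<xi> e p = 0 \<and> ricci A g \<xi> F.\<phi>e p = 0 \<and>
    ricci A g e \<xi> p = 0 \<and> ricci A g F.\<phi>e \<xi> p = 0 \<and>
    2 * F.cc p + ricci A g e e p = - 2 \<and> 2 * F.cc p + ricci A g F.\<phi>e F.\<phi>e p = - (- 2) \<and>
    ricci A g e F.\<phi>e p = 2 * F.a1 p"
    unfolding tab val[OF p] using \<epsilon>
  proof (elim insertE emptyE; intro conjI)
  qed (use r eqs[OF p] in \<open>simp_all add: tv_scale_apply algebra_simps\<close>)
  then have "\<forall>b c. lie_derivative_metric A \<xi> g (frame e b) (frame e c) p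
      + ricci A g (frame e b) (frame e c) p = - 2 * (if b = c then sign3 b else 0)"
    by (rule iffD2[OF F.soliton_at_iff[OF p]])
  then show "\<exists>U E. p \<in> U \<and> orthonormal_frame A g sign3 U E \<and>
      (\<forall>b c. lie_derivative_metric A \<xi> g (E b) (E c) p + ricci A g (E b) (E c) p
        = - 2 * (if b = c then sign3 b else 0))"
    using p F.basis_frame by blast
qed

end

theorem theorem3p4:
  fixes A :: "('a::{t2_space,second_countable_topology}) atlas"
    and \<phi> :: "'a \<Rightarrow> 'a tvec \<Rightarrow> 'a tvec"
    and \<xi> :: "'a vfield"
    and \<eta> :: "'a \<Rightarrow> 'a tvec \<Rightarrow> real"
    and g :: "'a metric_field"
  assumes "smooth_manifold A"
    and "connected (UNIV :: 'a set)"
    and "paracontact_metric A \<phi> \<xi> \<eta> g"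
  shows "(\<forall>l. ricci_soliton A g \<xi> l \<longleftrightarrow>
            l = - 2 \<and>
            (\<forall>p0. \<exists>U e. \<exists>\<epsilon>\<in>{1, - 1 :: real}. \<exists>a1 a3 a4 a5.
               p0 \<in> U \<and> phi_basis A \<phi> \<xi> g U e \<and>
               smooth_fun A U a1 \<and> smooth_fun A U a3 \<and> smooth_fun A U a4 \<and> smooth_fun A U a5 \<and>
               (\<forall>p\<in>U. let \<phi>e = (\<lambda>q. \<phi> q (e q)) in
                  lie_bracket A \<xi> e p
                    = (- \<epsilon> * a1 p) *\<^sub>T e p + (a3 p - a1 p + 1) *\<^sub>T \<phi>e p \<and>
                  lie_bracket A \<xi> \<phi>e p
                    = (a3 p + a1 p + 1) *\<^sub>T e p + (\<epsilon> * a1 p) *\<^sub>T \<phi>e p \<and>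
                  lie_bracket A e \<phi>e p
                    = (- 2) *\<^sub>T \<xi> p + a4 p *\<^sub>T e p - a5 p *\<^sub>T \<phi>e p \<and>
                  \<xi> p a4 - e p a3 + \<epsilon> * a1 p * a4 p - a5 p * (a3 p - a1 p + 1) = 0 \<and>
                  \<xi> p a5 - \<phi>e p a3 - \<epsilon> * a1 p * a5 p - a4 p * (a3 p + a1 p + 1) = 0 \<and>
                  (e p + \<epsilon> *\<^sub>T \<phi>e p) a1 + 2 * \<epsilon> * a1 p * a4 p + 2 * a1 p * a5 p = 0 \<and>
                  \<xi> p a1 + 2 * \<epsilon> * a1 p * a3 p = 2 * a1 p \<and>
                  scalar_curvature A g p = - 6)))
         \<and> (\<forall>l. ricci_soliton A g \<xi> l \<longrightarrow> expanding l)"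
proof -
  interpret paracontact A \<phi> \<xi> \<eta> g
    by unfold_locales (rule assms)+
  have "ricci_soliton A g \<xi> l \<longleftrightarrow> l = - 2 \<and> (\<forall>p0. local_form p0)" for l
    using soliton_imp_local_form local_form_imp_soliton by blast
  then show ?thesis unfolding local_form_def by auto
qed

end
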